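(* Let $d\ge3$, $m<1$, $m_c=(d-2)/d$, $p_c=d(1-m)/2$, and let $p\ge 1$ if $m>m_c$, or $p>p_c$ if $m\le m_c$. Put $\vartheta_p=1/(2p-d(1-m))$. There are positive constants $\mathcal{C}_1,\mathcal{C}_2$ depending only on $m,d,p$ such that the following holds. Let $\Omega\subset\mathbb{R}^d$ be a domain, $0<T\le\infty$, and let $u\ge 0$ be a local weak solution of $\partial_tu=\Delta(u^m/m)$ in $(0,T)\times\Omega$ with initial data $u_0\in L^p_{loc}(\Omega)$. Then for every $x_0\in\Omega$, every $0<R_0\le\mathrm{dist}(x_0,\partial\Omega)$ and every $0<t<T$ $$u(t,x_0)\le\frac{\mathcal{C}_1}{t^{d\vartheta_p}}\left[\int_{B_{R_0}(x_0)}|u_0(x)|^p\,dx\right]^{2\vartheta_p}+\mathcal{C}_2\left[\frac{t}{R_0^2}\right]^{\frac1{1-m}}.$$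
   Context: $B_r(x_0)$ is the open ball of radius $r$ centered at $x_0$. For $m=0$, $u^m/m$ is read as $\log u$. Values $m\le 0$ are allowed. By existing theory, solutions are assumed positive and smooth as long as they do not extinguish identically. *)

theory Defs
  imports "HOL-Analysis.Analysis"
begin

subsection \<open>Smooth functions and test functions\<close>

definition partial :: "'a::euclidean_space \<Rightarrow> ('a \<Rightarrow> real) \<Rightarrow> 'a \<Rightarrow> real" where
  "partial v f z = frechet_derivative f (at z) v"

text \<open>Intended for open sets \<open>S\<close> only.\<close>

fun Ck_on :: "nat \<Rightarrow> 'a::euclidean_space set \<Rightarrow> ('a \<Rightarrow> real) \<Rightarrow> bool" where
  "Ck_on 0 S f \<longleftrightarrow> continuous_on S f"
| "Ck_on (Suc k) S f \<longleftrightarrow> (\<forall>z\<in>S. f differentiable (at z)) \<and> (\<forall>v. Ck_on k S (partial v f))"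

definition smooth_on :: "'a::euclidean_space set \<Rightarrow> ('a \<Rightarrow> real) \<Rightarrow> bool" where
  "smooth_on S f \<longleftrightarrow> (\<forall>k. Ck_on k S f)"

definition test_function :: "'a::euclidean_space set \<Rightarrow> ('a \<Rightarrow> real) \<Rightarrow> bool" where
  "test_function S \<phi> \<longleftrightarrow>
     smooth_on UNIV \<phi> \<and> (\<exists>K. compact K \<and> K \<subseteq> S \<and> (\<forall>z. z \<notin> K \<longrightarrow> \<phi> z = 0))"

text \<open>Points of space-time are pairs \<open>(t, x)\<close>; the Laplacian acts on \<open>x\<close> only.\<close>

definition dt :: "(real \<times> (real^'n::finite) \<Rightarrow> real) \<Rightarrow> real \<times> (real^'n) \<Rightarrow> real" where
  "dt \<phi> = partial (1, 0) \<phi>"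

definition laplace_x :: "(real \<times> (real^'n::finite) \<Rightarrow> real) \<Rightarrow> real \<times> (real^'n) \<Rightarrow> real" where
  "laplace_x \<phi> z = (\<Sum>i\<in>UNIV. partial (0, axis i 1) (partial (0, axis i 1) \<phi>) z)"


subsection \<open>Local Lebesgue spaces\<close>

definition Lp_loc :: "real \<Rightarrow> 'a::euclidean_space set \<Rightarrow> ('a \<Rightarrow> real) \<Rightarrow> bool" where
  "Lp_loc p S f \<longleftrightarrow> (\<forall>K. compact K \<and> K \<subseteq> S \<longrightarrow>
     set_borel_measurable lebesgue K f \<and> set_integrable lebesgue K (\<lambda>x. \<bar>f x\<bar> powr p))"

definition tendsto_L1_loc ::
    "'a::euclidean_space set \<Rightarrow> (real \<Rightarrow> 'a \<Rightarrow> real) \<Rightarrow> ('a \<Rightarrow> real) \<Rightarrow> real filter \<Rightarrow> bool" where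
  "tendsto_L1_loc S u v F \<longleftrightarrow> (\<forall>K. compact K \<and> K \<subseteq> S \<longrightarrow>
     ((\<lambda>s. set_lebesgue_integral lebesgue K (\<lambda>x. \<bar>u s x - v x\<bar>)) \<longlongrightarrow> 0) F)"


subsection \<open>Local weak solutions of the fast diffusion equation\<close>

definition fde_Phi :: "real \<Rightarrow> real \<Rightarrow> real" where
  "fde_Phi m r = (if m = 0 then ln r else r powr m / m)"

definition cylinder :: "ereal \<Rightarrow> (real^'n::finite) set \<Rightarrow> (real \<times> (real^'n)) set" where
  "cylinder T \<Omega> = {(t, x). 0 < t \<and> ereal t < T \<and> x \<in> \<Omega>}"

text \<open>
  The part of the cylinder where \<open>u^m / m\<close> makes sense: everything if \<open>m > 0\<close>, but only
  \<open>{u > 0}\<close>, that is the time before extinction, if \<open>m \<le> 0\<close> (where \<open>ln 0\<close> and \<open>0 powr m\<close>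
  are meaningless default values).
\<close>

definition fde_region ::
    "real \<Rightarrow> ereal \<Rightarrow> (real^'n::finite) set \<Rightarrow> (real \<Rightarrow> (real^'n) \<Rightarrow> real) \<Rightarrow> (real \<times> (real^'n)) set" where
  "fde_region m T \<Omega> u = {(t, x) \<in> cylinder T \<Omega>. m > 0 \<or> u t x > 0}"

text \<open>
  The weak formulation carries both space derivatives on the test function; for solutions
  having \<open>\<nabla>(u^m)\<close> in \<open>L^1_loc\<close> this is the formulation with the gradients,
  integrated by parts once more.
\<close>

definition fde_weak_equation ::
    "real \<Rightarrow> ereal \<Rightarrow> (real^'n::finite) set \<Rightarrow> (real \<Rightarrow> (real^'n) \<Rightarrow> real) \<Rightarrow> bool" where
  "fde_weak_equation m T \<Omega> u \<longleftrightarrow>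
     Lp_loc 1 (cylinder T \<Omega>) (\<lambda>(t, x). u t x) \<and>
     Lp_loc 1 (fde_region m T \<Omega> u) (\<lambda>(t, x). fde_Phi m (u t x)) \<and>
     (\<forall>\<phi>. test_function (fde_region m T \<Omega> u) \<phi> \<longrightarrow>
        (LINT z|lebesgue. (case z of (t, x) \<Rightarrow>
            u t x * dt \<phi> (t, x) + fde_Phi m (u t x) * laplace_x \<phi> (t, x))) = 0)"

text \<open>
  The standing regularity convention: at each time \<open>u\<close> is either positive throughout \<open>\<Omega>\<close> or
  has become extinct for good, and it is smooth where it is positive.
\<close>

definition positive_smooth_until_extinction ::
    "ereal \<Rightarrow> (real^'n::finite) set \<Rightarrow> (real \<Rightarrow> (real^'n) \<Rightarrow> real) \<Rightarrow> bool" where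
  "positive_smooth_until_extinction T \<Omega> u \<longleftrightarrow>
     (\<forall>t. 0 < t \<and> ereal t < T \<longrightarrow>
        (\<forall>x\<in>\<Omega>. u t x > 0) \<or> (\<forall>s. t \<le> s \<and> ereal s < T \<longrightarrow> (\<forall>x\<in>\<Omega>. u s x = 0))) \<and>
     smooth_on {(t, x) \<in> cylinder T \<Omega>. u t x > 0} (\<lambda>(t, x). u t x)"

text \<open>
  \<open>u\<close> belongs to \<open>C([0,T); L^1_loc(\<Omega>))\<close> with \<open>u(0) = u0\<close>; the value of the function \<open>u\<close> at
  \<open>t = 0\<close> (or at any point outside the cylinder) is irrelevant.
\<close>

definition local_weak_solution ::
    "real \<Rightarrow> ereal \<Rightarrow> (real^'n::finite) set \<Rightarrow> (real^'n \<Rightarrow> real) \<Rightarrow> (real \<Rightarrow> (real^'n) \<Rightarrow> real) \<Rightarrow> bool"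
  where
  "local_weak_solution m T \<Omega> u0 u \<longleftrightarrow>
     (\<forall>t x. (t, x) \<in> cylinder T \<Omega> \<longrightarrow> u t x \<ge> 0) \<and>
     Lp_loc 1 \<Omega> u0 \<and>
     (\<forall>t. 0 < t \<and> ereal t < T \<longrightarrow> Lp_loc 1 \<Omega> (u t) \<and> tendsto_L1_loc \<Omega> u (u t) (at t)) \<and>
     tendsto_L1_loc \<Omega> u u0 (at_right 0) \<and>
     fde_weak_equation m T \<Omega> u \<and>
     positive_smooth_until_extinction T \<Omega> u"


subsection \<open>Exponents\<close>

definition m_crit :: "nat \<Rightarrow> real" where
  "m_crit d = (real d - 2) / real d"

definition p_crit :: "nat \<Rightarrow> real \<Rightarrow> real" where
  "p_crit d m = real d * (1 - m) / 2"

definition theta :: "nat \<Rightarrow> real \<Rightarrow> real \<Rightarrow> real" where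
  "theta d m p = 1 / (2 * p - real d * (1 - m))"

text \<open>Power with a positive exponent \<open>a\<close>, extended by \<open>\<infinity>^a = \<infinity>\<close>.\<close>

definition ennreal_powr :: "ennreal \<Rightarrow> real \<Rightarrow> ennreal" where
  "ennreal_powr r a = (if r = \<infinity> then \<infinity> else ennreal (enn2real r powr a))"

end

theory Submission
  imports Defs
begin

text \<open>
  The equation is \<open>u\<^sub>t = u\<^bsup>m-1\<^esup> \<Delta>u + (m-1) u\<^bsup>m-2\<^esup> |\<nabla>u|\<^sup>2\<close> wherever \<open>u\<close> is positive, and
  \<open>A u(\<tau> s, x\<^sub>0 + l x)\<close> solves it again as soon as \<open>A \<tau> = A\<^sup>m l\<^sup>2\<close>. With \<open>\<tau> = t\<close> and \<open>l = R\<close>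
  this reduces the theorem to a statement at unit scale: if \<open>\<integral> |u\<^sub>0|\<^sup>p \<le> 1\<close> over the unit ball,
  then \<open>u(1, 0) \<le> C\<close> (lemma \<open>smoothing_unit_scale\<close>). The rescaled mass of the ball of radius \<open>R\<close> is
  \<open>R\<^bsup>2p/(1-m) - d\<^esup> t\<^bsup>-p/(1-m)\<^esup>\<close> times its original mass, and \<open>2p > d(1-m)\<close> says precisely that the exponent of
  \<open>R\<close> is positive. So either \<open>R = R\<^sub>0/2\<close> is admissible, which gives the term with \<open>C\<^sub>2\<close>, or one shrinks
  \<open>R\<close> until the rescaled mass is \<open>1\<close>, which gives the term with \<open>C\<^sub>1\<close>.

  At unit scale there are two steps. First, the \<open>p\<close>-th power mass near the centre stays bounded up to
  time \<open>1\<close> (\<open>superlevel_mass_bound\<close>): for a convex \<open>j\<close> the function \<open>j(u)\<close> is a subsolution of an equation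
  with flux potential \<open>\<Psi>\<close>, \<open>\<Psi>' = j' u\<^bsup>m-1\<^esup>\<close>, and \<open>j(r) \<le> r\<^sup>p\<close> makes \<open>\<Psi>\<close> at most a multiple of
  \<open>j\<^sup>\<sigma> + 1\<close> with \<open>\<sigma> < 1\<close>. A flat enough cutoff turns this into a linear differential inequality for the mass.
  The initial datum is attained only in \<open>L\<^sup>1\<close>, so \<open>j\<close> is a power modified to grow linearly, and the
  modification is removed at the end.

  Second, bounded \<open>p\<close>-th power mass gives a pointwise bound (\<open>bounded_of_weak_Lp_bound\<close>). One maximises
  \<open>u\<close> times a weight that vanishes at the bottom and on the lateral boundary of the cylinder. Around a maximum point with a large value \<open>K\<close>,
  in the intrinsic cylinder where time and squared length have ratio \<open>K\<^bsup>1-m\<^esup>\<close>, the solution is at most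
  \<open>17/16 K\<close>, while the mass bound makes \<open>{u > K/2}\<close> a tiny part of every time slice. After division by \<open>K\<close> the
  equation is uniformly parabolic on \<open>{u > 1/2}\<close>, and \<open>small_superlevel_sets_lower_value\<close> says that such a
  solution is below \<open>1\<close> at the centre, a contradiction. That lemma takes the place of an iteration of
  Sobolev and energy inequalities: it slides paraboloids under \<open>17/16 - u\<close>, uses that they touch only where \<open>u > 1/2\<close>,
  and compares the measure of the set of vertices with that of the set of contact points.
\<close>

section \<open>Sliding paraboloids\<close>

text \<open>
  A covering argument: choose balls around the points of \<open>G\<close> that lie in \<open>U\<close> and on whose fivefold enlargements the
  Lipschitz bound from the centre holds, extract a disjoint family whose enlargements still cover \<open>G\<close>, and
  cover the image by the balls of radii \<open>5 L r\<close>. The set \<open>B\<close> is a measurable hull of the image,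
  which itself can fail to be measurable.
\<close>

lemma pointwise_lipschitz_image_measure:
  fixes \<phi> :: "'a::euclidean_space \<Rightarrow> 'a"
  assumes U: "open U" "G \<subseteq> U" and L: "L > 0"
    and lip: "\<And>x. x \<in> G \<Longrightarrow> \<exists>r>0. \<forall>z\<in>G. dist x z \<le> r \<longrightarrow> dist (\<phi> x) (\<phi> z) \<le> L * dist x z"
  shows "\<exists>B\<in>sets borel. \<phi> ` G \<subseteq> B \<and>
           emeasure lborel B \<le> ennreal ((5 * L) ^ DIM('a)) * emeasure lborel U"
proof -
  have "\<exists>r. 0 < r \<and> r \<le> 1 \<and> cball x r \<subseteq> U \<and>
          (\<forall>z\<in>G. dist x z \<le> 5 * r \<longrightarrow> dist (\<phi> x) (\<phi> z) \<le> L * dist x z)" if xG: "x \<in> G" for x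
  proof -
    obtain r1 where r1: "r1 > 0" "\<forall>z\<in>G. dist x z \<le> r1 \<longrightarrow> dist (\<phi> x) (\<phi> z) \<le> L * dist x z"
      using lip[OF xG] by blast
    obtain r2 where r2: "r2 > 0" "cball x r2 \<subseteq> U"
      using U xG open_contains_cball by blast
    define r where "r = min 1 (min (r1/5) r2)"
    have r: "0 < r" "r \<le> 1" "5 * r \<le> r1" "r \<le> r2" using r1 r2 by (auto simp: r_def)
    then have "cball x r \<subseteq> U" using r2(2) by (meson order_trans subset_cball)
    moreover have "\<forall>z\<in>G. dist x z \<le> 5 * r \<longrightarrow> dist (\<phi> x) (\<phi> z) \<le> L * dist x z"
      using r1(2) r(3) by (meson order_trans)
    ultimately show ?thesis using r(1,2) by blast
  qed
  then have "\<forall>x\<in>G. \<exists>r. 0 < r \<and> r \<le> 1 \<and> cball x r \<subseteq> U \<and>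
          (\<forall>z\<in>G. dist x z \<le> 5 * r \<longrightarrow> dist (\<phi> x) (\<phi> z) \<le> L * dist x z)" by blast
  from bchoice[OF this] obtain r where r: "\<And>x. x \<in> G \<Longrightarrow> 0 < r x \<and> r x \<le> 1 \<and> cball x (r x) \<subseteq> U \<and>
          (\<forall>z\<in>G. dist x z \<le> 5 * r x \<longrightarrow> dist (\<phi> x) (\<phi> z) \<le> L * dist x z)"
    by blast
  have "G \<subseteq> (\<Union>i\<in>G. cball (id i) (r i))" using r by fastforce
  then obtain C where C: "countable C" "C \<subseteq> G"
     "pairwise (\<lambda>i j. disjnt (cball (id i) (r i)) (cball (id j) (r j))) C"
     "G \<subseteq> (\<Union>i\<in>C. cball (id i) (5 * r i))"
    by (rule Vitali_covering_lemma_cballs[of G id r G 1]) (use r in auto)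
  define N where "N = to_nat_on C ` C"
  define X where "X n = (if n \<in> N then cball (from_nat_into C n) (r (from_nat_into C n)) else {})" for n
  define Y where "Y n = (if n \<in> N then cball (\<phi> (from_nat_into C n)) (5 * L * r (from_nat_into C n)) else {})" for n
  have fC: "from_nat_into C n \<in> C" if "n \<in> N" for n
    using that C(1) unfolding N_def by auto
  have fto: "to_nat_on C (from_nat_into C n) = n" if "n \<in> N" for n
    using that C(1) unfolding N_def by auto
  have disj: "disjoint_family X"
    unfolding disjoint_family_on_def X_def
  proof (intro ballI impI)
    fix n k :: nat assume "n \<noteq> k"
    show "(if n \<in> N then cball (from_nat_into C n) (r (from_nat_into C n)) else {}) \<inter>
          (if k \<in> N then cball (from_nat_into C k) (r (from_nat_into C k)) else {}) = {}"
    proof (cases "n \<in> N \<and> k \<in> N")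
      case True
      then have "from_nat_into C n \<noteq> from_nat_into C k" using fto \<open>n \<noteq> k\<close> by metis
      then show ?thesis using C(3) fC True by (auto simp: pairwise_def disjnt_def)
    qed auto
  qed
  have sub: "\<phi> ` G \<subseteq> (\<Union>n. Y n)"
  proof
    fix y assume "y \<in> \<phi> ` G"
    then obtain z where z: "z \<in> G" "y = \<phi> z" by auto
    then obtain i where i: "i \<in> C" "dist i z \<le> 5 * r i" using C(4) by auto
    have "dist (\<phi> i) (\<phi> z) \<le> L * dist i z" using r[of i] i C(2) z by auto
    also have "\<dots> \<le> L * (5 * r i)" using i L by simp
    finally have "y \<in> cball (\<phi> i) (5 * L * r i)" using z by (simp add: mult_ac)
    then have "y \<in> Y (to_nat_on C i)" using i C(1) by (auto simp: Y_def N_def)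
    then show "y \<in> (\<Union>n. Y n)" by blast
  qed
  have emY: "emeasure lborel (Y n) = ennreal ((5 * L) ^ DIM('a)) * emeasure lborel (X n)" for n
  proof (cases "n \<in> N")
    case True
    then have "r (from_nat_into C n) > 0" using fC r C(2) by blast
    then show ?thesis using True L
      by (simp add: X_def Y_def emeasure_cball power_mult_distrib ennreal_mult' [symmetric] mult_ac)
  qed (simp add: X_def Y_def)
  have Xs: "X n \<in> sets lborel" and Ys: "Y n \<in> sets lborel" for n
    by (auto simp: X_def Y_def)
  have "emeasure lborel (\<Union>n. Y n) \<le> (\<Sum>n. emeasure lborel (Y n))"
    using Ys by (intro emeasure_subadditive_countably) auto
  also have "\<dots> = ennreal ((5 * L) ^ DIM('a)) * (\<Sum>n. emeasure lborel (X n))"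
    by (simp add: emY)
  also have "(\<Sum>n. emeasure lborel (X n)) = emeasure lborel (\<Union>n. X n)"
    using Xs disj by (intro suminf_emeasure) auto
  also have "\<dots> \<le> emeasure lborel U"
  proof (rule emeasure_mono)
    show "(\<Union>n. X n) \<subseteq> U" using r fC C(2) by (fastforce simp: X_def split: if_splits)
  qed (use U in auto)
  finally have "emeasure lborel (\<Union>n. Y n) \<le> ennreal ((5 * L) ^ DIM('a)) * emeasure lborel U"
    by (simp add: mult_left_mono)
  moreover have "(\<Union>n. Y n) \<in> sets borel" using Ys by auto
  ultimately show ?thesis using sub by blast
qed

text \<open>
  Differentiability of the gradient at the single point \<open>x\<close> is enough: along the segment to \<open>x + h\<close> the derivative of
  the remainder is the error in the first order expansion of \<open>g\<close>.
\<close>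

lemma taylor_young:
  fixes v :: "'a::euclidean_space \<Rightarrow> real"
  assumes S: "open S" "x \<in> S"
    and v: "\<And>z. z \<in> S \<Longrightarrow> (v has_derivative (\<lambda>h. g z \<bullet> h)) (at z)"
    and g: "(g has_derivative H) (at x)" and e: "e > 0"
  shows "\<exists>r>0. \<forall>h. norm h < r \<longrightarrow> x + h \<in> S \<and> \<bar>v (x + h) - v x - g x \<bullet> h - (H h \<bullet> h) / 2\<bar> \<le> e * (norm h)\<^sup>2"
proof -
  obtain r1 where r1: "r1 > 0" "ball x r1 \<subseteq> S" using S open_contains_ball by blast
  obtain r2 where r2: "r2 > 0"
    "\<And>y. norm (y - x) < r2 \<Longrightarrow> norm (g y - g x - H (y - x)) \<le> e * norm (y - x)"
    using g e unfolding has_derivative_at_alt by blast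
  interpret H: bounded_linear H using g by (rule has_derivative_bounded_linear)
  define r where "r = min r1 r2"
  have "x + h \<in> S \<and> \<bar>v (x + h) - v x - g x \<bullet> h - (H h \<bullet> h) / 2\<bar> \<le> e * (norm h)\<^sup>2" if h: "norm h < r" for h
  proof -
    define f where "f s = v (x + s *\<^sub>R h) - s * (g x \<bullet> h) - s\<^sup>2 / 2 * (H h \<bullet> h)" for s :: real
    have inS: "x + s *\<^sub>R h \<in> S" if "0 \<le> s" "s \<le> 1" for s
    proof -
      have "norm (s *\<^sub>R h) \<le> norm h" using that by (simp add: mult_left_le_one_le)
      then have "x + s *\<^sub>R h \<in> ball x r1" using h r_def by (simp add: dist_norm)
      then show ?thesis using r1 by blast
    qed
    have df: "(f has_real_derivative ((g (x + s *\<^sub>R h) - g x - H (s *\<^sub>R h)) \<bullet> h)) (at s)" if "0 \<le> s" "s \<le> 1" for s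
    proof -
      have 1: "((\<lambda>s. x + s *\<^sub>R h) has_derivative (\<lambda>k. k *\<^sub>R h)) (at s)"
        by (auto intro!: derivative_eq_intros)
      have "((\<lambda>s. v (x + s *\<^sub>R h)) has_derivative (\<lambda>k. g (x + s *\<^sub>R h) \<bullet> (k *\<^sub>R h))) (at s)"
        by (rule has_derivative_compose[OF 1 v[OF inS[OF that]]])
      then have "((\<lambda>s. v (x + s *\<^sub>R h)) has_real_derivative g (x + s *\<^sub>R h) \<bullet> h) (at s)"
        unfolding has_field_derivative_def by (rule has_derivative_eq_rhs) (simp add: fun_eq_iff)
      then show ?thesis unfolding f_def
        by (auto intro!: derivative_eq_intros simp: H.scaleR inner_diff_left algebra_simps)
    qed
    have "\<exists>z>0. z < 1 \<and> f 1 - f 0 = (1 - 0) * ((g (x + z *\<^sub>R h) - g x - H (z *\<^sub>R h)) \<bullet> h)"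
      by (rule MVT2) (use df in auto)
    then obtain z where z: "0 < z" "z < 1" "f 1 - f 0 = (g (x + z *\<^sub>R h) - g x - H (z *\<^sub>R h)) \<bullet> h" by auto
    have zh: "norm (z *\<^sub>R h) \<le> norm h" using z by (simp add: mult_left_le_one_le)
    then have "norm (g (x + z *\<^sub>R h) - g x - H (z *\<^sub>R h)) \<le> e * norm (z *\<^sub>R h)"
      using r2(2)[of "x + z *\<^sub>R h"] h r_def by simp
    also have "\<dots> \<le> e * norm h" using zh e by simp
    finally have "\<bar>f 1 - f 0\<bar> \<le> e * norm h * norm h"
      unfolding z(3) using Cauchy_Schwarz_ineq2 by (meson mult_right_mono norm_ge_zero order_trans)
    then show ?thesis using inS[of 1] by (simp add: f_def power2_eq_square mult_ac)
  qed
  then show ?thesis using r1 r2 by (intro exI[of _ r]) (auto simp: r_def)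
qed

text \<open>
  The form is convex, and \<open>h\<close> is the sum of its \<open>DIM('a)\<close> coordinate parts, so its value at
  \<open>h\<close> is at most \<open>DIM('a)\<close> times the sum of its values at the parts.
\<close>

lemma nonneg_quadratic_form_le_trace:
  fixes Q :: "'a::euclidean_space \<Rightarrow> 'a"
  assumes "linear Q" and pos: "\<And>h. Q h \<bullet> h \<ge> 0"
  shows "Q h \<bullet> h \<le> real DIM('a) * (\<Sum>e\<in>Basis. Q e \<bullet> e) * (norm h)\<^sup>2"
proof -
  interpret Q: linear Q by fact
  define w where "w i = (h \<bullet> i) *\<^sub>R i" for i :: 'a
  let ?B = "Basis :: 'a set"
  have h: "h = (\<Sum>i\<in>?B. w i)" unfolding w_def by (simp add: euclidean_representation)
  have "0 \<le> (\<Sum>i\<in>?B. \<Sum>j\<in>?B. Q (w i - w j) \<bullet> (w i - w j))"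
    by (intro sum_nonneg pos)
  also have "\<dots> = (\<Sum>i\<in>?B. \<Sum>j\<in>?B. Q (w i) \<bullet> w i + Q (w j) \<bullet> w j - Q (w i) \<bullet> w j - Q (w j) \<bullet> w i)"
    by (simp add: Q.diff inner_diff_left inner_diff_right algebra_simps)
  also have "\<dots> = 2 * real DIM('a) * (\<Sum>i\<in>?B. Q (w i) \<bullet> w i) - 2 * (Q h \<bullet> h)"
  proof -
    have a: "(\<Sum>i\<in>?B. \<Sum>j\<in>?B. Q (w i) \<bullet> w j) = Q h \<bullet> h"
      unfolding h by (simp add: Q.sum inner_sum_left inner_sum_right) (rule sum.swap)
    have b: "(\<Sum>i\<in>?B. \<Sum>j\<in>?B. Q (w j) \<bullet> w i) = Q h \<bullet> h"
      using a by (subst sum.swap) simp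
    show ?thesis
      by (simp add: sum_subtractf sum.distrib a b sum_distrib_left mult.assoc)
  qed
  finally have 1: "Q h \<bullet> h \<le> real DIM('a) * (\<Sum>i\<in>?B. Q (w i) \<bullet> w i)" by simp
  have "(\<Sum>i\<in>?B. Q (w i) \<bullet> w i) \<le> (\<Sum>i\<in>?B. (norm h)\<^sup>2 * (Q i \<bullet> i))"
  proof (rule sum_mono)
    fix i :: 'a assume i: "i \<in> ?B"
    have "(h \<bullet> i)\<^sup>2 \<le> (norm h)\<^sup>2" using Basis_le_norm[OF i, of h] by (metis abs_ge_zero power2_abs power_mono)
    moreover have "Q (w i) \<bullet> w i = (h \<bullet> i)\<^sup>2 * (Q i \<bullet> i)"
      by (simp add: w_def Q.scale power2_eq_square)
    ultimately show "Q (w i) \<bullet> w i \<le> (norm h)\<^sup>2 * (Q i \<bullet> i)" using pos[of i] by (simp add: mult_right_mono)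
  qed
  then have "(\<Sum>i\<in>?B. Q (w i) \<bullet> w i) \<le> (norm h)\<^sup>2 * (\<Sum>i\<in>?B. Q i \<bullet> i)"
    by (simp add: sum_distrib_left)
  then have "real DIM('a) * (\<Sum>i\<in>?B. Q (w i) \<bullet> w i) \<le> real DIM('a) * ((norm h)\<^sup>2 * (\<Sum>i\<in>?B. Q i \<bullet> i))"
    by (rule mult_left_mono) simp
  from order_trans[OF 1 this] show ?thesis by (simp only: mult_ac)
qed

text \<open>
  A paraboloid of opening \<open>M\<close> with vertex \<open>y\<close> touches \<open>v\<close> from below at \<open>x\<close>: the first and second order conditions at
  the minimum \<open>x\<close> of \<open>v + M |\<cdot> - y|\<^sup>2\<close>. The first one recovers the vertex from the contact point.
\<close>

lemma contact_point_conditions: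
  fixes v :: "'a::euclidean_space \<Rightarrow> real"
  assumes S: "open S" "x \<in> S"
    and v: "\<And>z. z \<in> S \<Longrightarrow> (v has_derivative (\<lambda>h. g z \<bullet> h)) (at z)"
    and g: "(g has_derivative H) (at x)"
    and contact: "\<And>z. z \<in> S \<Longrightarrow> v x + M * (norm (x - y))\<^sup>2 \<le> v z + M * (norm (z - y))\<^sup>2"
  shows "g x = (2 * M) *\<^sub>R (y - x)" and "H h \<bullet> h + 2 * M * (norm h)\<^sup>2 \<ge> 0"
proof -
  define f where "f z = v z + M * ((z - y) \<bullet> (z - y))" for z
  have n2: "(norm w)\<^sup>2 = w \<bullet> w" for w :: 'a by (simp add: power2_norm_eq_inner)
  have "(f has_derivative (\<lambda>h. g x \<bullet> h + M * (2 * ((x - y) \<bullet> h)))) (at x)"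
    unfolding f_def
    by (rule derivative_eq_intros v[OF S(2)] refl)+ (auto simp: inner_commute algebra_simps)
  moreover have "\<forall>z\<in>S. f x \<le> f z" using contact by (auto simp: f_def n2)
  ultimately have "(\<lambda>h. g x \<bullet> h + M * (2 * ((x - y) \<bullet> h))) = (\<lambda>h. 0)"
    using differential_zero_maxmin[OF S(2,1)] by blast
  then have "(g x + (2 * M) *\<^sub>R (x - y)) \<bullet> h = 0" for h
    by (simp add: fun_eq_iff inner_add_left mult_ac)
  then have p: "g x + (2 * M) *\<^sub>R (x - y) = 0" using inner_eq_zero_iff by blast
  then show gx: "g x = (2 * M) *\<^sub>R (y - x)"
    by (simp add: algebra_simps add_eq_0_iff2)
  interpret H: bounded_linear H using g by (rule has_derivative_bounded_linear)
  have *: "0 \<le> H h \<bullet> h / 2 + M * (norm h)\<^sup>2 + e * (norm h)\<^sup>2" if e: "e > 0" for e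
  proof -
    obtain r where r: "r > 0" "\<And>h. norm h < r \<Longrightarrow> x + h \<in> S \<and>
        \<bar>v (x + h) - v x - g x \<bullet> h - (H h \<bullet> h) / 2\<bar> \<le> e * (norm h)\<^sup>2"
      using taylor_young[OF S v g e] by blast
    define s where "s = r / (2 * (norm h + 1))"
    have s: "s > 0" using r by (simp add: s_def add_nonneg_pos)
    have "norm (s *\<^sub>R h) < r"
    proof -
      have "norm (s *\<^sub>R h) = r * (norm h / (2 * (norm h + 1)))" using r(1) by (simp add: s_def)
      also have "\<dots> < r * 1"
      proof (rule mult_strict_left_mono)
        have "0 < norm h + 1" by (simp add: add_nonneg_pos)
        then have "0 < 2 * (norm h + 1)" by simp
        moreover from \<open>0 < norm h + 1\<close> have "norm h < 1 * (2 * (norm h + 1))" by (simp add: algebra_simps)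
        ultimately show "norm h / (2 * (norm h + 1)) < 1" by (simp only: pos_divide_less_eq)
      qed (use r in auto)
      finally show ?thesis by simp
    qed
    from r(2)[OF this] have 1: "x + s *\<^sub>R h \<in> S"
      "v (x + s *\<^sub>R h) \<le> v x + s * (g x \<bullet> h) + s\<^sup>2 * (H h \<bullet> h) / 2 + e * (s\<^sup>2 * (norm h)\<^sup>2)"
      by (auto simp: H.scaleR power_mult_distrib power2_eq_square mult_ac)
    have c1: "v x + M * (norm (x - y))\<^sup>2 \<le> v (x + s *\<^sub>R h) + M * (norm (x + s *\<^sub>R h - y))\<^sup>2"
      using contact[OF 1(1)] .
    have c2: "(norm (x + s *\<^sub>R h - y))\<^sup>2 = (norm (x - y))\<^sup>2 + 2 * s * ((x - y) \<bullet> h) + s\<^sup>2 * (norm h)\<^sup>2"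
      unfolding n2 by (simp add: inner_add_left inner_add_right inner_diff_left inner_diff_right
            algebra_simps inner_commute power2_eq_square)
    have c3: "s * (g x \<bullet> h) = - (M * (2 * s * ((x - y) \<bullet> h)))"
      unfolding gx by (simp add: inner_diff_left algebra_simps)
    have "0 \<le> s\<^sup>2 * (H h \<bullet> h) / 2 + e * (s\<^sup>2 * (norm h)\<^sup>2) + M * (s\<^sup>2 * (norm h)\<^sup>2)"
      using c1 1(2) unfolding c2 c3 distrib_left by linarith
    also have "\<dots> = s\<^sup>2 * (H h \<bullet> h / 2 + M * (norm h)\<^sup>2 + e * (norm h)\<^sup>2)"
      by (simp add: algebra_simps)
    finally show ?thesis using s by (simp add: zero_le_mult_iff)
  qed
  show "H h \<bullet> h + 2 * M * (norm h)\<^sup>2 \<ge> 0"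
  proof (rule ccontr)
    define q where "q = - (H h \<bullet> h / 2 + M * (norm h)\<^sup>2)"
    assume "\<not> H h \<bullet> h + 2 * M * (norm h)\<^sup>2 \<ge> 0"
    then have q: "q > 0" by (simp add: q_def)
    define e where "e = q / (2 * ((norm h)\<^sup>2 + 1))"
    have "e > 0" using q by (simp add: e_def add_nonneg_pos)
    have "e * (norm h)\<^sup>2 < q"
    proof -
      have "e * (norm h)\<^sup>2 = q * ((norm h)\<^sup>2 / (2 * ((norm h)\<^sup>2 + 1)))" by (simp add: e_def)
      also have "\<dots> < q * 1"
      proof (rule mult_strict_left_mono)
        have "0 < (norm h)\<^sup>2 + 1" by (simp add: add_nonneg_pos)
        then have "0 < 2 * ((norm h)\<^sup>2 + 1)" by simp
        moreover from \<open>0 < (norm h)\<^sup>2 + 1\<close> have "(norm h)\<^sup>2 < 1 * (2 * ((norm h)\<^sup>2 + 1))" by (simp add: algebra_simps)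
        ultimately show "(norm h)\<^sup>2 / (2 * ((norm h)\<^sup>2 + 1)) < 1" by (simp only: pos_divide_less_eq)
      qed (use q in auto)
      finally show ?thesis by simp
    qed
    then show False using *[OF \<open>e > 0\<close>] by (simp add: q_def)
  qed
qed

text \<open>
  The sliding paraboloid estimate. At a contact point the Hessian is at least \<open>-2M\<close>, so a bound on its trace
  bounds it from above as well. There \<open>v\<close> lies between two paraboloids tangent to it, and comparing
  two nearby contact points \<open>x\<close>, \<open>z\<close> at a third point, displaced from \<open>z\<close> in the direction of \<open>g z - g x\<close>, shows that
  the gradient, hence the vertex \<open>x + g x / (2M)\<close>, is a locally Lipschitz function of the contact point.
\<close>

lemma contact_vertices_measure:
  fixes v :: "'a::euclidean_space \<Rightarrow> real" and M T :: real
  assumes S: "open S" and U: "open U" "U \<subseteq> S" and M: "M > 0"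
    and v: "\<And>z. z \<in> S \<Longrightarrow> (v has_derivative (\<lambda>h. g z \<bullet> h)) (at z)"
    and g: "\<And>z. z \<in> S \<Longrightarrow> (g has_derivative H z) (at z)"
  defines "L \<equiv> 2 + (real DIM('a) * (\<bar>T\<bar> + 2 * M * real DIM('a)) + 2) / M"
  shows "\<exists>B\<in>sets borel.
      {y. \<exists>x\<in>U. (\<forall>z\<in>S. v x + M * (norm (x - y))\<^sup>2 \<le> v z + M * (norm (z - y))\<^sup>2)
                 \<and> (\<Sum>e\<in>Basis. H x e \<bullet> e) \<le> T} \<subseteq> B \<and>
      emeasure lborel B \<le> ennreal ((5 * L) ^ DIM('a)) * emeasure lborel U"
proof -
  define n where "n = real DIM('a)"
  define \<Lambda> where "\<Lambda> = n * (\<bar>T\<bar> + 2 * M * n)"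
  have \<Lambda>: "\<Lambda> \<ge> 0" using M by (simp add: \<Lambda>_def n_def)
  have Ldef: "L = 2 + (\<Lambda> + 2) / M" by (simp add: L_def \<Lambda>_def n_def)
  define C where "C = \<Lambda> / 2 + 1"
  define contact where "contact x y \<longleftrightarrow> (\<forall>z\<in>S. v x + M * (norm (x - y))\<^sup>2 \<le> v z + M * (norm (z - y))\<^sup>2)" for x y
  define G where "G = {x \<in> U. (\<exists>y. contact x y) \<and> (\<Sum>e\<in>Basis. H x e \<bullet> e) \<le> T}"
  define \<phi> where "\<phi> x = x + (1 / (2 * M)) *\<^sub>R g x" for x
  have n2: "(norm w)\<^sup>2 = w \<bullet> w" for w :: 'a by (simp add: power2_norm_eq_inner)
  have vertex: "y = \<phi> x" if "contact x y" "x \<in> U" for x y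
  proof -
    have xS: "x \<in> S" using that U by auto
    have "g x = (2 * M) *\<^sub>R (y - x)"
      by (rule contact_point_conditions(1)[OF S xS v g[OF xS]]) (use that in \<open>auto simp: contact_def\<close>)
    then show ?thesis using M by (simp add: \<phi>_def)
  qed
  have upper: "H x h \<bullet> h \<le> \<Lambda> * (norm h)\<^sup>2" if xG: "x \<in> G" for x h
  proof -
    obtain y where y: "contact x y" and xU: "x \<in> U" and tr: "(\<Sum>e\<in>Basis. H x e \<bullet> e) \<le> T"
      using xG by (auto simp: G_def)
    have xS: "x \<in> S" using xU U by auto
    interpret H: bounded_linear "H x" using g[OF xS] by (rule has_derivative_bounded_linear)
    define Q where "Q h = H x h + (2 * M) *\<^sub>R h" for h
    have Q1: "linear Q" unfolding Q_def
      by (intro linearI) (auto simp: H.add H.scaleR algebra_simps)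
    have Q2: "Q h \<bullet> h \<ge> 0" for h
    proof -
      have "H x h \<bullet> h + 2 * M * (norm h)\<^sup>2 \<ge> 0"
        by (rule contact_point_conditions(2)[OF S xS v g[OF xS]]) (use y in \<open>auto simp: contact_def\<close>)
      then show ?thesis by (simp add: Q_def inner_add_left n2)
    qed
    have "(\<Sum>e\<in>Basis. Q e \<bullet> e) = (\<Sum>e\<in>Basis. H x e \<bullet> e) + 2 * M * n"
      by (simp add: Q_def inner_add_left sum.distrib n_def)
    also have "\<dots> \<le> \<bar>T\<bar> + 2 * M * n" using tr by simp
    finally have "n * (\<Sum>e\<in>Basis. Q e \<bullet> e) * (norm h)\<^sup>2 \<le> n * (\<bar>T\<bar> + 2 * M * n) * (norm h)\<^sup>2"
      by (intro mult_right_mono mult_left_mono) (auto simp: n_def)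
    then have "Q h \<bullet> h \<le> \<Lambda> * (norm h)\<^sup>2"
      using order_trans[OF nonneg_quadratic_form_le_trace[OF Q1 Q2, of h]] unfolding \<Lambda>_def n_def by blast
    then show ?thesis using M by (simp add: Q_def inner_add_left) (smt (verit) inner_ge_zero mult_nonneg_nonneg)
  qed
  have lip: "\<exists>r>0. \<forall>z\<in>G. dist x z \<le> r \<longrightarrow> dist (\<phi> x) (\<phi> z) \<le> L * dist x z" if x: "x \<in> G" for x
  proof -
    have xS: "x \<in> S" using x U by (auto simp: G_def)
    obtain r where r: "r > 0" "\<And>h. norm h < r \<Longrightarrow> x + h \<in> S \<and>
        \<bar>v (x + h) - v x - g x \<bullet> h - (H x h \<bullet> h) / 2\<bar> \<le> 1 * (norm h)\<^sup>2"
      using taylor_young[OF S xS v g[OF xS], of 1] by auto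
    have up: "v (x + h) \<le> v x + g x \<bullet> h + C * (norm h)\<^sup>2" if "norm h < r" for h
    proof -
      have "C * (norm h)\<^sup>2 = \<Lambda> * (norm h)\<^sup>2 / 2 + (norm h)\<^sup>2" by (simp add: C_def algebra_simps)
      moreover have "\<bar>v (x + h) - v x - g x \<bullet> h - (H x h \<bullet> h) / 2\<bar> \<le> (norm h)\<^sup>2"
        using r(2)[OF that] by simp
      ultimately show ?thesis using upper[OF x, of h] by linarith
    qed
    have "dist (\<phi> x) (\<phi> z) \<le> L * dist x z" if z: "z \<in> G" "dist x z \<le> r / 3" for z
    proof (cases "g z = g x")
      case True
      then have "dist (\<phi> x) (\<phi> z) = dist x z" by (simp add: \<phi>_def)
      moreover have "1 * dist x z \<le> L * dist x z"
        using \<Lambda> M by (intro mult_right_mono) (auto simp: Ldef)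
      ultimately show ?thesis by simp
    next
      case False
      define \<rho> where "\<rho> = norm (z - x)"
      define d where "d = g z - g x"
      have d: "norm d > 0" using False by (simp add: d_def)
      \<comment> \<open>The third point is \<open>z + k = x + h\<close>; it is at distance \<open>\<rho> = |z - x|\<close> from \<open>z\<close>, in the direction in which the gradients differ.\<close>
      define k where "k = (\<rho> / norm d) *\<^sub>R d"
      have nk: "norm k = \<rho>" using d by (simp add: k_def \<rho>_def)
      have \<rho>: "\<rho> \<le> r / 3" using z by (simp add: \<rho>_def dist_norm norm_minus_commute)
      define h where "h = z - x + k"
      have nh: "norm h \<le> 2 * \<rho>" unfolding h_def using norm_triangle_ineq[of "z - x" k] nk by (simp add: \<rho>_def)
      then have hr: "norm h < r" using \<rho> r(1) by linarith
      have xh: "x + h = z + k" by (simp add: h_def)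
      have zk: "z + k \<in> S" using r(2)[OF hr] xh by simp
      obtain y where y: "contact z y" and zU: "z \<in> U" using z by (auto simp: G_def)
      have zS: "z \<in> S" using zU U by auto
      have gz: "g z = (2 * M) *\<^sub>R (y - z)"
        by (rule contact_point_conditions(1)[OF S zS v g[OF zS]]) (use y in \<open>auto simp: contact_def\<close>)
      have c1: "v z + M * (norm (z - y))\<^sup>2 \<le> v (z + k) + M * (norm (z + k - y))\<^sup>2"
        using y zk by (auto simp: contact_def)
      have c2: "(norm (z + k - y))\<^sup>2 = (norm (z - y))\<^sup>2 - 2 * ((y - z) \<bullet> k) + \<rho>\<^sup>2"
        unfolding n2 nk[symmetric] by (simp add: n2 inner_add_left inner_add_right inner_diff_left inner_diff_right
            algebra_simps inner_commute)
      have c3: "g z \<bullet> k = 2 * M * ((y - z) \<bullet> k)" by (simp add: gz)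
      have low: "v z + g z \<bullet> k - M * \<rho>\<^sup>2 \<le> v (z + k)"
        using c1 unfolding c2 c3 by (simp add: right_diff_distrib distrib_left)
      obtain y' where y': "contact x y'" using x by (auto simp: G_def)
      have gx: "g x = (2 * M) *\<^sub>R (y' - x)"
        by (rule contact_point_conditions(1)[OF S xS v g[OF xS]]) (use y' in \<open>auto simp: contact_def\<close>)
      have c1: "v x + M * (norm (x - y'))\<^sup>2 \<le> v z + M * (norm (z - y'))\<^sup>2"
        using y' zS by (auto simp: contact_def)
      have c2: "(norm (z - y'))\<^sup>2 = (norm (x - y'))\<^sup>2 - 2 * ((y' - x) \<bullet> (z - x)) + \<rho>\<^sup>2"
        unfolding n2 \<rho>_def by (simp add: n2 inner_add_left inner_add_right inner_diff_left inner_diff_right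
            algebra_simps inner_commute)
      have c3: "g x \<bullet> (z - x) = 2 * M * ((y' - x) \<bullet> (z - x))" by (simp add: gx)
      have low': "v x + g x \<bullet> (z - x) - M * \<rho>\<^sup>2 \<le> v z"
        using c1 unfolding c2 c3 by (simp add: right_diff_distrib distrib_left)
      have "C * (norm h)\<^sup>2 \<le> C * (2 * \<rho>)\<^sup>2"
        using nh \<Lambda> by (intro mult_left_mono power_mono) (auto simp: C_def)
      then have "v (z + k) \<le> v x + g x \<bullet> h + 4 * C * \<rho>\<^sup>2"
        using up[OF hr] xh by (simp add: power_mult_distrib)
      moreover have "g x \<bullet> h = g x \<bullet> (z - x) + g x \<bullet> k" by (simp add: h_def inner_add_right)
      ultimately have "d \<bullet> k \<le> (4 * C + 2 * M) * \<rho>\<^sup>2"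
        using low low' by (simp add: d_def inner_diff_left algebra_simps)
      moreover have "d \<bullet> k = norm d * \<rho>"
        using d by (simp add: k_def n2[symmetric] power2_eq_square)
      ultimately have 1: "norm d * \<rho> \<le> ((4 * C + 2 * M) * \<rho>) * \<rho>" by (simp add: power2_eq_square mult_ac)
      have "\<rho> > 0" using False by (auto simp: \<rho>_def)
      with 1 have nd: "norm d \<le> (4 * C + 2 * M) * \<rho>" by (simp add: mult_le_cancel_right)
      have "\<phi> z - \<phi> x = (z - x) + (1 / (2 * M)) *\<^sub>R d" by (simp add: \<phi>_def d_def algebra_simps)
      then have "norm (\<phi> z - \<phi> x) \<le> \<rho> + 1 / (2 * M) * norm d"
        using norm_triangle_ineq[of "z - x" "(1 / (2 * M)) *\<^sub>R d"] M by (simp add: \<rho>_def)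
      also have "\<dots> \<le> \<rho> + 1 / (2 * M) * ((4 * C + 2 * M) * \<rho>)"
        using nd M by (intro add_left_mono mult_left_mono) auto
      also have "\<dots> = L * \<rho>" using M by (simp add: Ldef C_def field_simps)
      finally show ?thesis by (simp add: dist_norm norm_minus_commute \<rho>_def)
    qed
    then show ?thesis using r(1) by (intro exI[of _ "r/3"]) auto
  qed
  have L0: "L > 0" using \<Lambda> M by (simp add: Ldef add_pos_nonneg)
  have GU: "G \<subseteq> U" by (auto simp: G_def)
  have "\<exists>B\<in>sets borel. \<phi> ` G \<subseteq> B \<and>
      emeasure lborel B \<le> ennreal ((5 * L) ^ DIM('a)) * emeasure lborel U"
    by (rule pointwise_lipschitz_image_measure[OF U(1) GU L0 lip])
  then obtain B where B: "B \<in> sets borel" "\<phi> ` G \<subseteq> B"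
      "emeasure lborel B \<le> ennreal ((5 * L) ^ DIM('a)) * emeasure lborel U" by blast
  have "{y. \<exists>x\<in>U. contact x y \<and> (\<Sum>e\<in>Basis. H x e \<bullet> e) \<le> T} \<subseteq> \<phi> ` G"
  proof
    fix y assume "y \<in> {y. \<exists>x\<in>U. contact x y \<and> (\<Sum>e\<in>Basis. H x e \<bullet> e) \<le> T}"
    then obtain x where x: "x \<in> U" "contact x y" "(\<Sum>e\<in>Basis. H x e \<bullet> e) \<le> T" by auto
    then have "x \<in> G" unfolding G_def by blast
    then show "y \<in> \<phi> ` G" using vertex[OF x(2,1)] by blast
  qed
  with B show ?thesis unfolding contact_def by (intro bexI[of _ B] conjI) (assumption | erule order_trans)+
qed

section \<open>Classical solutions of the fast diffusion equation\<close>

text \<open>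
  Derivatives are explicit arguments: \<open>ut\<close> in time, the gradient \<open>g\<close> and the Hessian \<open>H\<close> (as a linear map) in space.
  The equation is in expanded form, which covers \<open>m = 0\<close> without a case distinction.
\<close>

definition classical_fde ::
    "real \<Rightarrow> real set \<Rightarrow> 'a::euclidean_space set \<Rightarrow> (real \<Rightarrow> 'a \<Rightarrow> real) \<Rightarrow> (real \<Rightarrow> 'a \<Rightarrow> real) \<Rightarrow>
     (real \<Rightarrow> 'a \<Rightarrow> 'a) \<Rightarrow> (real \<Rightarrow> 'a \<Rightarrow> 'a \<Rightarrow> 'a) \<Rightarrow> bool" where
  "classical_fde m I S u ut g H \<longleftrightarrow>
     (\<forall>t\<in>I. \<forall>x\<in>S. 0 < u t x \<and>
        ((\<lambda>s. u s x) has_real_derivative ut t x) (at t) \<and>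
        (u t has_derivative (\<lambda>h. g t x \<bullet> h)) (at x) \<and>
        (g t has_derivative H t x) (at x) \<and>
        ut t x = u t x powr (m - 1) * (\<Sum>e\<in>Basis. H t x e \<bullet> e) + (m - 1) * u t x powr (m - 2) * (norm (g t x))\<^sup>2) \<and>
     continuous_on (I \<times> S) (\<lambda>(t, x). u t x) \<and>
     continuous_on (I \<times> S) (\<lambda>(t, x). ut t x) \<and>
     continuous_on (I \<times> S) (\<lambda>(t, x). g t x) \<and>
     (\<forall>e\<in>Basis. continuous_on (I \<times> S) (\<lambda>(t, x). H t x e \<bullet> e))"

lemma classical_fdeD:
  assumes "classical_fde m I S u ut g H" "t \<in> I" "x \<in> S"
  shows "0 < u t x" "((\<lambda>s. u s x) has_real_derivative ut t x) (at t)"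
    "(u t has_derivative (\<lambda>h. g t x \<bullet> h)) (at x)" "(g t has_derivative H t x) (at x)"
    "ut t x = u t x powr (m - 1) * (\<Sum>e\<in>Basis. H t x e \<bullet> e) + (m - 1) * u t x powr (m - 2) * (norm (g t x))\<^sup>2"
  using assms unfolding classical_fde_def by blast+

lemma classical_fde_continuous:
  assumes "classical_fde m I S u ut g H"
  shows "continuous_on (I \<times> S) (\<lambda>(t, x). u t x)" "continuous_on (I \<times> S) (\<lambda>(t, x). ut t x)"
    "continuous_on (I \<times> S) (\<lambda>(t, x). g t x)" "\<And>e. e \<in> Basis \<Longrightarrow> continuous_on (I \<times> S) (\<lambda>(t, x). H t x e \<bullet> e)"
  using assms unfolding classical_fde_def by blast+

definition classical_near :: "real \<Rightarrow> real set \<Rightarrow> 'a::euclidean_space set \<Rightarrow> (real \<Rightarrow> 'a \<Rightarrow> real) \<Rightarrow> bool" where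
  "classical_near m I K u \<longleftrightarrow> (\<exists>S ut g H. open S \<and> K \<subseteq> S \<and> classical_fde m I S u ut g H)"

lemma classical_nearI:
  "open S \<Longrightarrow> K \<subseteq> S \<Longrightarrow> classical_fde m I S u ut g H \<Longrightarrow> classical_near m I K u"
  unfolding classical_near_def by blast

lemma continuous_on_slice:
  assumes "continuous_on (I \<times> S) (\<lambda>(t, x). f t x)" "t \<in> I"
  shows "continuous_on S (f t)"
proof -
  have "continuous_on S (\<lambda>x. (\<lambda>(t, x). f t x) (t, x))"
    by (rule continuous_on_compose2[OF assms(1)]) (use assms(2) in \<open>auto intro!: continuous_intros\<close>)
  then show ?thesis by simp
qed

lemma classical_fde_mono:
  assumes "classical_fde m I S u ut g H" "J \<subseteq> I" "S' \<subseteq> S"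
  shows "classical_fde m J S' u ut g H"
proof -
  have sub: "J \<times> S' \<subseteq> I \<times> S" using assms by blast
  have in_large: "t \<in> I" "x \<in> S" if "t \<in> J" "x \<in> S'" for t x using assms(2,3) that by auto
  note D = classical_fdeD[OF assms(1) in_large]
  show ?thesis unfolding classical_fde_def
    by (intro conjI ballI D continuous_on_subset[OF classical_fde_continuous(1)[OF assms(1)] sub]
        continuous_on_subset[OF classical_fde_continuous(2)[OF assms(1)] sub]
        continuous_on_subset[OF classical_fde_continuous(3)[OF assms(1)] sub]
        continuous_on_subset[OF classical_fde_continuous(4)[OF assms(1)] sub])
qed

lemma classical_near_mono:
  assumes "classical_near m I K u" "J \<subseteq> I" "K' \<subseteq> K"
  shows "classical_near m J K' u"
proof -
  obtain S ut g H where S: "open S" "K \<subseteq> S" "classical_fde m I S u ut g H"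
    using assms(1) by (auto simp: classical_near_def)
  then show ?thesis
    using assms(3) by (intro classical_nearI[OF S(1) _ classical_fde_mono[OF S(3) assms(2) order_refl]]) blast
qed

text \<open>
  The two-parameter scaling group of the equation, with translations.
\<close>

lemma classical_fde_rescale:
  fixes x1 :: "'a::euclidean_space"
  assumes u: "classical_fde m I S u ut g H"
    and A: "A > 0" and l: "l > 0" and scale: "A * \<tau> = A powr m * l\<^sup>2"
    and J: "\<And>s. s \<in> J \<Longrightarrow> c + \<tau> * s \<in> I" and S': "\<And>x. x \<in> S' \<Longrightarrow> x1 + l *\<^sub>R x \<in> S"
  shows "classical_fde m J S' (\<lambda>s x. A * u (c + \<tau> * s) (x1 + l *\<^sub>R x))
     (\<lambda>s x. A * \<tau> * ut (c + \<tau> * s) (x1 + l *\<^sub>R x))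
     (\<lambda>s x. (A * l) *\<^sub>R g (c + \<tau> * s) (x1 + l *\<^sub>R x))
     (\<lambda>s x h. (A * l\<^sup>2) *\<^sub>R H (c + \<tau> * s) (x1 + l *\<^sub>R x) h)"
proof -
  have cont: "continuous_on (J \<times> S') (\<lambda>(s, x). f (c + \<tau> * s) (x1 + l *\<^sub>R x))"
    if "continuous_on (I \<times> S) (\<lambda>(t, x). f t x)" for f :: "real \<Rightarrow> 'a \<Rightarrow> 'b::topological_space"
  proof -
    have "continuous_on (J \<times> S') (\<lambda>z. (\<lambda>(t, x). f t x) (c + \<tau> * fst z, x1 + l *\<^sub>R snd z))"
      by (rule continuous_on_compose2[OF that]) (use J S' in \<open>auto intro!: continuous_intros\<close>)
    then show ?thesis by (simp add: case_prod_unfold)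
  qed
  have pt: "0 < A * u (c + \<tau> * s) (x1 + l *\<^sub>R x) \<and>
      ((\<lambda>s. A * u (c + \<tau> * s) (x1 + l *\<^sub>R x)) has_real_derivative A * \<tau> * ut (c + \<tau> * s) (x1 + l *\<^sub>R x)) (at s) \<and>
      ((\<lambda>x. A * u (c + \<tau> * s) (x1 + l *\<^sub>R x)) has_derivative (\<lambda>h. (A * l) *\<^sub>R g (c + \<tau> * s) (x1 + l *\<^sub>R x) \<bullet> h)) (at x) \<and>
      ((\<lambda>x. (A * l) *\<^sub>R g (c + \<tau> * s) (x1 + l *\<^sub>R x)) has_derivative (\<lambda>h. (A * l\<^sup>2) *\<^sub>R H (c + \<tau> * s) (x1 + l *\<^sub>R x) h)) (at x) \<and>
      A * \<tau> * ut (c + \<tau> * s) (x1 + l *\<^sub>R x) = (A * u (c + \<tau> * s) (x1 + l *\<^sub>R x)) powr (m - 1) *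
          (\<Sum>e\<in>Basis. (A * l\<^sup>2) *\<^sub>R H (c + \<tau> * s) (x1 + l *\<^sub>R x) e \<bullet> e) +
        (m - 1) * (A * u (c + \<tau> * s) (x1 + l *\<^sub>R x)) powr (m - 2) *
          (norm ((A * l) *\<^sub>R g (c + \<tau> * s) (x1 + l *\<^sub>R x)))\<^sup>2"
    if "s \<in> J" "x \<in> S'" for s x
  proof -
    define t where "t = c + \<tau> * s"
    define y where "y = x1 + l *\<^sub>R x"
    have tI: "t \<in> I" and yS: "y \<in> S" using J S' that by (auto simp: t_def y_def)
    note D = classical_fdeD[OF u tI yS]
    have "((\<lambda>s. c + \<tau> * s) has_real_derivative \<tau>) (at s)" by (auto intro!: derivative_eq_intros)
    from DERIV_chain2[OF D(2)[unfolded t_def] this]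
    have 1: "((\<lambda>s. A * u (c + \<tau> * s) y) has_real_derivative A * \<tau> * ut t y) (at s)"
      by (auto intro!: derivative_eq_intros simp: t_def)
    have L: "((\<lambda>x. x1 + l *\<^sub>R x) has_derivative (\<lambda>h. l *\<^sub>R h)) (at x)"
      by (auto intro!: derivative_eq_intros)
    have "((\<lambda>x. u t (x1 + l *\<^sub>R x)) has_derivative (\<lambda>h. g t y \<bullet> (l *\<^sub>R h))) (at x)"
      using has_derivative_compose[OF L D(3)[unfolded y_def]] by (simp add: y_def)
    then have 2: "((\<lambda>x. A * u t (x1 + l *\<^sub>R x)) has_derivative (\<lambda>h. (A * l) *\<^sub>R g t y \<bullet> h)) (at x)"
      by (auto intro!: derivative_eq_intros)
    interpret H: bounded_linear "H t y" using D(4) by (rule has_derivative_bounded_linear)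
    have "((\<lambda>x. g t (x1 + l *\<^sub>R x)) has_derivative (\<lambda>h. H t y (l *\<^sub>R h))) (at x)"
      using has_derivative_compose[OF L D(4)[unfolded y_def]] by (simp add: y_def)
    then have "((\<lambda>x. (A * l) *\<^sub>R g t (x1 + l *\<^sub>R x)) has_derivative (\<lambda>h. (A * l) *\<^sub>R H t y (l *\<^sub>R h))) (at x)"
      by (rule has_derivative_scaleR_right)
    then have 3: "((\<lambda>x. (A * l) *\<^sub>R g t (x1 + l *\<^sub>R x)) has_derivative (\<lambda>h. (A * l\<^sup>2) *\<^sub>R H t y h)) (at x)"
      by (simp add: H.scaleR power2_eq_square mult_ac)
    have pA: "A powr (m - 1) * A = A powr m" "A powr (m - 2) * A\<^sup>2 = A powr m"
      using A by (simp_all add: powr_diff field_simps powr_numeral)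
    have "(A * u t y) powr (m - 1) * (\<Sum>e\<in>Basis. (A * l\<^sup>2) *\<^sub>R H t y e \<bullet> e) +
        (m - 1) * (A * u t y) powr (m - 2) * (norm ((A * l) *\<^sub>R g t y))\<^sup>2
      = (A powr (m - 1) * A) * l\<^sup>2 * (u t y powr (m - 1) * (\<Sum>e\<in>Basis. H t y e \<bullet> e)) +
        (A powr (m - 2) * A\<^sup>2) * l\<^sup>2 * ((m - 1) * u t y powr (m - 2) * (norm (g t y))\<^sup>2)"
      using A l D(1) by (simp add: powr_mult sum_distrib_left[symmetric] power_mult_distrib mult_ac)
    also have "\<dots> = A powr m * l\<^sup>2 * ut t y" unfolding pA D(5) by (simp add: algebra_simps)
    finally have 4: "A * \<tau> * ut t y = (A * u t y) powr (m - 1) * (\<Sum>e\<in>Basis. (A * l\<^sup>2) *\<^sub>R H t y e \<bullet> e) +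
        (m - 1) * (A * u t y) powr (m - 2) * (norm ((A * l) *\<^sub>R g t y))\<^sup>2" by (simp add: scale)
    show ?thesis using A D(1) 1 2 3 4 unfolding t_def y_def by simp
  qed
  have "continuous_on (J \<times> S') (\<lambda>(s, x). A * u (c + \<tau> * s) (x1 + l *\<^sub>R x))"
    "continuous_on (J \<times> S') (\<lambda>(s, x). A * \<tau> * ut (c + \<tau> * s) (x1 + l *\<^sub>R x))"
    "continuous_on (J \<times> S') (\<lambda>(s, x). (A * l) *\<^sub>R g (c + \<tau> * s) (x1 + l *\<^sub>R x))"
    using cont[OF classical_fde_continuous(1)[OF u]] cont[OF classical_fde_continuous(2)[OF u]]
      cont[OF classical_fde_continuous(3)[OF u]]
    unfolding case_prod_unfold by (auto intro!: continuous_intros)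
  moreover have "continuous_on (J \<times> S') (\<lambda>(s, x). (A * l\<^sup>2) *\<^sub>R H (c + \<tau> * s) (x1 + l *\<^sub>R x) e \<bullet> e)"
    if "e \<in> Basis" for e
    using cont[OF classical_fde_continuous(4)[OF u that]]
    unfolding case_prod_unfold inner_scaleR_left by (intro continuous_on_mult_left)
  ultimately show ?thesis using pt unfolding classical_fde_def by blast
qed

section \<open>Small superlevel sets force small values\<close>

text \<open>
  Let \<open>v = 17/16 - u\<close>, let \<open>w(t, y)\<close> be the minimum of \<open>v(t, \<cdot>) + 2 |\<cdot> - y|\<^sup>2\<close> over the closed unit ball,
  and \<open>W\<close> the positive part of \<open>1/2 - w\<close>. Where \<open>W > 0\<close> and \<open>|y| < 1/4\<close> the minimum is attained in the open ball at a point with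
  \<open>u > 9/16\<close>. Backwards in time \<open>w\<close> changes at most like \<open>v\<close> at the minimum point, so \<open>W\<close> decreases at unit speed unless
  the time derivative of \<open>v\<close> is less than \<open>1\<close> there; then the equation bounds the trace of the Hessian of \<open>v\<close>, so \<open>y\<close> is in a set of bad vertices whose measure
  is controlled by that of \<open>{u > 1/2}\<close>, and the growth of \<open>W\<close> is bounded as well.
  As \<open>W \<le> 1/2\<close> initially, at time \<open>0\<close> only vertices that were bad for a definite time have \<open>W\<close> of size \<open>1/4\<close>,
  and these are few. But \<open>u(0, 0) \<ge> 1\<close> would give \<open>W \<ge> 1/4\<close> on the whole ball of radius \<open>1/4\<close>.
  Time is discretised, so that neither derivatives nor measurability of \<open>W\<close> are needed.
\<close>

lemma small_superlevel_sets_lower_value: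
  fixes m :: real
  assumes m: "m < 1"
  shows "\<exists>\<epsilon>>0. \<forall>u :: real \<Rightarrow> 'a::euclidean_space \<Rightarrow> real.
     classical_near m {-1..0} (cball 0 1) u \<and>
     (\<forall>t\<in>{-1..0}. \<forall>x\<in>cball 0 1. u t x \<le> 17/16) \<and>
     (\<forall>t\<in>{-1..0}. emeasure lborel {x \<in> ball 0 1. u t x > 1/2} \<le> ennreal \<epsilon>)
     \<longrightarrow> u 0 0 < 1"
proof -
  define n where "n = real DIM('a)"
  have n1: "n \<ge> 1" using DIM_ge_Suc0[where 'a='a] by (simp add: n_def)
  define a0 where "a0 = (17/16 :: real) powr (m - 1)"
  define a1 where "a1 = (1/2 :: real) powr (m - 1)"
  have a0: "a0 > 0" and a1: "a1 > 0" by (simp_all add: a0_def a1_def)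
  define T where "T = 1 / a0"
  define C where "C = 4 * n * a1"
  have C: "C > 0" using n1 a1 by (simp add: C_def)
  define L where "L = 2 + (n * (\<bar>T\<bar> + 2 * 2 * n) + 2) / 2"
  have L: "L > 0" using n1 by (simp add: L_def add_pos_nonneg)
  define V where "V = unit_ball_vol n * (1/4) ^ DIM('a)"
  have V: "V > 0" by (simp add: V_def n_def)
  define \<epsilon> where "\<epsilon> = V / (16 * (1 + C) * (5 * L) ^ DIM('a))"
  have \<epsilon>: "\<epsilon> > 0" using V C L by (simp add: \<epsilon>_def)
  have main: "u 0 0 < 1"
    if S: "open S" "cball 0 1 \<subseteq> S" and u: "classical_fde m {-1..0} S u ut g H"
      and ub: "\<And>t x. t \<in> {-1..0} \<Longrightarrow> x \<in> cball 0 1 \<Longrightarrow> u t x \<le> 17/16"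
      and small: "\<And>t. t \<in> {-1..0} \<Longrightarrow> emeasure lborel {x \<in> ball 0 1. u t x > 1/2} \<le> ennreal \<epsilon>"
    for u :: "real \<Rightarrow> 'a \<Rightarrow> real" and ut g H S
  proof (rule ccontr)
    assume "\<not> u 0 0 < 1"
    then have u00: "u 0 0 \<ge> 1" by simp
    have bS: "x \<in> S" if "x \<in> ball 0 1" for x using that S(2) by auto
    define v where "v t x = 17/16 - u t x" for t x
    define w where "w t y z = v t z + 2 * (norm (z - y))\<^sup>2" for t :: real and y z :: 'a
    have v0: "v t x \<ge> 0" if "t \<in> {-1..0}" "x \<in> cball 0 1" for t x
      using ub[OF that] by (simp add: v_def)
    have ex: "\<exists>x\<in>cball 0 1. \<forall>z\<in>cball 0 1. w t y x \<le> w t y z" if t: "t \<in> {-1..0}" for t y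
    proof -
      have "continuous_on S (u t)" by (rule continuous_on_slice[OF classical_fde_continuous(1)[OF u] t])
      then have "continuous_on (cball 0 1) (u t)" using S(2) continuous_on_subset by blast
      then have "continuous_on (cball 0 1) (w t y)" unfolding w_def v_def by (intro continuous_intros)
      then show ?thesis by (intro continuous_attains_inf) auto
    qed
    define X where "X t y = (SOME x. x \<in> cball 0 1 \<and> (\<forall>z\<in>cball 0 1. w t y x \<le> w t y z))" for t y
    have X': "X t y \<in> cball 0 1 \<and> (\<forall>z\<in>cball 0 1. w t y (X t y) \<le> w t y z)" if t: "t \<in> {-1..0}" for t y
      unfolding X_def by (rule someI_ex) (use ex[OF t, of y] in blast)
    have X: "\<And>t y. t \<in> {-1..0} \<Longrightarrow> X t y \<in> cball 0 1"
      "\<And>t y z. t \<in> {-1..0} \<Longrightarrow> z \<in> cball 0 1 \<Longrightarrow> w t y (X t y) \<le> w t y z" using X' by blast+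
    define W where "W t y = max 0 (1/2 - w t y (X t y))" for t y
    define U where "U t = {x \<in> ball 0 1. u t x > 1/2}" for t
    have Uo: "open (U t)" if t: "t \<in> {-1..0}" for t
    proof -
      have "continuous_on S (u t)" by (rule continuous_on_slice[OF classical_fde_continuous(1)[OF u] t])
      then have "continuous_on (ball 0 1) (u t)" using bS continuous_on_subset by blast
      from continuous_open_preimage[OF this open_ball open_greaterThan, of "1/2"]
      have "open (ball 0 1 \<inter> u t -` {1/2<..})" .
      moreover have "U t = ball 0 1 \<inter> u t -` {1/2<..}" by (auto simp: U_def)
      ultimately show ?thesis by simp
    qed
    have US: "U t \<subseteq> ball 0 1" for t by (auto simp: U_def)
    have dv: "(v t has_derivative (\<lambda>h. (- g t z) \<bullet> h)) (at z)"
      and dg: "((\<lambda>z. - g t z) has_derivative (\<lambda>h. - H t z h)) (at z)"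
      if t: "t \<in> {-1..0}" and z: "z \<in> ball 0 1" for t z
    proof -
      have "((\<lambda>x. 17/16 - u t x) has_derivative (\<lambda>h. 0 - g t z \<bullet> h)) (at z)"
        by (intro has_derivative_diff has_derivative_const classical_fdeD(3)[OF u t bS[OF z]])
      then show "(v t has_derivative (\<lambda>h. (- g t z) \<bullet> h)) (at z)" by (simp add: v_def[abs_def])
      show "((\<lambda>z. - g t z) has_derivative (\<lambda>h. - H t z h)) (at z)"
        by (intro has_derivative_minus classical_fdeD(4)[OF u t bS[OF z]])
    qed
    define bad where "bad t = {y. \<exists>x\<in>U t. (\<forall>z\<in>ball 0 1. v t x + 2 * (norm (x - y))\<^sup>2 \<le> v t z + 2 * (norm (z - y))\<^sup>2)
                 \<and> (\<Sum>e\<in>Basis. (- H t x e) \<bullet> e) \<le> T}" for t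
    have "\<exists>B\<in>sets borel. bad t \<subseteq> B \<and> emeasure lborel B \<le> ennreal ((5 * L) ^ DIM('a)) * ennreal \<epsilon>"
      if t: "t \<in> {-1..0}" for t
    proof -
      have "\<exists>B\<in>sets borel. bad t \<subseteq> B \<and> emeasure lborel B \<le> ennreal ((5 * L) ^ DIM('a)) * emeasure lborel (U t)"
        unfolding bad_def L_def n_def
        by (rule contact_vertices_measure[OF open_ball Uo[OF t] US _ dv[OF t] dg[OF t]]) auto
      moreover have "ennreal ((5 * L) ^ DIM('a)) * emeasure lborel (U t) \<le> ennreal ((5 * L) ^ DIM('a)) * ennreal \<epsilon>"
        using small[OF t] by (intro mult_left_mono) (auto simp: U_def)
      ultimately show ?thesis using order_trans by blast
    qed
    then have "\<forall>t\<in>{-1..0}. \<exists>B. B \<in> sets borel \<and> bad t \<subseteq> B \<and>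
        emeasure lborel B \<le> ennreal ((5 * L) ^ DIM('a)) * ennreal \<epsilon>" by blast
    from bchoice[OF this] obtain B where B: "\<And>t. t \<in> {-1..0} \<Longrightarrow> B t \<in> sets borel" "\<And>t. t \<in> {-1..0} \<Longrightarrow> bad t \<subseteq> B t"
      "\<And>t. t \<in> {-1..0} \<Longrightarrow> emeasure lborel (B t) \<le> ennreal ((5 * L) ^ DIM('a)) * ennreal \<epsilon>"
      by blast
    have "uniformly_continuous_on ({-1..0} \<times> cball 0 1) (\<lambda>(t, x). ut t x)"
    proof (rule compact_uniformly_continuous)
      show "continuous_on ({-1..0} \<times> cball 0 1) (\<lambda>(t, x). ut t x)"
        by (rule continuous_on_subset[OF classical_fde_continuous(2)[OF u]]) (use S(2) in auto)
    qed (intro compact_Times compact_Icc compact_cball)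
    then have "\<exists>\<delta>>0. \<forall>p\<in>{-1..0} \<times> cball 0 1. \<forall>q\<in>{-1..0} \<times> cball 0 1. dist q p < \<delta> \<longrightarrow>
        dist (case q of (t, x) \<Rightarrow> ut t x) (case p of (t, x) \<Rightarrow> ut t x) < 1/8"
      unfolding uniformly_continuous_on_def by (elim allE[of _ "1/8"]) simp
    then obtain \<delta> where \<delta>: "\<delta> > 0" "\<And>p q. p \<in> {-1..0} \<times> cball 0 1 \<Longrightarrow> q \<in> {-1..0} \<times> cball 0 1 \<Longrightarrow>
        dist q p < \<delta> \<Longrightarrow> dist (case q of (t, x) \<Rightarrow> ut t x) (case p of (t, x) \<Rightarrow> ut t x) < 1/8"
      by blast
    obtain N :: nat where N: "N > 0" "1 / real N < \<delta>"
      using nat_approx_posE[OF \<delta>(1)] by (metis zero_less_Suc)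
    define h where "h = 1 / real N"
    have h: "h > 0" "h < \<delta>" "real N * h = 1" using N by (auto simp: h_def)
    \<comment> \<open>First order expansion backwards in time; \<open>h\<close> is so small that the error is at most \<open>h/8\<close> on the whole cylinder.\<close>
    have backward: "v (t - h) x \<le> v t x + h * ut t x + h / 8"
      if t: "t \<in> {-1..0}" "t - h \<in> {-1..0}" and x: "x \<in> cball 0 1" for t x
    proof -
      have "\<exists>z>t - h. z < t \<and> u t x - u (t - h) x = (t - (t - h)) * ut z x"
        by (rule MVT2) (use h t x S(2) in \<open>auto intro!: classical_fdeD(2)[OF u]\<close>)
      then obtain z where z: "t - h < z" "z < t" "u t x - u (t - h) x = h * ut z x" by auto
      have "dist (z, x) (t, x) < \<delta>" using z h by (simp add: dist_Pair_Pair dist_real_def)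
      then have "dist (ut z x) (ut t x) < 1/8" using \<delta>(2)[of "(t, x)" "(z, x)"] t x z by auto
      then have "ut z x \<le> ut t x + 1/8" unfolding dist_real_def by linarith
      then have "h * ut z x \<le> h * (ut t x + 1/8)" using h by (intro mult_left_mono) auto
      then show ?thesis using z(3) by (simp add: v_def algebra_simps)
    qed
    \<comment> \<open>The first alternative is the decrease at unit speed, the second one a bad vertex.\<close>
    have step: "W t y \<le> max 0 (W (t - h) y - h + h / 8) \<or> (y \<in> B t \<and> W t y \<le> W (t - h) y + C * h + h / 8)"
      if t: "t \<in> {-1..0}" "t - h \<in> {-1..0}" and y: "y \<in> ball 0 (1/4)" for t y
    proof (cases "W t y > 0")
      case True
      define x where "x = X t y"
      have xc: "x \<in> cball 0 1" using X(1)[OF t(1)] by (simp add: x_def)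
      have Wt: "W t y = 1/2 - w t y x" and wx: "w t y x < 1/2" using True by (auto simp: W_def x_def max_def split: if_splits)
      have vx: "v t x \<ge> 0" by (rule v0[OF t(1) xc])
      \<comment> \<open>On the unit sphere the paraboloid term alone exceeds \<open>1/2\<close>, since \<open>|y| < 1/4\<close>.\<close>
      have "norm x \<noteq> 1"
      proof
        assume "norm x = 1"
        then have "norm (x - y) \<ge> 3/4" using y norm_triangle_ineq2[of x y] by simp
        then have "(norm (x - y))\<^sup>2 \<ge> (3/4)\<^sup>2" by (intro power_mono) auto
        then show False using wx vx by (simp add: w_def power2_eq_square)
      qed
      then have xb: "x \<in> ball 0 1" using xc by simp
      have "v t x < 1/2" using wx unfolding w_def by (smt (verit) zero_le_power2)
      then have ux: "9/16 < u t x" "u t x \<le> 17/16" using ub[OF t(1) xc] by (auto simp: v_def)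
      then have xU: "x \<in> U t" using xb by (simp add: U_def)
      have contact: "\<forall>z\<in>ball 0 1. v t x + 2 * (norm (x - y))\<^sup>2 \<le> v t z + 2 * (norm (z - y))\<^sup>2"
        using X(2)[OF t(1)] unfolding w_def x_def by auto
      define tr where "tr = (\<Sum>e\<in>Basis. (- H t x e) \<bullet> e)"
      have "(- H t x e) \<bullet> e \<ge> - 4" if e: "e \<in> Basis" for e
      proof -
        have "(- H t x e) \<bullet> e + 2 * 2 * (norm e)\<^sup>2 \<ge> 0"
          by (rule contact_point_conditions(2)[OF open_ball xb dv[OF t(1)] dg[OF t(1) xb]]) (use contact in auto)
        then show ?thesis using e by simp
      qed
      then have "(\<Sum>e\<in>(Basis::'a set). - 4) \<le> tr" unfolding tr_def by (intro sum_mono) auto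
      then have tr: "tr \<ge> - 4 * n" by (simp add: n_def)
      have pos: "u t x > 0" using ux by simp
      have pde: "- ut t x = u t x powr (m - 1) * tr + (1 - m) * u t x powr (m - 2) * (norm (g t x))\<^sup>2"
        using classical_fdeD(5)[OF u t(1) bS[OF xb]] by (simp add: tr_def sum_negf algebra_simps)
      have "(1 - m) * u t x powr (m - 2) * (norm (g t x))\<^sup>2 \<ge> 0" using m by simp
      then have pde': "- ut t x \<ge> u t x powr (m - 1) * tr" using pde by linarith
      have p1: "u t x powr (m - 1) \<le> a1" unfolding a1_def using ux m by (intro powr_mono2') auto
      have p0: "u t x powr (m - 1) \<ge> a0" unfolding a0_def using ux m by (intro powr_mono2') auto
      have "W t y \<le> W (t - h) y + h * ut t x + h / 8"
      proof -
        have "w (t - h) y (X (t - h) y) \<le> w (t - h) y x" by (rule X(2)[OF t(2) xc])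
        also have "\<dots> \<le> w t y x + h * ut t x + h / 8"
          using backward[OF t xc] by (simp add: w_def)
        finally show ?thesis using Wt by (simp add: W_def)
      qed
      moreover have "W t y \<le> max 0 (W (t - h) y - h + h / 8)" if "ut t x \<le> - 1"
      proof -
        have "h * ut t x \<le> h * (- 1)" using that h by (intro mult_left_mono) auto
        then show ?thesis using \<open>W t y \<le> W (t - h) y + h * ut t x + h / 8\<close> by linarith
      qed
      moreover have "y \<in> B t \<and> W t y \<le> W (t - h) y + C * h + h / 8" if "ut t x > - 1"
      proof
        have "tr \<le> T"
        proof (cases "tr \<le> 0")
          case True then show ?thesis using a0 by (simp add: T_def) (smt (verit) divide_pos_pos)
        next
          case False
          then have "a0 * tr \<le> u t x powr (m - 1) * tr" using p0 by (intro mult_right_mono) auto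
          also have "\<dots> \<le> 1" using pde' that by linarith
          finally show ?thesis using a0 by (simp add: T_def field_simps)
        qed
        then have "y \<in> bad t" using xU contact unfolding bad_def tr_def by blast
        then show "y \<in> B t" using B(2)[OF t(1)] by blast
        have "- tr * u t x powr (m - 1) \<le> 4 * n * a1"
        proof -
          have "- tr * u t x powr (m - 1) \<le> (4 * n) * u t x powr (m - 1)" using tr by (intro mult_right_mono) auto
          also have "\<dots> \<le> 4 * n * a1" using p1 n1 by (intro mult_left_mono) auto
          finally show ?thesis .
        qed
        then have "ut t x \<le> C" using pde' by (simp add: C_def mult.commute)
        then have "h * ut t x \<le> h * C" using h by (intro mult_left_mono) auto
        then show "W t y \<le> W (t - h) y + C * h + h / 8"
          using \<open>W t y \<le> W (t - h) y + h * ut t x + h / 8\<close> by (simp add: mult.commute)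
      qed
      ultimately show ?thesis by linarith
    qed (auto simp: W_def)
    define s where "s k = - 1 + real k * h" for k :: nat
    have sI: "s k \<in> {-1..0}" if "k \<le> N" for k
    proof -
      have "real k * h \<le> real N * h" using that h by (intro mult_right_mono) auto
      then show ?thesis using h by (simp add: s_def)
    qed
    have sN: "s N = 0" using h by (simp add: s_def)
    \<comment> \<open>Each bad step costs at most \<open>C h\<close> and the lost decrease \<open>h\<close>; the initial \<open>1/2\<close> is used up by time \<open>0\<close>.\<close>
    have inv: "W (s k) y \<le> max 0 (1/2 - real k * h) + (1 + C) * h * (\<Sum>i=1..k. indicator (B (s i)) y) + real k * h / 8"
      if y: "y \<in> ball 0 (1/4)" and k: "k \<le> N" for k y
      using k
    proof (induction k)
      case 0
      have "w (s 0) y (X (s 0) y) \<ge> 0" using v0[OF _ X(1)] sI[of 0] by (simp add: w_def)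
      then have "W (s 0) y \<le> 1/2" unfolding W_def by linarith
      then show ?case by simp
    next
      case (Suc k)
      define \<Sigma> where "\<Sigma> = (1 + C) * h * (\<Sum>i=1..k. indicator (B (s i)) y :: real)"
      have \<Sigma>: "\<Sigma> \<ge> 0" using C h by (auto simp: \<Sigma>_def intro!: mult_nonneg_nonneg sum_nonneg)
      have IH: "W (s k) y \<le> max 0 (1/2 - real k * h) + \<Sigma> + real k * h / 8"
        using Suc unfolding \<Sigma>_def by simp
      have sk: "s (Suc k) - h = s k" by (simp add: s_def algebra_simps)
      have kh: "0 \<le> real k * h" using h by simp
      have SucS: "(1 + C) * h * (\<Sum>i=1..Suc k. indicator (B (s i)) y) = \<Sigma> + (1 + C) * h * indicator (B (s (Suc k))) y"
        by (simp add: \<Sigma>_def distrib_left)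
      have Sk: "real (Suc k) * h = real k * h + h" by (simp add: algebra_simps)
      have e: "(1 + C) * h = h + C * h" by (simp add: algebra_simps)
      have Ch: "C * h > 0" using C h by simp
      from step[OF sI[OF Suc.prems] _ y] sI[of k] Suc.prems sk
      consider "W (s (Suc k)) y \<le> max 0 (W (s k) y - h + h / 8)"
        | "y \<in> B (s (Suc k))" "W (s (Suc k)) y \<le> W (s k) y + C * h + h / 8" by fastforce
      then show ?case
      proof cases
        case 1
        have "(1 + C) * h * indicator (B (s (Suc k))) y \<ge> 0" using C h by simp
        moreover have "w' \<le> max 0 (1/2 - (q + h)) + (S + J) + (q + h) / 8"
          if "0 \<le> J" "w' \<le> max 0 (w - h + h / 8)" "w \<le> max 0 (1/2 - q) + S + q / 8" "0 < h" "0 \<le> S" "0 \<le> q"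
          for w w' q S J h :: real using that by (auto simp: max_def field_simps split: if_splits)
        ultimately show ?thesis using 1 IH h(1) \<Sigma> kh unfolding SucS Sk by blast
      next
        case 2
        then have "(1 + C) * h * indicator (B (s (Suc k))) y = h + C * h" by (simp add: e)
        moreover have "w' \<le> max 0 (1/2 - (q + h)) + (S + J) + (q + h) / 8"
          if "J = h + c" "w' \<le> w + c + h / 8" "w \<le> max 0 (1/2 - q) + S + q / 8" "0 < h" "0 \<le> S" "0 \<le> q"
          for w w' q S J h c :: real using that by (auto simp: max_def field_simps split: if_splits)
        ultimately show ?thesis using 2 IH h(1) \<Sigma> kh unfolding SucS Sk by blast
      qed
    qed
    have many: "1/8 \<le> (1 + C) * h * (\<Sum>i=1..N. indicator (B (s i)) y)" if y: "y \<in> ball 0 (1/4)" for y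
    proof -
      have "w 0 y (X 0 y) \<le> w 0 y 0" by (rule X(2)) auto
      also have "w 0 y 0 \<le> 1/16 + 2 * (1/4)\<^sup>2"
      proof -
        have "(norm y)\<^sup>2 \<le> (1/4)\<^sup>2" using y by (intro power_mono) auto
        moreover have "w 0 y 0 = 17/16 - u 0 0 + 2 * (norm y)\<^sup>2" by (simp add: w_def v_def)
        ultimately show ?thesis using u00 by linarith
      qed
      finally have "w 0 y (X 0 y) \<le> 1/4" by (simp add: power2_eq_square)
      then have "W 0 y \<ge> 1/4" unfolding W_def by linarith
      moreover have "max 0 (1/2 - real N * h) = 0" using h by simp
      ultimately show ?thesis using inv[OF y order_refl] h(3) by (simp add: sN)
    qed
    have "ennreal (1/8) * emeasure lborel (ball (0::'a) (1/4)) =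
        (\<integral>\<^sup>+y. ennreal (1/8) * indicator (ball (0::'a) (1/4)) y \<partial>lborel)"
      by (subst nn_integral_cmult_indicator) auto
    also have "\<dots> \<le> (\<integral>\<^sup>+y. (\<Sum>i=1..N. ennreal ((1 + C) * h) * indicator (B (s i)) y) \<partial>lborel)"
    proof (rule nn_integral_mono)
      fix y :: 'a
      show "ennreal (1/8) * indicator (ball (0::'a) (1/4)) y \<le> (\<Sum>i=1..N. ennreal ((1 + C) * h) * indicator (B (s i)) y)"
      proof (cases "y \<in> ball 0 (1/4)")
        case True
        have "(\<Sum>i=1..N. indicator (B (s i)) y) = (\<Sum>i=1..N. ennreal (indicator (B (s i)) y))"
          by (simp only: ennreal_indicator)
        also have "\<dots> = ennreal (\<Sum>i=1..N. indicator (B (s i)) y)" by (rule sum_ennreal) simp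
        finally have ind: "(\<Sum>i=1..N. indicator (B (s i)) y) = ennreal (\<Sum>i=1..N. indicator (B (s i)) y)" .
        have "ennreal (1/8) \<le> ennreal ((1 + C) * h * (\<Sum>i=1..N. indicator (B (s i)) y))"
          using many[OF True] by (intro ennreal_leI)
        also have "\<dots> = (\<Sum>i=1..N. ennreal ((1 + C) * h) * indicator (B (s i)) y)"
          unfolding sum_distrib_left[symmetric] ind using C h by (intro ennreal_mult sum_nonneg) auto
        finally show ?thesis using True by simp
      qed auto
    qed
    also have "\<dots> = (\<Sum>i=1..N. ennreal ((1 + C) * h) * emeasure lborel (B (s i)))"
      using B(1) sI by (subst nn_integral_sum) (auto simp: nn_integral_cmult_indicator)
    also have "\<dots> \<le> (\<Sum>i=1..N. ennreal ((1 + C) * h) * (ennreal ((5 * L) ^ DIM('a)) * ennreal \<epsilon>))"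
      using B(3) sI by (intro sum_mono mult_left_mono) auto
    also have "\<dots> = ennreal (real N * ((1 + C) * h * ((5 * L) ^ DIM('a) * \<epsilon>)))"
      using C h L \<epsilon> by (simp add: ennreal_mult ennreal_of_nat_eq_real_of_nat)
    also have "real N * ((1 + C) * h * ((5 * L) ^ DIM('a) * \<epsilon>)) = (real N * h) * ((1 + C) * (5 * L) ^ DIM('a) * \<epsilon>)"
      by simp
    also have "\<dots> = V / 16"
    proof -
      have "1 * (c * P * (V / (16 * c * P))) = V / 16" if "c > 0" "P > 0" for c P :: real
        using that by simp
      then show ?thesis unfolding h(3) \<epsilon>_def using C L by (metis add_pos_pos mult_pos_pos zero_less_numeral zero_less_one zero_less_power)
    qed
    finally have le: "ennreal (1/8) * emeasure lborel (ball (0::'a) (1/4)) \<le> ennreal (V / 16)" .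
    have "emeasure lborel (ball (0::'a) (1/4)) = ennreal V"
      by (subst emeasure_ball) (simp_all add: V_def n_def)
    then have "ennreal (1/8) * emeasure lborel (ball (0::'a) (1/4)) = ennreal (1/8 * V)"
      using V by (simp only: ennreal_mult[of "1/8" V])
    with le have "ennreal (1/8 * V) \<le> ennreal (V / 16)" by (simp only:)
    then show False using V by (simp add: ennreal_le_iff)
  qed
  show ?thesis
  proof (intro exI[of _ \<epsilon>] conjI allI impI)
    fix u :: "real \<Rightarrow> 'a \<Rightarrow> real"
    assume u: "classical_near m {-1..0} (cball 0 1) u \<and>
     (\<forall>t\<in>{-1..0}. \<forall>x\<in>cball 0 1. u t x \<le> 17/16) \<and>
     (\<forall>t\<in>{-1..0}. emeasure lborel {x \<in> ball 0 1. u t x > 1/2} \<le> ennreal \<epsilon>)"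
    then obtain S ut g H where "open S" "cball 0 1 \<subseteq> S" "classical_fde m {-1..0} S u ut g H"
      by (auto simp: classical_near_def)
    then show "u 0 0 < 1" by (rule main) (use u in simp_all)
  qed (rule \<epsilon>)
qed

section \<open>From a weak Lebesgue bound to a pointwise bound\<close>

text \<open>
  The maximum \<open>N\<close> of \<open>u (t - 1/2)\<^sup>a (1/2 - |x|)\<^sup>b\<close> is bounded by a constant. The exponent \<open>b = 2/(1-m)\<close> makes the
  intrinsic radius \<open>l\<close> at the maximum point small compared with the distance \<open>d\<close> to the lateral boundary when \<open>N\<close> is large,
  and \<open>a = n/(2p - n(1-m))\<close>, where \<open>n\<close> is the dimension, makes the rescaled measure of \<open>{u > K/2}\<close> small when \<open>N\<close> is large.
\<close>

lemma bounded_of_weak_Lp_bound: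
  fixes m p K1 :: real
  assumes m: "m < 1" and p: "2 * p > real DIM('a) * (1 - m)" and K1: "K1 > 0"
  shows "\<exists>C>0. \<forall>u :: real \<Rightarrow> 'a::euclidean_space \<Rightarrow> real.
     classical_near m {1/2..1} (cball 0 (1/2)) u \<and>
     (\<forall>t\<in>{1/2..1}. \<forall>\<mu>>0. emeasure lborel {x \<in> ball 0 (1/2). u t x > \<mu>} \<le> ennreal (K1 * \<mu> powr (- p)))
     \<longrightarrow> u 1 0 \<le> C"
proof -
  define n where "n = real DIM('a)"
  have n1: "n \<ge> 1" using DIM_ge_Suc0[where 'a='a] by (simp add: n_def)
  obtain \<epsilon> where \<epsilon>: "\<epsilon> > 0" and lower: "\<forall>u :: real \<Rightarrow> 'a \<Rightarrow> real.
     classical_near m {-1..0} (cball 0 1) u \<and>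
     (\<forall>t\<in>{-1..0}. \<forall>x\<in>cball 0 1. u t x \<le> 17/16) \<and>
     (\<forall>t\<in>{-1..0}. emeasure lborel {x \<in> ball 0 1. u t x > 1/2} \<le> ennreal \<epsilon>)
     \<longrightarrow> u 0 0 < 1"
    using small_superlevel_sets_lower_value[OF m, where 'a='a] by (elim exE conjE) (rule that)
  define q where "q = 2 * p - n * (1 - m)"
  have q: "q > 0" using p by (simp add: q_def n_def)
  define a where "a = n / q"
  define b where "b = 2 / (1 - m)"
  have a: "a > 0" using n1 q by (simp add: a_def)
  have b: "b > 0" using m by (simp add: b_def)
  have "((\<lambda>\<kappa>. (1 - \<kappa>) powr (a + b)) \<longlongrightarrow> (1 - 0) powr (a + b)) (at_right (0::real))"
    by (intro tendsto_intros) auto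
  then have "\<forall>\<^sub>F \<kappa> in at_right (0::real). (1 - \<kappa>) powr (a + b) > 16/17"
    by (intro order_tendstoD(1)) auto
  moreover have "\<forall>\<^sub>F \<kappa> in at_right (0::real). \<kappa> < 1/2" "\<forall>\<^sub>F \<kappa> in at_right (0::real). \<kappa> > 0"
    by (auto intro: eventually_at_right_less simp: eventually_at_right_field intro!: exI[of _ "1/2"])
  ultimately have "\<forall>\<^sub>F \<kappa> in at_right (0::real). (1 - \<kappa>) powr (a + b) > 16/17 \<and> \<kappa> < 1/2 \<and> \<kappa> > 0"
    by (intro eventually_conj)
  \<comment> \<open>On the intrinsic cylinder both factors of the weight lose at most the factor \<open>1 - \<kappa>\<close>, so \<open>u\<close> is at most \<open>17/16 K\<close> there.\<close>
  then obtain \<kappa> where \<kappa>: "(1 - \<kappa>) powr (a + b) > 16/17" "\<kappa> < 1/2" "\<kappa> > 0"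
    using eventually_happens'[OF trivial_limit_at_right_real] by blast
  \<comment> \<open>If \<open>N > N1\<close>, then \<open>l \<le> \<kappa> d\<close>; if \<open>N > N2\<close>, the rescaled superlevel sets have measure at most \<open>\<epsilon>\<close>.\<close>
  define N1 where "N1 = (1 / \<kappa>) powr (1 / (1 - m))"
  define N2 where "N2 = (K1 * 2 powr p / (\<epsilon> * \<kappa> powr (n / 2))) powr (2 / q)"
  define N0 where "N0 = max 1 (max N1 N2)"
  define C where "C = N0 * 2 powr (a + b)"
  have main: "u 1 0 \<le> C"
    if S: "open S" "cball 0 (1/2) \<subseteq> S" and u: "classical_fde m {1/2..1} S u ut g H"
     and cheb: "\<And>t \<mu>. t \<in> {1/2..1} \<Longrightarrow> \<mu> > 0 \<Longrightarrow>
        emeasure lborel {x \<in> ball 0 (1/2). u t x > \<mu>} \<le> ennreal (K1 * \<mu> powr (- p))"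
    for u :: "real \<Rightarrow> 'a \<Rightarrow> real" and ut g H S
  proof -
    define F where "F z = (case z of (t, x) \<Rightarrow> u t x * ((t - 1/2) powr a * (1/2 - norm x) powr b))" for z :: "real \<times> 'a"
    define Q where "Q = {1/2..1::real} \<times> cball (0::'a) (1/2)"
    have "continuous_on Q (\<lambda>(t, x). u t x)"
      unfolding Q_def by (rule continuous_on_subset[OF classical_fde_continuous(1)[OF u]]) (use S(2) in auto)
    then have "continuous_on Q F"
      unfolding F_def case_prod_unfold
      by (intro continuous_on_mult continuous_on_powr' continuous_on_diff continuous_on_norm
          continuous_on_fst continuous_on_snd continuous_on_id continuous_on_const) (auto simp: Q_def a b)
    moreover have "compact Q" "Q \<noteq> {}" unfolding Q_def by (auto intro!: compact_Times)
    ultimately obtain z1 where z1: "z1 \<in> Q" "\<And>z. z \<in> Q \<Longrightarrow> F z \<le> F z1"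
      using continuous_attains_sup by metis
    obtain t1 x1 where tx: "z1 = (t1, x1)" by (cases z1)
    define N where "N = F z1"
    have F10: "F (1, 0) = u 1 0 * (1/2) powr (a + b)" by (simp add: F_def powr_add)
    have "N \<le> N0"
    proof (rule ccontr)
      assume "\<not> N \<le> N0"
      then have N: "N > 1" "N > N1" "N > N2" by (auto simp: N0_def)
      define \<sigma> where "\<sigma> = t1 - 1/2"
      define d where "d = 1/2 - norm x1"
      define K where "K = u t1 x1"
      have t1: "t1 \<in> {1/2..1}" and x1: "x1 \<in> cball 0 (1/2)" using z1(1) by (auto simp: tx Q_def)
      have NK: "N = K * (\<sigma> powr a * d powr b)" by (simp add: N_def tx F_def K_def \<sigma>_def d_def)
      have "\<sigma> \<noteq> 0" "d \<noteq> 0" using NK N by auto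
      then have \<sigma>: "0 < \<sigma>" "\<sigma> \<le> 1/2" and d: "0 < d" "d \<le> 1/2" using t1 x1 by (auto simp: \<sigma>_def d_def)
      have x1S: "x1 \<in> S" using x1 S by auto
      have K: "K > 0" unfolding K_def by (rule classical_fdeD(1)[OF u t1 x1S])
      define \<omega> where "\<omega> = \<sigma> powr a * d powr b"
      have \<omega>: "\<omega> > 0" using \<sigma> d by (simp add: \<omega>_def)
      have \<omega>1: "d powr b \<le> 1" "\<sigma> powr a \<le> 1"
        using powr_mono2[of b d 1] powr_mono2[of a \<sigma> 1] a b \<sigma> d by auto
      define \<tau> where "\<tau> = \<kappa> * \<sigma>"
      define l where "l = sqrt (\<tau> * K powr (m - 1))"
      have \<tau>: "\<tau> > 0" using \<kappa> \<sigma> by (simp add: \<tau>_def)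
      have l: "l > 0" using \<tau> K by (simp add: l_def)
      have l2: "l\<^sup>2 = \<tau> * K powr (m - 1)" using \<tau> K by (simp add: l_def)
      have l_le: "l \<le> \<kappa> * d"
      proof -
        have "N powr (1 - m) = K powr (1 - m) * (\<sigma> powr (a * (1 - m)) * d powr (b * (1 - m)))"
          unfolding NK using K \<sigma> d by (simp add: powr_mult powr_powr)
        also have "b * (1 - m) = 2" using m b_def nonzero_eq_divide_eq[of "1 - m" b 2] by simp
        also have "d powr 2 = d\<^sup>2" using d by (simp add: powr_numeral)
        finally have e: "N powr (1 - m) = K powr (1 - m) * (\<sigma> powr (a * (1 - m)) * d\<^sup>2)" .
        have "\<sigma> powr (a * (1 - m)) \<le> 1" using powr_mono2[of "a * (1 - m)" \<sigma> 1] a m \<sigma> by auto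
        then have "\<sigma> powr (a * (1 - m)) * d\<^sup>2 \<le> 1 * d\<^sup>2" by (intro mult_right_mono) auto
        then have "N powr (1 - m) \<le> K powr (1 - m) * d\<^sup>2" unfolding e using K by (intro mult_left_mono) auto
        moreover have "N powr (1 - m) \<ge> 1 / \<kappa>"
        proof -
          have "N1 powr (1 - m) \<le> N powr (1 - m)" using N m by (intro powr_mono2) (auto simp: N1_def)
          then show ?thesis using m \<kappa> by (simp add: N1_def powr_powr)
        qed
        ultimately have "1 / \<kappa> \<le> K powr (1 - m) * d\<^sup>2" by simp
        then have "1 \<le> \<kappa> * K powr (1 - m) * d\<^sup>2" using \<kappa> by (simp add: field_simps)
        then have "K powr (m - 1) * 1 \<le> K powr (m - 1) * (\<kappa> * K powr (1 - m) * d\<^sup>2)"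
          using K by (intro mult_left_mono) auto
        also have "\<dots> = (K powr (m - 1) * K powr (1 - m)) * (\<kappa> * d\<^sup>2)" by simp
        also have "K powr (m - 1) * K powr (1 - m) = 1" using K by (simp add: powr_add[symmetric])
        finally have "K powr (m - 1) \<le> \<kappa> * d\<^sup>2" by simp
        then have "l\<^sup>2 \<le> \<tau> * (\<kappa> * d\<^sup>2)" unfolding l2 using \<tau> by (intro mult_left_mono) auto
        also have "\<dots> \<le> \<kappa> * (\<kappa> * d\<^sup>2)" using \<sigma> \<kappa> by (intro mult_right_mono) (auto simp: \<tau>_def)
        also have "\<dots> = (\<kappa> * d)\<^sup>2" by (simp add: power2_eq_square)
        finally show ?thesis using l \<kappa> d by (simp add: power2_le_iff_abs_le abs_le_square_iff[symmetric])
      qed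
      define U where "U s x = inverse K * u (t1 + \<tau> * s) (x1 + l *\<^sub>R x)" for s x
      have tin: "t1 + \<tau> * s \<in> {1/2..1}" "t1 + \<tau> * s - 1/2 \<ge> (1 - \<kappa>) * \<sigma>" if "s \<in> {-1..0}" for s
      proof -
        have "\<tau> * s \<ge> \<tau> * (-1)" using that \<tau> by (intro mult_left_mono) auto
        moreover have "(1 - \<kappa>) * \<sigma> = \<sigma> - \<tau>" by (simp add: \<tau>_def left_diff_distrib)
        moreover have "t1 = \<sigma> + 1/2" by (simp add: \<sigma>_def)
        ultimately show ge: "t1 + \<tau> * s - 1/2 \<ge> (1 - \<kappa>) * \<sigma>" by linarith
        have "(1 - \<kappa>) * \<sigma> \<ge> 0" using \<kappa> \<sigma> by simp
        moreover have "\<tau> * s \<le> 0" using that \<tau> by (simp add: mult_nonneg_nonpos)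
        ultimately show "t1 + \<tau> * s \<in> {1/2..1}" using ge t1 by auto
      qed
      have xin: "x1 + l *\<^sub>R x \<in> ball 0 (1/2)" "1/2 - norm (x1 + l *\<^sub>R x) \<ge> (1 - \<kappa>) * d" if "x \<in> cball 0 1" for x
      proof -
        have "norm (l *\<^sub>R x) \<le> l * 1" using that l by (simp add: mult_left_le)
        then have "norm (x1 + l *\<^sub>R x) \<le> norm x1 + \<kappa> * d"
          using norm_triangle_ineq[of x1 "l *\<^sub>R x"] l_le by linarith
        moreover have "(1 - \<kappa>) * d = d - \<kappa> * d" by (simp add: left_diff_distrib)
        moreover have "norm x1 = 1/2 - d" by (simp add: d_def)
        ultimately show ge: "1/2 - norm (x1 + l *\<^sub>R x) \<ge> (1 - \<kappa>) * d" by linarith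
        have "(1 - \<kappa>) * d > 0" using \<kappa> d by simp
        then show "x1 + l *\<^sub>R x \<in> ball 0 (1/2)" using ge by simp
      qed
      define S' where "S' = (\<lambda>x. x1 + l *\<^sub>R x) -` S"
      have S'o: "open S'" unfolding S'_def
        by (rule open_vimage[OF S(1)]) (intro continuous_intros)
      have S'c: "cball 0 1 \<subseteq> S'"
      proof
        fix x :: 'a assume "x \<in> cball 0 1"
        then have "x1 + l *\<^sub>R x \<in> cball 0 (1/2)" using xin(1) ball_subset_cball by blast
        then show "x \<in> S'" using S(2) by (auto simp: S'_def)
      qed
      have scale: "inverse K * \<tau> = inverse K powr m * l\<^sup>2"
      proof -
        have "inverse K powr m * (K powr (m - 1)) = inverse K"
          using K by (simp add: inverse_powr powr_minus[symmetric] powr_add[symmetric])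
            (simp add: divide_inverse)
        then show ?thesis unfolding l2 by (simp add: mult_ac)
      qed
      have "classical_fde m {-1..0} S' (\<lambda>s x. inverse K * u (t1 + \<tau> * s) (x1 + l *\<^sub>R x))
         (\<lambda>s x. inverse K * \<tau> * ut (t1 + \<tau> * s) (x1 + l *\<^sub>R x))
         (\<lambda>s x. (inverse K * l) *\<^sub>R g (t1 + \<tau> * s) (x1 + l *\<^sub>R x))
         (\<lambda>s x h. (inverse K * l\<^sup>2) *\<^sub>R H (t1 + \<tau> * s) (x1 + l *\<^sub>R x) h)"
        by (rule classical_fde_rescale[OF u _ l scale]) (use K tin in \<open>auto simp: S'_def\<close>)
      then have "classical_fde m {-1..0} S' U
         (\<lambda>s x. inverse K * \<tau> * ut (t1 + \<tau> * s) (x1 + l *\<^sub>R x))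
         (\<lambda>s x. (inverse K * l) *\<^sub>R g (t1 + \<tau> * s) (x1 + l *\<^sub>R x))
         (\<lambda>s x h. (inverse K * l\<^sup>2) *\<^sub>R H (t1 + \<tau> * s) (x1 + l *\<^sub>R x) h)"
        unfolding U_def[abs_def] .
      then have near: "classical_near m {-1..0} (cball 0 1) U" by (rule classical_nearI[OF S'o S'c])
      moreover have Ub: "U s x \<le> 17/16" if s: "s \<in> {-1..0}" and x: "x \<in> cball 0 1" for s x
      proof -
        define t where "t = t1 + \<tau> * s"
        define y where "y = x1 + l *\<^sub>R x"
        have yc: "y \<in> cball 0 (1/2)" using xin(1)[OF x] ball_subset_cball unfolding y_def by blast
        have "(t, y) \<in> Q" using tin(1)[OF s] yc by (simp add: Q_def t_def)
        then have "u t y * ((t - 1/2) powr a * (1/2 - norm y) powr b) \<le> K * \<omega>"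
          using z1(2)[of "(t, y)"] NK by (simp add: F_def N_def \<omega>_def)
        moreover have "(16/17) * \<omega> \<le> (t - 1/2) powr a * (1/2 - norm y) powr b"
        proof -
          have "(16/17) * \<omega> \<le> (1 - \<kappa>) powr (a + b) * \<omega>" using \<kappa> \<omega> by (intro mult_right_mono) auto
          also have "\<dots> = ((1 - \<kappa>) * \<sigma>) powr a * ((1 - \<kappa>) * d) powr b"
            using \<kappa> \<sigma> d by (simp add: \<omega>_def powr_mult powr_add)
          also have "\<dots> \<le> (t - 1/2) powr a * (1/2 - norm y) powr b"
            using tin(2)[OF s] xin(2)[OF x] \<kappa> \<sigma> d a b unfolding t_def y_def
            by (intro mult_mono powr_mono2) auto
          finally show ?thesis .
        qed
        moreover have uy: "u t y > 0" using classical_fdeD(1)[OF u] tin(1)[OF s] yc S(2) unfolding t_def by blast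
        ultimately have "u t y * ((16/17) * \<omega>) \<le> K * \<omega>"
          by (meson mult_left_mono less_imp_le order_trans)
        then have "u t y * (16/17) \<le> K" using \<omega> by (simp add: mult.assoc[symmetric] mult_le_cancel_right)
        then have "u t y \<le> 17/16 * K" by simp
        then show ?thesis using K by (simp add: U_def t_def[symmetric] y_def[symmetric] field_simps)
      qed
      moreover have "emeasure lborel {x \<in> ball 0 1. U s x > 1/2} \<le> ennreal \<epsilon>" if s: "s \<in> {-1..0}" for s
      proof -
        define t where "t = t1 + \<tau> * s"
        define E where "E = {y \<in> ball 0 (1/2). u t y > K / 2}"
        have tI: "t \<in> {1/2..1}" using tin(1)[OF s] by (simp add: t_def)
        have "continuous_on S (u t)" by (rule continuous_on_slice[OF classical_fde_continuous(1)[OF u] tI])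
        then have "continuous_on (ball 0 (1/2)) (u t)"
          using S(2) ball_subset_cball continuous_on_subset by (metis order_trans)
        from continuous_open_preimage[OF this open_ball open_greaterThan, of "K/2"]
        have "open (ball 0 (1/2) \<inter> u t -` {K/2<..})" .
        moreover have "E = ball 0 (1/2) \<inter> u t -` {K/2<..}" by (auto simp: E_def)
        ultimately have E: "open E" by simp
        define v0 where "v0 = - (inverse l *\<^sub>R x1)"
        have sub: "(\<lambda>x. x1 + l *\<^sub>R x) ` {x \<in> ball 0 1. U s x > 1/2} \<subseteq> E"
        proof
          fix y assume "y \<in> (\<lambda>x. x1 + l *\<^sub>R x) ` {x \<in> ball 0 1. U s x > 1/2}"
          then obtain x where x: "x \<in> ball 0 1" "U s x > 1/2" "y = x1 + l *\<^sub>R x" by auto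
          then have "y \<in> ball 0 (1/2)" using xin(1) by auto
          moreover have "u t y > K / 2" using x(2,3) K by (simp add: U_def t_def field_simps)
          ultimately show "y \<in> E" by (simp add: E_def)
        qed
        have "{x \<in> ball 0 1. U s x > 1/2} \<subseteq> (\<lambda>y. inverse l *\<^sub>R y + v0) ` E"
        proof
          fix x assume x: "x \<in> {x \<in> ball 0 1. U s x > 1/2}"
          have "x = inverse l *\<^sub>R (x1 + l *\<^sub>R x) + v0" using l by (simp add: v0_def scaleR_right_distrib)
          then show "x \<in> (\<lambda>y. inverse l *\<^sub>R y + v0) ` E" using sub x by blast
        qed
        moreover have Em: "(\<lambda>y. inverse l *\<^sub>R y + v0) ` E \<in> sets lebesgue"
        proof -
          have "open ((\<lambda>y. v0 + inverse l *\<^sub>R y) ` E)"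
            by (rule open_affinity[OF E]) (use l in simp)
          then show ?thesis by (simp add: add.commute)
        qed
        ultimately have "emeasure lebesgue {x \<in> ball 0 1. U s x > 1/2} \<le> emeasure lebesgue ((\<lambda>y. inverse l *\<^sub>R y + v0) ` E)"
          by (intro emeasure_mono)
        also have "\<dots> = ennreal (\<bar>inverse l\<bar> ^ DIM('a)) * emeasure lebesgue E"
          using emeasure_lebesgue_affine[of "inverse l" v0 E] by (simp add: add.commute)
        also have "emeasure lebesgue E = emeasure lborel E" using E by simp
        also have "\<dots> \<le> ennreal (K1 * (K / 2) powr (- p))"
          unfolding E_def by (rule cheb[OF tI]) (use K in auto)
        finally have "emeasure lebesgue {x \<in> ball 0 1. U s x > 1/2} \<le>
            ennreal (\<bar>inverse l\<bar> ^ DIM('a)) * ennreal (K1 * (K / 2) powr (- p))"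
          by (simp add: mult_left_mono)
        also have "\<dots> = ennreal (inverse l ^ DIM('a) * (K1 * (K / 2) powr (- p)))"
          using l K K1 by (simp add: ennreal_mult)
        also have "\<dots> \<le> ennreal \<epsilon>"
        proof (rule ennreal_leI)
          have ln: "l ^ DIM('a) = l powr n" using l by (simp add: n_def powr_realpow)
          have "l powr n = (l powr 2) powr (n / 2)" by (simp add: powr_powr)
          also have "l powr 2 = l\<^sup>2" using l by (simp add: powr_numeral)
          also have "(l\<^sup>2) powr (n / 2) = \<kappa> powr (n / 2) * \<sigma> powr (n / 2) * K powr ((m - 1) * (n / 2))"
            unfolding l2 \<tau>_def using \<kappa> \<sigma> K by (simp add: powr_mult powr_powr)
          finally have lp: "l powr n = \<kappa> powr (n / 2) * \<sigma> powr (n / 2) * K powr ((m - 1) * (n / 2))" .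
          have "K powr p * K powr ((m - 1) * (n / 2)) = K powr (q / 2)"
            unfolding powr_add[symmetric] by (rule arg_cong[of _ _ "\<lambda>z. K powr z"]) (simp add: q_def field_simps)
          then have big: "K powr p * l powr n = \<kappa> powr (n / 2) * (\<sigma> powr (n / 2) * K powr (q / 2))"
            unfolding lp by (simp add: mult_ac)
          have "N powr (q / 2) \<le> \<sigma> powr (n / 2) * K powr (q / 2)"
          proof -
            have "K * (\<sigma> powr a * d powr b) \<le> K * (\<sigma> powr a * 1)"
              using \<omega>1 K by (intro mult_left_mono) auto
            then have "N powr (q / 2) \<le> (K * \<sigma> powr a) powr (q / 2)"
              unfolding NK using K q by (intro powr_mono2) auto
            also have "\<dots> = K powr (q / 2) * \<sigma> powr (n / 2)"
              using K q by (simp add: powr_mult powr_powr a_def)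
            finally show ?thesis by (simp add: mult.commute)
          qed
          moreover have "K1 * 2 powr p / (\<epsilon> * \<kappa> powr (n / 2)) \<le> N powr (q / 2)"
          proof -
            have "N2 powr (q / 2) \<le> N powr (q / 2)" using N q by (intro powr_mono2) (auto simp: N2_def)
            then show ?thesis using q K1 \<epsilon> \<kappa> by (simp add: N2_def powr_powr)
          qed
          ultimately have "K1 * 2 powr p / (\<epsilon> * \<kappa> powr (n / 2)) \<le> \<sigma> powr (n / 2) * K powr (q / 2)"
            by linarith
          then have "K1 * 2 powr p \<le> \<epsilon> * (\<kappa> powr (n / 2) * (\<sigma> powr (n / 2) * K powr (q / 2)))"
            using \<epsilon> \<kappa> by (simp add: field_simps)
          then have "K1 * 2 powr p \<le> \<epsilon> * (K powr p * l powr n)" by (simp only: big)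
          then have le: "(K1 * 2 powr p) / (K powr p * l powr n) \<le> \<epsilon>"
            by (subst pos_divide_le_eq) (use K l in auto)
          have "(K / 2) powr (- p) = 2 powr p / K powr p"
            using K by (simp add: powr_divide powr_minus_divide)
          moreover have "inverse l ^ DIM('a) = 1 / l powr n"
            unfolding ln[symmetric] by (simp add: power_one_over inverse_eq_divide)
          ultimately have "inverse l ^ DIM('a) * (K1 * (K / 2) powr (- p)) = (K1 * 2 powr p) / (K powr p * l powr n)"
            by (simp add: mult.commute)
          then show "inverse l ^ DIM('a) * (K1 * (K / 2) powr (- p)) \<le> \<epsilon>" using le by (simp only:)
        qed
        finally have le: "emeasure lebesgue {x \<in> ball 0 1. U s x > 1/2} \<le> ennreal \<epsilon>" .
        have "{x \<in> ball 0 1. U s x > 1/2} = ball 0 1 \<inter> (\<lambda>x. x1 + l *\<^sub>R x) -` E"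
          using xin(1) K by (auto simp: E_def U_def t_def field_simps subset_iff)
        also have "open \<dots>" by (intro open_Int open_ball open_vimage[OF E] continuous_intros)
        finally show ?thesis using le by simp
      qed
      ultimately have "U 0 0 < 1" by (intro lower[THEN spec, THEN mp] conjI ballI)
      then show False using K by (simp add: U_def K_def)
    qed
    moreover have "F (1, 0) \<le> N" unfolding N_def by (rule z1(2)) (simp add: Q_def)
    ultimately have "u 1 0 * (1/2) powr (a + b) \<le> N0" using F10 by simp
    then have "u 1 0 * (1/2) powr (a + b) * 2 powr (a + b) \<le> C"
      unfolding C_def by (intro mult_right_mono) auto
    then show ?thesis by (simp add: mult.assoc powr_mult[symmetric])
  qed
  show ?thesis
  proof (intro exI[of _ C] conjI allI impI)
    show "C > 0" by (simp add: C_def N0_def less_max_iff_disj)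
    fix u :: "real \<Rightarrow> 'a \<Rightarrow> real"
    assume u: "classical_near m {1/2..1} (cball 0 (1/2)) u \<and>
     (\<forall>t\<in>{1/2..1}. \<forall>\<mu>>0. emeasure lborel {x \<in> ball 0 (1/2). u t x > \<mu>} \<le> ennreal (K1 * \<mu> powr (- p)))"
    then obtain S ut g H where "open S" "cball 0 (1/2) \<subseteq> S" "classical_fde m {1/2..1} S u ut g H"
      by (auto simp: classical_near_def)
    then show "u 1 0 \<le> C" by (rule main) (use u in simp_all)
  qed
qed

section \<open>Integrals of directional derivatives\<close>

text \<open>
  Difference quotients have integral zero by translation invariance, and they converge boundedly.
\<close>

lemma integral_directional_derivative_zero:
  fixes G :: "'a::euclidean_space \<Rightarrow> real"
  assumes der: "\<And>x. ((\<lambda>s. G (x + s *\<^sub>R e)) has_real_derivative G' x) (at 0)"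
    and cont: "continuous_on UNIV G'"
    and K: "compact K" "\<And>x. x \<notin> K \<Longrightarrow> G x = 0" "\<And>x. x \<notin> K \<Longrightarrow> G' x = 0"
    and G: "continuous_on UNIV G"
  shows "integrable lborel G'" "(\<integral>x. G' x \<partial>lborel) = 0"
proof -
  have Gder: "((\<lambda>s. G (x + s *\<^sub>R e)) has_real_derivative G' (x + s *\<^sub>R e)) (at s)" for x s
  proof -
    have "((\<lambda>r. G ((x + s *\<^sub>R e) + r *\<^sub>R e)) has_real_derivative G' (x + s *\<^sub>R e)) (at (0 + 0))"
      using der by simp
    then have "((\<lambda>r. G ((x + s *\<^sub>R e) + (r - s) *\<^sub>R e)) has_real_derivative G' (x + s *\<^sub>R e)) (at s)"
    proof -
      have 1: "((\<lambda>r. r - s) has_real_derivative 1) (at s)" by (auto intro!: derivative_eq_intros)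
      have 0: "((\<lambda>r. G ((x + s *\<^sub>R e) + r *\<^sub>R e)) has_real_derivative G' (x + s *\<^sub>R e)) (at (s - s))"
        using der by simp
      show ?thesis using DERIV_chain2[OF 0 1] by simp
    qed
    then show ?thesis by (simp add: algebra_simps)
  qed
  obtain Bd where Bd: "\<And>x. \<bar>G' x\<bar> \<le> Bd" "Bd \<ge> 0"
  proof -
    have "bounded (G' ` K)" using compact_continuous_image[OF continuous_on_subset[OF cont] K(1)] compact_imp_bounded by blast
    then obtain b where "\<forall>x\<in>K. \<bar>G' x\<bar> \<le> b" by (auto simp: bounded_iff)
    then have "\<bar>G' x\<bar> \<le> max 0 b" for x using K(3)[of x] by (cases "x \<in> K") (auto simp: max_def)
    then show ?thesis using that[of "max 0 b"] by auto
  qed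
  \<comment> \<open>The supports of the difference quotients with steps in \<open>[0, 1]\<close>, translated back.\<close>
  define K2 where "K2 = (\<lambda>(x, s). x - s *\<^sub>R e) ` (K \<times> {0..1::real})"
  have K2: "compact K2"
    unfolding K2_def using K(1)
    by (intro compact_continuous_image compact_Times) (auto simp: case_prod_unfold intro!: continuous_intros)
  have int: "integrable lborel f" if "continuous_on UNIV f" "\<And>x. x \<notin> K \<Longrightarrow> f x = 0" for f :: "'a \<Rightarrow> real"
  proof -
    have "integrable lborel (\<lambda>x. indicator K x *\<^sub>R f x)"
      by (rule borel_integrable_compact[OF K(1)]) (use that continuous_on_subset in blast)
    also have "(\<lambda>x. indicator K x *\<^sub>R f x) = f" using that by (auto simp: fun_eq_iff indicator_def)
    finally show ?thesis .
  qed
  show intG': "integrable lborel G'" by (rule int[OF cont K(3)])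
  have intG: "integrable lborel G" by (rule int[OF G K(2)])
  define h where "h k = 1 / real (Suc k)" for k
  have h: "0 < h k" "h k \<le> 1" for k by (auto simp: h_def)
  have h0: "h \<longlonglongrightarrow> 0" unfolding h_def by (rule LIMSEQ_Suc[OF lim_1_over_n])
  define D where "D k x = (G (x + h k *\<^sub>R e) - G x) / h k" for k x
  have bm: "G \<in> borel_measurable borel" "G' \<in> borel_measurable borel"
    using G cont by (auto intro: borel_measurable_continuous_onI)
  have transl: "(\<integral>x. G (x + c) \<partial>lborel) = (\<integral>x. G x \<partial>lborel)" "integrable lborel (\<lambda>x. G (x + c))" for c
  proof -
    have eq: "(\<lambda>x. x + c) = (+) c" by (auto simp: fun_eq_iff add.commute)
    have d: "distr lborel borel (\<lambda>x. x + c) = lborel" unfolding eq by (rule lborel_distr_plus)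
    show "(\<integral>x. G (x + c) \<partial>lborel) = (\<integral>x. G x \<partial>lborel)"
      using integral_distr[of "\<lambda>x. x + c" lborel borel G] bm by (simp add: d)
    show "integrable lborel (\<lambda>x. G (x + c))"
      using integrable_distr_eq[of "\<lambda>x. x + c" lborel borel G] bm intG by (simp add: d)
  qed
  have D0: "(\<integral>x. D k x \<partial>lborel) = 0" for k
    unfolding D_def using transl intG by simp
  have "(\<lambda>k. \<integral>x. D k x \<partial>lborel) \<longlonglongrightarrow> (\<integral>x. G' x \<partial>lborel)"
  proof (rule integral_dominated_convergence)
    show "integrable lborel (\<lambda>x. indicator (K \<union> K2) x *\<^sub>R Bd)"
      by (rule borel_integrable_compact) (use K K2 in auto)
    show "AE x in lborel. (\<lambda>k. D k x) \<longlonglongrightarrow> G' x"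
    proof (rule AE_I2)
      fix x
      have "((\<lambda>r. (G (x + r *\<^sub>R e) - G x) / r) \<longlongrightarrow> G' x) (at 0)"
        using der[of x] by (simp add: DERIV_def)
      moreover have "filterlim h (at 0) sequentially"
        using h0 h(1) by (auto simp: filterlim_at intro!: always_eventually less_imp_neq[THEN not_sym])
      ultimately show "(\<lambda>k. D k x) \<longlonglongrightarrow> G' x"
        unfolding D_def by (rule filterlim_compose)
    qed
    show "AE x in lborel. norm (D k x) \<le> indicator (K \<union> K2) x *\<^sub>R Bd" for k
    proof (rule AE_I2)
      fix x
      have "\<exists>z>0. z < h k \<and> G (x + h k *\<^sub>R e) - G (x + 0 *\<^sub>R e) = (h k - 0) * G' (x + z *\<^sub>R e)"
        by (rule MVT2[OF h(1) Gder])
      then obtain z where z: "0 < z" "z < h k" "G (x + h k *\<^sub>R e) - G x = h k * G' (x + z *\<^sub>R e)" by auto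
      then have De: "D k x = G' (x + z *\<^sub>R e)" using h(1)[of k] by (simp add: D_def)
      show "norm (D k x) \<le> indicator (K \<union> K2) x *\<^sub>R Bd"
      proof (cases "x \<in> K \<union> K2")
        case True then show ?thesis using De Bd by simp
      next
        case False
        have "x + z *\<^sub>R e \<notin> K"
        proof
          assume "x + z *\<^sub>R e \<in> K"
          then have "(x + z *\<^sub>R e) - z *\<^sub>R e \<in> K2" unfolding K2_def using z h(2)[of k] by (intro image_eqI[of _ _ "(x + z *\<^sub>R e, z)"]) auto
          then show False using False by simp
        qed
        then show ?thesis using De K(3) Bd by simp
      qed
    qed
  qed (use bm in \<open>auto simp: D_def\<close>)
  then have "(\<lambda>k. 0 :: real) \<longlonglongrightarrow> (\<integral>x. G' x \<partial>lborel)" by (simp add: D0)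
  then show "(\<integral>x. G' x \<partial>lborel) = 0" using LIMSEQ_unique tendsto_const by blast
qed

section \<open>A polynomial cutoff and an antiderivative\<close>

lemma continuous_on_paste_zero:
  assumes "closed A" "closed B" "continuous_on A f" "\<And>x. x \<in> B \<Longrightarrow> f x = (0 :: 'b::real_normed_vector)"
  shows "continuous_on (A \<union> B) f"
proof (rule continuous_on_closed_Un[OF assms(1,2,3)])
  show "continuous_on B f"
    using continuous_on_const[of B "0::'b"] by (rule continuous_on_eq) (simp add: assms(4))
qed

lemma has_real_derivative_positive_part_power:
  "((\<lambda>r. max 0 r ^ (l + 2)) has_real_derivative real (l + 2) * max 0 r ^ (l + 1)) (at (r::real))"
proof -
  consider "r > 0" | "r < 0" | "r = 0" by linarith
  then show ?thesis
  proof cases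
    case 1
    have "((\<lambda>r. r ^ (l + 2)) has_real_derivative real (l + 2) * r ^ (l + 1)) (at r)"
      using DERIV_pow[of "l + 2" r UNIV] by simp
    moreover have "\<forall>\<^sub>F x in nhds r. x ^ (l + 2) = max 0 x ^ (l + 2)"
      using eventually_nhds_in_open[of "{0<..}" r] 1 by (auto elim!: eventually_mono)
    ultimately show ?thesis using 1 DERIV_cong_ev[OF refl _ refl] by fastforce
  next
    case 2
    have "((\<lambda>r. 0) has_real_derivative 0) (at r)" by simp
    moreover have "\<forall>\<^sub>F x in nhds r. 0 = max 0 x ^ (l + 2)"
      using eventually_nhds_in_open[of "{..<0}" r] 2 by (auto elim!: eventually_mono)
    ultimately have "((\<lambda>x. max 0 x ^ (l + 2)) has_real_derivative 0) (at r)"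
      using DERIV_cong_ev[OF refl _ refl] by fastforce
    then show ?thesis using 2 by simp
  next
    case 3
    have "((\<lambda>h. max 0 h ^ (l + 1)) \<longlongrightarrow> max 0 0 ^ (l + 1)) (at (0::real))"
      by (intro tendsto_intros)
    moreover have "\<forall>\<^sub>F h in at (0::real). max 0 h ^ (l + 1) = (max 0 (0 + h) ^ (l + 2) - max 0 0 ^ (l + 2)) / h"
      by (auto simp: eventually_at_filter max_def)
    ultimately have "((\<lambda>h. (max 0 (0 + h) ^ (l + 2) - max 0 0 ^ (l + 2)) / h) \<longlongrightarrow> max 0 0 ^ (l + 1)) (at (0::real))"
      by (rule Lim_transform_eventually)
    then show ?thesis unfolding DERIV_def 3 by simp
  qed
qed

definition bump_base :: "'a::euclidean_space \<Rightarrow> real" where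
  "bump_base x = max 0 (1 - x \<bullet> x)"

text \<open>
  The powers \<open>(1 - |x|\<^sup>2)\<^sub>+\<^sup>k\<close>: twice continuously differentiable for \<open>k \<ge> 3\<close>, and with
  Laplacian at most a multiple of the power \<open>1 - 2/k\<close> of the function. So a large \<open>k\<close> reaches every power below \<open>1\<close>.
\<close>

definition cutoff :: "nat \<Rightarrow> 'a::euclidean_space \<Rightarrow> real" where
  "cutoff l x = bump_base x ^ (l + 3)"

definition cutoff_d :: "nat \<Rightarrow> 'a::euclidean_space \<Rightarrow> 'a \<Rightarrow> real" where
  "cutoff_d l e x = - 2 * real (l + 3) * (x \<bullet> e) * bump_base x ^ (l + 2)"

definition cutoff_dd :: "nat \<Rightarrow> 'a::euclidean_space \<Rightarrow> 'a \<Rightarrow> real" where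
  "cutoff_dd l e x = - 2 * real (l + 3) * bump_base x ^ (l + 2) +
     4 * real (l + 3) * real (l + 2) * (x \<bullet> e)\<^sup>2 * bump_base x ^ (l + 1)"

lemma bump_base_derivative:
  assumes "e \<in> Basis"
  shows "((\<lambda>s. bump_base (x + s *\<^sub>R e) ^ (l + 2)) has_real_derivative
           - 2 * real (l + 2) * (x \<bullet> e) * bump_base x ^ (l + 1)) (at 0)"
proof -
  have 1: "((\<lambda>s. 1 - (x + s *\<^sub>R e) \<bullet> (x + s *\<^sub>R e)) has_real_derivative - 2 * (x \<bullet> e)) (at 0)"
    by (simp add: inner_add_left inner_add_right) (auto intro!: derivative_eq_intros simp: inner_commute)
  have "((\<lambda>r. max 0 r ^ (l + 2)) has_real_derivative real (l + 2) * bump_base x ^ (l + 1))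
      (at (1 - (x + 0 *\<^sub>R e) \<bullet> (x + 0 *\<^sub>R e)))"
    using has_real_derivative_positive_part_power[of l "1 - x \<bullet> x"] by (simp add: bump_base_def)
  from DERIV_chain2[OF this 1] show ?thesis by (simp add: bump_base_def algebra_simps)
qed

lemma cutoff_derivatives:
  assumes e: "e \<in> Basis"
  shows "((\<lambda>s. cutoff l (x + s *\<^sub>R e)) has_real_derivative cutoff_d l e x) (at 0)"
    and "((\<lambda>s. cutoff_d l e (x + s *\<^sub>R e)) has_real_derivative cutoff_dd l e x) (at 0)"
proof -
  show "((\<lambda>s. cutoff l (x + s *\<^sub>R e)) has_real_derivative cutoff_d l e x) (at 0)"
    using bump_base_derivative[OF e, of x "l + 1"] by (simp add: cutoff_def cutoff_d_def numeral_3_eq_3)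
  have "((\<lambda>s. (x + s *\<^sub>R e) \<bullet> e) has_real_derivative 1) (at 0)"
    using e by (simp add: inner_add_left) (auto intro!: derivative_eq_intros)
  from DERIV_mult[OF DERIV_cmult[OF this, of "- 2 * real (l + 3)"] bump_base_derivative[OF e, of x l]]
  show "((\<lambda>s. cutoff_d l e (x + s *\<^sub>R e)) has_real_derivative cutoff_dd l e x) (at 0)"
    by (simp add: cutoff_d_def cutoff_dd_def power2_eq_square algebra_simps)
qed

lemma bump_base_bounds: "0 \<le> bump_base x" "bump_base x \<le> 1"
  by (auto simp: bump_base_def)

lemma bump_base_outside: "x \<notin> ball 0 1 \<Longrightarrow> bump_base x = 0"
  by (auto simp: bump_base_def max_def power2_norm_eq_inner[symmetric] abs_square_less_1)
     (smt (verit) one_le_power)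

lemma cutoff_simps:
  "0 \<le> cutoff l x" "cutoff l x \<le> 1"
  "x \<notin> ball 0 1 \<Longrightarrow> cutoff l x = 0" "x \<notin> ball 0 1 \<Longrightarrow> cutoff_d l e x = 0" "x \<notin> ball 0 1 \<Longrightarrow> cutoff_dd l e x = 0"
  by (auto simp: cutoff_def cutoff_d_def cutoff_dd_def bump_base_bounds bump_base_outside power_le_one)

lemma continuous_on_cutoff [continuous_intros]:
  "continuous_on A (cutoff l)" "continuous_on A (cutoff_d l e)" "continuous_on A (cutoff_dd l e)"
  unfolding cutoff_def[abs_def] cutoff_d_def[abs_def] cutoff_dd_def[abs_def] bump_base_def
  by (intro continuous_intros)+

text \<open>
  The Laplacian is of the order of the cutoff base to the power \<open>k - 2\<close>, where \<open>k = l + 3\<close>; this is at most the power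
  \<open>k \<sigma>\<close> once \<open>k \<ge> 2/(1 - \<sigma>)\<close>.
\<close>

lemma cutoff_laplacian_bound:
  fixes x :: "'a::euclidean_space"
  assumes "real (l + 3) * \<sigma> \<le> real (l + 1)"
  shows "\<bar>\<Sum>e\<in>Basis. cutoff_dd l e x\<bar> \<le>
     (2 * real (l + 3) * real DIM('a) + 4 * real (l + 3) * real (l + 2)) * cutoff l x powr \<sigma>"
proof (cases "x \<in> ball 0 1")
  case False
  then show ?thesis by (simp add: cutoff_simps)
next
  case True
  define q where "q = bump_base x"
  define k where "k = real (l + 3)"
  have "(norm x)\<^sup>2 < 1" using True by (simp add: abs_square_less_1)
  then have x1: "x \<bullet> x < 1" by (simp add: power2_norm_eq_inner)
  then have q: "0 < q" "q \<le> 1" by (auto simp: q_def bump_base_def)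
  have "(\<Sum>e\<in>Basis. (x \<bullet> e)\<^sup>2) = x \<bullet> x"
    by (simp add: euclidean_inner[of x x] power2_eq_square)
  then have S: "(\<Sum>e\<in>Basis. cutoff_dd l e x) =
     - (2 * k * real DIM('a)) * q ^ (l + 2) + 4 * k * real (l + 2) * (x \<bullet> x) * q ^ (l + 1)"
    by (simp add: cutoff_dd_def sum.distrib sum_subtractf sum_negf q_def k_def sum_distrib_left[symmetric] sum_distrib_right[symmetric])
      (simp add: algebra_simps)
  have "q ^ (l + 2) \<le> q ^ (l + 1)" using q by (intro power_decreasing) auto
  then have 1: "(2 * k * real DIM('a)) * q ^ (l + 2) \<le> (2 * k * real DIM('a)) * q ^ (l + 1)"
    by (intro mult_left_mono) (auto simp: k_def)
  have "(x \<bullet> x) * q ^ (l + 1) \<le> 1 * q ^ (l + 1)" using x1 q by (intro mult_right_mono) auto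
  then have 2: "4 * k * real (l + 2) * ((x \<bullet> x) * q ^ (l + 1)) \<le> 4 * k * real (l + 2) * (1 * q ^ (l + 1))"
    by (intro mult_left_mono) (auto simp: k_def)
  have 3: "(2 * k * real DIM('a)) * q ^ (l + 2) \<ge> 0" "4 * k * real (l + 2) * ((x \<bullet> x) * q ^ (l + 1)) \<ge> 0"
    using q by (auto simp: k_def)
  have "\<bar>\<Sum>e\<in>Basis. cutoff_dd l e x\<bar> \<le> (2 * k * real DIM('a)) * q ^ (l + 1) + 4 * k * real (l + 2) * (1 * q ^ (l + 1))"
  proof -
    have abs: "\<bar>- A + B\<bar> \<le> A' + B'" if "0 \<le> A" "A \<le> A'" "0 \<le> B" "B \<le> B'" for A B A' B' :: real
      using that by linarith
    have "(\<Sum>e\<in>Basis. cutoff_dd l e x) =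
      - ((2 * k * real DIM('a)) * q ^ (l + 2)) + 4 * k * real (l + 2) * ((x \<bullet> x) * q ^ (l + 1))"
      unfolding S by simp
    then show ?thesis using abs[OF 3(1) 1 3(2) 2] by (simp only:)
  qed
  also have "\<dots> = (2 * k * real DIM('a) + 4 * k * real (l + 2)) * q ^ (l + 1)" by (simp add: algebra_simps)
  also have "\<dots> \<le> (2 * k * real DIM('a) + 4 * k * real (l + 2)) * cutoff l x powr \<sigma>"
  proof (rule mult_left_mono)
    have "q ^ (l + 1) = q powr (real (l + 1))" using q by (simp only: powr_realpow)
    also have "\<dots> \<le> q powr (real (l + 3) * \<sigma>)" using assms q by (intro powr_mono') auto
    also have "\<dots> = cutoff l x powr \<sigma>" unfolding cutoff_def q_def[symmetric]
      using q by (simp only: powr_powr[symmetric] powr_realpow)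
    finally show "q ^ (l + 1) \<le> cutoff l x powr \<sigma>" .
  qed (auto simp: k_def)
  finally show ?thesis by (simp add: k_def)
qed

text \<open>
  The integrand may fail to be integrable at \<open>0\<close>, so the antiderivative is based at \<open>1\<close>; one of the two integrals
  in \<open>F\<close> is over an empty or one-point interval.
\<close>

lemma antiderivative_on_positive_reals:
  fixes f :: "real \<Rightarrow> real"
  assumes f: "continuous_on {0<..} f"
  shows "\<exists>F. F 1 = 0 \<and> (\<forall>r>0. (F has_real_derivative f r) (at r))"
proof -
  define F where "F r = integral {1..r} f - integral {r..1} f" for r
  have "(F has_real_derivative f r) (at r)" if r: "r > 0" for r
  proof -
    define a where "a = min r 1 / 2"
    define b where "b = max r 1 + 1"
    have ab: "0 < a" "a < r" "r < b" "a < 1" "1 < b" using r by (auto simp: a_def b_def min_def max_def)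
    have cont: "continuous_on {a..b} f" using f ab by (auto elim: continuous_on_subset)
    have int: "f integrable_on {c..d}" if "a \<le> c" "d \<le> b" for c d
      by (rule integrable_continuous_real) (use cont that in \<open>auto elim: continuous_on_subset\<close>)
    have eq: "F x = integral {a..x} f - integral {a..1} f" if x: "x \<in> {a..b}" for x
    proof (cases "x \<le> 1")
      case True
      have "integral {a..x} f + integral {x..1} f = integral {a..1} f"
        using True x ab by (intro Henstock_Kurzweil_Integration.integral_combine int) auto
      moreover have "integral {1..x} f = 0" using True by (cases "x = 1") auto
      ultimately show ?thesis by (simp add: F_def)
    next
      case False
      have "integral {a..1} f + integral {1..x} f = integral {a..x} f"
        using False x ab by (intro Henstock_Kurzweil_Integration.integral_combine int) auto
      then show ?thesis using False by (simp add: F_def)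
    qed
    have "((\<lambda>x. integral {a..x} f) has_real_derivative f r) (at r within {a..b})"
      by (rule integral_has_real_derivative[OF cont]) (use ab in auto)
    then have "((\<lambda>x. integral {a..x} f) has_real_derivative f r) (at r)"
      using ab by (simp add: at_within_Icc_at)
    then have "((\<lambda>x. integral {a..x} f - integral {a..1} f) has_real_derivative f r) (at r)"
      by (auto intro!: derivative_eq_intros)
    moreover have "\<forall>\<^sub>F x in nhds r. integral {a..x} f - integral {a..1} f = F x"
      using eventually_nhds_in_open[of "{a<..<b}" r] ab eq by (auto elim!: eventually_mono)
    ultimately show ?thesis using DERIV_cong_ev[OF refl _ refl] by fastforce
  qed
  moreover have "F 1 = 0" by (simp add: F_def)
  ultimately show ?thesis by blast
qed

section \<open>Powers with linear growth\<close>

text \<open>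
  The perspective of \<open>r\<^sup>p\<close>: convex and increasing, at most \<open>r\<^sup>p\<close>, Lipschitz because \<open>\<epsilon> > 0\<close>, and convergent
  to \<open>r\<^sup>p\<close> as \<open>\<epsilon>\<close> tends to \<open>0\<close>. The Lipschitz bound allows the passage to an initial datum
  that is attained in \<open>L\<^sup>1\<close>.
\<close>

definition tpow :: "real \<Rightarrow> real \<Rightarrow> real \<Rightarrow> real" where
  "tpow p \<epsilon> r = r powr p * (1 + \<epsilon> * r) powr (1 - p)"

definition tpow_d :: "real \<Rightarrow> real \<Rightarrow> real \<Rightarrow> real" where
  "tpow_d p \<epsilon> r = r powr (p - 1) * (p + \<epsilon> * r) * (1 + \<epsilon> * r) powr (- p)"

definition tpow_dd :: "real \<Rightarrow> real \<Rightarrow> real \<Rightarrow> real" where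
  "tpow_dd p \<epsilon> r = p * (p - 1) * r powr (p - 2) * (1 + \<epsilon> * r) powr (- p - 1)"

lemma tpow_derivative:
  assumes r: "r > 0" and \<epsilon>: "\<epsilon> > 0"
  shows "(tpow p \<epsilon> has_real_derivative tpow_d p \<epsilon> r) (at r)"
proof -
  define w where "w = 1 + \<epsilon> * r"
  have w: "w > 0" using r \<epsilon> by (simp add: w_def add_pos_pos)
  have "(tpow p \<epsilon> has_real_derivative
      p * r powr (p - 1) * w powr (1 - p) + r powr p * ((1 - p) * w powr (- p) * \<epsilon>)) (at r)"
    unfolding tpow_def[abs_def] w_def using r \<epsilon> w
    by (auto intro!: derivative_eq_intros simp: w_def)
  moreover have "w powr (1 - p) = w * w powr (- p)" using w by (simp add: powr_diff powr_minus field_simps)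
  moreover have "r powr p = r * r powr (p - 1)" using r by (simp add: powr_diff)
  ultimately show ?thesis by (simp add: tpow_d_def w_def algebra_simps)
qed

lemma tpow_d_derivative:
  assumes r: "r > 0" and \<epsilon>: "\<epsilon> > 0"
  shows "(tpow_d p \<epsilon> has_real_derivative tpow_dd p \<epsilon> r) (at r)"
proof -
  define w where "w = 1 + \<epsilon> * r"
  have w: "w > 0" using r \<epsilon> by (simp add: w_def add_pos_pos)
  define A where "A = r powr (p - 2)"
  define B where "B = w powr (- p - 1)"
  have "(tpow_d p \<epsilon> has_real_derivative
      ((p - 1) * r powr (p - 2) * (p + \<epsilon> * r) + r powr (p - 1) * \<epsilon>) * w powr (- p)
       + r powr (p - 1) * (p + \<epsilon> * r) * (- p * w powr (- p - 1) * \<epsilon>)) (at r)"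
    unfolding tpow_d_def[abs_def] w_def using r \<epsilon> w
    by (auto intro!: derivative_eq_intros simp: w_def algebra_simps)
  moreover have "r powr (p - 1) = r * A" unfolding A_def using r powr_add[of r 1 "p - 2"] by simp
  moreover have "w powr (- p) = w * B" unfolding B_def using w powr_add[of w 1 "- p - 1"] by simp
  ultimately have "(tpow_d p \<epsilon> has_real_derivative
      ((p - 1) * A * (p + \<epsilon> * r) + r * A * \<epsilon>) * (w * B) + r * A * (p + \<epsilon> * r) * (- p * B * \<epsilon>)) (at r)"
    by (simp only: A_def[symmetric] B_def[symmetric])
  also have "((p - 1) * A * (p + \<epsilon> * r) + r * A * \<epsilon>) * (w * B) + r * A * (p + \<epsilon> * r) * (- p * B * \<epsilon>)
      = p * (p - 1) * A * B"
    unfolding w_def by algebra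
  finally show ?thesis by (simp add: tpow_dd_def A_def B_def w_def)
qed

lemma tpow_bounds:
  assumes r: "r > 0" and \<epsilon>: "\<epsilon> > 0" and p: "p \<ge> 1"
  shows "0 < tpow p \<epsilon> r" "tpow p \<epsilon> r \<le> r powr p" "0 \<le> tpow_d p \<epsilon> r"
    "tpow_d p \<epsilon> r \<le> p * \<epsilon> powr (1 - p)" "0 \<le> tpow_dd p \<epsilon> r"
proof -
  have w: "1 + \<epsilon> * r > 1" using r \<epsilon> by simp
  then have w0: "1 + \<epsilon> * r > 0" by linarith
  show "0 < tpow p \<epsilon> r" using r w0 by (simp add: tpow_def)
  have "(1 + \<epsilon> * r) powr (1 - p) \<le> (1 + \<epsilon> * r) powr 0" using w p by (intro powr_mono) auto
  then have "(1 + \<epsilon> * r) powr (1 - p) \<le> 1" using w0 by simp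
  then have "r powr p * (1 + \<epsilon> * r) powr (1 - p) \<le> r powr p * 1" by (intro mult_left_mono) auto
  then show "tpow p \<epsilon> r \<le> r powr p" by (simp add: tpow_def)
  show "0 \<le> tpow_d p \<epsilon> r" using r \<epsilon> p by (simp add: tpow_d_def)
  show "0 \<le> tpow_dd p \<epsilon> r" using r \<epsilon> p by (simp add: tpow_dd_def)
  have "p + \<epsilon> * r \<le> p * (1 + \<epsilon> * r)"
  proof -
    have "1 * (\<epsilon> * r) \<le> p * (\<epsilon> * r)" using p r \<epsilon> by (intro mult_right_mono) auto
    then show ?thesis by (simp add: distrib_left)
  qed
  then have "tpow_d p \<epsilon> r \<le> r powr (p - 1) * (p * (1 + \<epsilon> * r)) * (1 + \<epsilon> * r) powr (- p)"
    unfolding tpow_d_def by (intro mult_right_mono mult_left_mono) auto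
  also have "\<dots> = p * (r powr (p - 1) * ((1 + \<epsilon> * r) * (1 + \<epsilon> * r) powr (- p)))" by simp
  also have "(1 + \<epsilon> * r) * (1 + \<epsilon> * r) powr (- p) = (1 + \<epsilon> * r) powr (1 - p)"
    using w0 powr_add[of "1 + \<epsilon> * r" 1 "- p"] by simp
  also have "r powr (p - 1) * (1 + \<epsilon> * r) powr (1 - p) \<le> \<epsilon> powr (1 - p)"
  proof -
    have "(\<epsilon> * r) powr (p - 1) \<le> (1 + \<epsilon> * r) powr (p - 1)" using r \<epsilon> p by (intro powr_mono2) auto
    then have "\<epsilon> powr (p - 1) * r powr (p - 1) \<le> (1 + \<epsilon> * r) powr (p - 1)" using r \<epsilon> by (simp add: powr_mult)
    moreover have eq: "\<epsilon> powr (1 - p) = 1 / \<epsilon> powr (p - 1)" "(1 + \<epsilon> * r) powr (1 - p) = 1 / (1 + \<epsilon> * r) powr (p - 1)"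
      using powr_minus_divide[of \<epsilon> "p - 1"] powr_minus_divide[of "1 + \<epsilon> * r" "p - 1"] by simp_all
    moreover have "R * (1 / W) \<le> 1 / E" if "E * R \<le> W" "E > 0" "W > 0" for E R W :: real
      using that by (simp add: field_simps)
    ultimately show ?thesis unfolding eq using \<epsilon> w0 by simp
  qed
  finally show "tpow_d p \<epsilon> r \<le> p * \<epsilon> powr (1 - p)" using p by simp
qed

lemma tpow_mono:
  assumes "0 < r" "r \<le> s" "\<epsilon> > 0" "p \<ge> 1"
  shows "tpow p \<epsilon> r \<le> tpow p \<epsilon> s"
  by (rule DERIV_nonneg_imp_nondecreasing[OF assms(2)])
    (use assms tpow_derivative tpow_bounds(3) in \<open>meson less_le_trans\<close>)

lemma tpow_0: "tpow p \<epsilon> 0 = 0" by (simp add: tpow_def)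

lemma continuous_on_tpow:
  assumes "\<epsilon> > 0" "p \<ge> 1"
  shows "continuous_on {0..} (tpow p \<epsilon>)"
  unfolding tpow_def[abs_def]
  using assms by (intro continuous_on_mult continuous_on_powr' continuous_intros) (auto simp: add_nonneg_eq_0_iff)

lemma tpow_lipschitz:
  assumes "0 \<le> r" "0 \<le> s" and \<epsilon>: "\<epsilon> > 0" and p: "p \<ge> 1"
  shows "tpow p \<epsilon> r \<le> tpow p \<epsilon> s + p * \<epsilon> powr (1 - p) * \<bar>r - s\<bar>"
proof -
  define L where "L = p * \<epsilon> powr (1 - p)"
  have L: "L \<ge> 0" using p by (simp add: L_def)
  have *: "\<bar>tpow p \<epsilon> b - tpow p \<epsilon> a\<bar> \<le> L * (b - a)" if ab: "0 \<le> a" "a < b" for a b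
  proof -
    have "continuous_on {a..b} (tpow p \<epsilon>)" using continuous_on_tpow[OF \<epsilon> p] ab by (auto elim: continuous_on_subset)
    moreover have "\<And>x. a < x \<Longrightarrow> x < b \<Longrightarrow> tpow p \<epsilon> differentiable (at x)"
      using tpow_derivative[OF _ \<epsilon>] ab real_differentiable_def by (meson le_less_trans)
    ultimately obtain d z where z: "a < z" "z < b" "(tpow p \<epsilon> has_real_derivative d) (at z)"
      "tpow p \<epsilon> b - tpow p \<epsilon> a = (b - a) * d"
      using MVT[OF ab(2)] by blast
    have "d = tpow_d p \<epsilon> z" using z ab tpow_derivative[OF _ \<epsilon>] DERIV_unique by (meson le_less_trans)
    then have "0 \<le> d" "d \<le> L" using tpow_bounds(3,4)[of z, OF _ \<epsilon> p] z ab by (auto simp: L_def)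
    then have "(b - a) * d \<le> (b - a) * L" "0 \<le> (b - a) * d" using ab by (auto intro: mult_left_mono)
    then show ?thesis unfolding z(4) by (simp add: mult.commute)
  qed
  consider "r < s" | "s < r" | "r = s" by linarith
  then have "\<bar>tpow p \<epsilon> r - tpow p \<epsilon> s\<bar> \<le> L * \<bar>r - s\<bar>"
    using *[of r s] *[of s r] assms by cases (auto simp: abs_minus_commute)
  then show ?thesis unfolding L_def by linarith
qed

text \<open>
  Since \<open>j r \<le> r\<^sup>p\<close> and \<open>m < 1\<close>, the derivative \<open>j' r\<^bsup>m-1\<^esup>\<close> is at most \<open>j' j\<^bsup>(m-1)/p\<^esup>\<close>, the derivative of \<open>j\<^sup>\<sigma>/\<sigma>\<close>. The
  bound does not depend on \<open>j\<close> otherwise, in particular not on \<open>\<epsilon>\<close> for \<open>j = tpow p \<epsilon>\<close>. The additive constant comes from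
  the normalisation \<open>\<Psi>(1) = 0\<close>.
\<close>

lemma flux_potential:
  fixes j j1 :: "real \<Rightarrow> real"
  assumes m: "m < 1" and p: "p > 0" "p + m - 1 > 0"
    and j: "\<And>r. r > 0 \<Longrightarrow> (j has_real_derivative j1 r) (at r)"
    and j1: "\<And>r. r > 0 \<Longrightarrow> 0 \<le> j1 r" "continuous_on {0<..} j1"
    and bounds: "\<And>r. r > 0 \<Longrightarrow> 0 < j r" "\<And>r. r > 0 \<Longrightarrow> j r \<le> r powr p"
  defines "\<sigma> \<equiv> (p + m - 1) / p"
  shows "\<exists>\<Psi>. \<forall>r>0. (\<Psi> has_real_derivative j1 r * r powr (m - 1)) (at r) \<and> \<bar>\<Psi> r\<bar> \<le> (j r powr \<sigma> + 1) / \<sigma>"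
proof -
  have \<sigma>: "0 < \<sigma>" using p by (simp add: \<sigma>_def)
  have \<sigma>1: "\<sigma> - 1 = (m - 1) / p" using p by (simp add: \<sigma>_def field_simps)
  have "continuous_on {0<..} (\<lambda>r. j1 r * r powr (m - 1))"
    by (intro continuous_intros j1(2)) auto
  then obtain \<Psi> where \<Psi>: "\<Psi> 1 = 0" "\<And>r. r > 0 \<Longrightarrow> (\<Psi> has_real_derivative j1 r * r powr (m - 1)) (at r)"
    using antiderivative_on_positive_reals by blast
  define G where "G r = j r powr \<sigma> / \<sigma>" for r
  have G: "(G has_real_derivative j1 r * j r powr (\<sigma> - 1)) (at r)" if "r > 0" for r
  proof -
    have "((\<lambda>r. j r powr \<sigma>) has_real_derivative \<sigma> * j r powr (\<sigma> - 1) * j1 r) (at r)"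
      using DERIV_chain2[OF has_real_derivative_powr[OF bounds(1)[OF that], of \<sigma>] j[OF that]] by simp
    from DERIV_cdivide[OF this, of \<sigma>] show ?thesis using \<sigma> by (simp add: G_def[abs_def] mult.commute)
  qed
  have slope: "j1 r * r powr (m - 1) \<le> j1 r * j r powr (\<sigma> - 1)" if r: "r > 0" for r
  proof (rule mult_left_mono[OF _ j1(1)[OF r]])
    have "(r powr p) powr (\<sigma> - 1) \<le> j r powr (\<sigma> - 1)"
      using bounds[OF r] m p by (intro powr_mono2') (auto simp: \<sigma>1 divide_nonpos_pos)
    then show "r powr (m - 1) \<le> j r powr (\<sigma> - 1)" using p by (simp add: powr_powr \<sigma>1)
  qed
  have mono: "\<Psi> a \<le> \<Psi> b" if "0 < a" "a \<le> b" for a b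
  proof (rule DERIV_nonneg_imp_nondecreasing[OF that(2)])
    fix x assume "a \<le> x"
    then have "x > 0" using that by simp
    then show "\<exists>y. (\<Psi> has_real_derivative y) (at x) \<and> 0 \<le> y" using \<Psi>(2) j1(1) by (metis mult_nonneg_nonneg powr_ge_zero)
  qed
  have monoG: "G a - \<Psi> a \<le> G b - \<Psi> b" if "0 < a" "a \<le> b" for a b
  proof (rule DERIV_nonneg_imp_nondecreasing[OF that(2), of "\<lambda>x. G x - \<Psi> x"])
    fix x assume "a \<le> x"
    then have x: "x > 0" using that by simp
    have "((\<lambda>x. G x - \<Psi> x) has_real_derivative (j1 x * j x powr (\<sigma> - 1) - j1 x * x powr (m - 1))) (at x)"
      by (intro DERIV_diff G[OF x] \<Psi>(2)[OF x])
    then show "\<exists>y. ((\<lambda>x. G x - \<Psi> x) has_real_derivative y) (at x) \<and> 0 \<le> y" using slope[OF x] by (intro exI conjI) auto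
  qed
  have G1: "G r \<ge> 0" for r using \<sigma> by (simp add: G_def)
  have "G 1 \<le> 1 / \<sigma>"
  proof -
    have "j 1 \<le> 1" using bounds(2)[of 1] by simp
    then have "j 1 powr \<sigma> \<le> 1 powr \<sigma>" using bounds(1)[of 1] \<sigma> by (intro powr_mono2) auto
    then show ?thesis using \<sigma> by (simp add: G_def divide_right_mono)
  qed
  have "\<bar>\<Psi> r\<bar> \<le> (j r powr \<sigma> + 1) / \<sigma>" if r: "r > 0" for r
  proof -
    have "\<bar>\<Psi> r\<bar> \<le> G r + G 1"
    proof (cases "r \<le> 1")
      case True
      then show ?thesis using mono[OF r True] monoG[OF r True] \<Psi>(1) G1[of r] G1[of 1] by linarith
    next
      case False
      then have "1 \<le> r" by simp
      then show ?thesis using mono[of 1 r] monoG[of 1 r] \<Psi>(1) G1[of r] G1[of 1] by linarith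
    qed
    also have "\<dots> \<le> (j r powr \<sigma> + 1) / \<sigma>" using \<open>G 1 \<le> 1 / \<sigma>\<close> by (simp add: G_def add_divide_distrib)
    finally show ?thesis .
  qed
  then show ?thesis using \<Psi>(2) by blast
qed

section \<open>Integration by parts for the flux\<close>

lemma integral_lborel_eq_integral_cbox:
  fixes f :: "'a::euclidean_space \<Rightarrow> real"
  assumes "continuous_on UNIV f" "\<And>x. x \<notin> cball 0 1 \<Longrightarrow> f x = 0"
  shows "integrable lborel f" "integral (cbox (- One) One) f = (\<integral>x. f x \<partial>lborel)"
proof -
  have sub: "cball 0 1 \<subseteq> cbox (- One) (One :: 'a)"
  proof
    fix x :: 'a assume "x \<in> cball 0 1"
    then have "\<bar>x \<bullet> i\<bar> \<le> 1" if "i \<in> Basis" for i using Basis_le_norm[OF that, of x] by simp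
    then show "x \<in> cbox (- One) One" by (auto simp: mem_box abs_le_iff)
  qed
  have "integrable lborel (\<lambda>x. indicator (cball 0 1) x *\<^sub>R f x)"
    by (rule borel_integrable_compact) (use assms(1) continuous_on_subset in \<open>auto\<close>)
  also have "(\<lambda>x. indicator (cball 0 1) x *\<^sub>R f x) = f" using assms(2) by (auto simp: fun_eq_iff indicator_def)
  finally show int: "integrable lborel f" .
  have "(f has_integral (\<integral>x. f x \<partial>lborel)) UNIV" by (rule has_integral_integral_lborel[OF int])
  then have "((\<lambda>x. if x \<in> cbox (- One) One then f x else 0) has_integral (\<integral>x. f x \<partial>lborel)) UNIV"
  proof (rule has_integral_eq[rotated])
    show "f x = (if x \<in> cbox (- One) One then f x else 0)" for x
      using assms(2)[of x] sub by (cases "x \<in> cbox (- One) (One :: 'a)") (simp, meson subsetD)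
  qed
  then have "(f has_integral (\<integral>x. f x \<partial>lborel)) (cbox (- One) One)"
    by (simp only: has_integral_restrict_UNIV)
  then show "integral (cbox (- One) One) f = (\<integral>x. f x \<partial>lborel)" by (rule integral_unique)
qed

lemma closed_norm_ge_1: "closed {x :: 'a::euclidean_space. norm x \<ge> 1}"
  by (intro closed_Collect_le continuous_intros)

lemma cball_Un_norm_ge_1: "cball 0 1 \<union> {x. norm x \<ge> 1} = (UNIV :: 'a::euclidean_space set)"
  by auto

lemma continuous_on_times_cutoff:
  fixes f c :: "'a::euclidean_space \<Rightarrow> real"
  assumes "cball 0 1 \<subseteq> S" "continuous_on S f" "continuous_on UNIV c" "\<And>x. x \<notin> ball 0 1 \<Longrightarrow> c x = 0"
  shows "continuous_on UNIV (\<lambda>x. c x * f x)"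
proof -
  have "continuous_on (cball 0 1 \<union> {x. norm x \<ge> 1}) (\<lambda>x. c x * f x)"
  proof (rule continuous_on_paste_zero)
    show "continuous_on (cball 0 1) (\<lambda>x. c x * f x)"
      by (intro continuous_on_mult continuous_on_subset[OF assms(2,1)] continuous_on_subset[OF assms(3) subset_UNIV])
    show "c x * f x = 0" if "x \<in> {x. norm x \<ge> 1}" for x
      using assms(4)[of x] that by simp
  qed (rule closed_cball closed_norm_ge_1)+
  then show ?thesis by (simp only: cball_Un_norm_ge_1)
qed

text \<open>
  The left integrand is the cutoff times \<open>\<Delta>(\<Psi>(u))\<close>. In each coordinate direction the difference of the two sides is the
  derivative of \<open>\<Psi>(u) \<partial>\<phi> - \<phi> \<partial>(\<Psi>(u))\<close>.
\<close>

lemma flux_integration_by_parts: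
  fixes u :: "'a::euclidean_space \<Rightarrow> real" and \<Psi> \<psi> \<psi>' :: "real \<Rightarrow> real"
  assumes S: "open S" "cball 0 1 \<subseteq> S"
    and u: "\<And>x. x \<in> S \<Longrightarrow> u x > 0" "\<And>x. x \<in> S \<Longrightarrow> (u has_derivative (\<lambda>h. g x \<bullet> h)) (at x)"
      "\<And>x. x \<in> S \<Longrightarrow> (g has_derivative H x) (at x)"
    and cont: "continuous_on S u" "continuous_on S g" "\<And>e. e \<in> Basis \<Longrightarrow> continuous_on S (\<lambda>x. H x e \<bullet> e)"
    and \<Psi>: "\<And>r. r > 0 \<Longrightarrow> (\<Psi> has_real_derivative \<psi> r) (at r)"
    and \<psi>: "\<And>r. r > 0 \<Longrightarrow> (\<psi> has_real_derivative \<psi>' r) (at r)" "continuous_on {0<..} \<psi>'"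
  shows "integrable lborel (\<lambda>x. cutoff l x * (\<psi> (u x) * (\<Sum>e\<in>Basis. H x e \<bullet> e) + \<psi>' (u x) * (norm (g x))\<^sup>2))"
    and "integrable lborel (\<lambda>x. (\<Sum>e\<in>Basis. cutoff_dd l e x) * \<Psi> (u x))"
    and "(\<integral>x. cutoff l x * (\<psi> (u x) * (\<Sum>e\<in>Basis. H x e \<bullet> e) + \<psi>' (u x) * (norm (g x))\<^sup>2) \<partial>lborel)
       = (\<integral>x. (\<Sum>e\<in>Basis. cutoff_dd l e x) * \<Psi> (u x) \<partial>lborel)"
proof -
  have cu: "continuous_on S (\<lambda>x. f (u x))" if "\<And>r. r > 0 \<Longrightarrow> (f has_real_derivative f' r) (at r)" for f f'
  proof (rule continuous_on_compose2[OF _ cont(1)])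
    show "continuous_on {0<..} f"
      by (rule DERIV_continuous_on[of _ _ f'], rule has_field_derivative_at_within, rule that) simp
  qed (use u(1) in auto)
  have c\<Psi>: "continuous_on S (\<lambda>x. \<Psi> (u x))" and c\<psi>: "continuous_on S (\<lambda>x. \<psi> (u x))"
    using cu[of \<Psi> \<psi>] \<Psi> cu[of \<psi> \<psi>'] \<psi>(1) by simp_all
  have c\<psi>': "continuous_on S (\<lambda>x. \<psi>' (u x))"
    by (rule continuous_on_compose2[OF \<psi>(2) cont(1)]) (use u(1) in auto)
  define A where "A e x = cutoff_dd l e x * \<Psi> (u x)" for e x
  define B where "B e x = cutoff l x * (\<psi> (u x) * (H x e \<bullet> e) + \<psi>' (u x) * (g x \<bullet> e)\<^sup>2)" for e x
  have cA: "continuous_on UNIV (A e)" for e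
    unfolding A_def[abs_def]
    by (rule continuous_on_times_cutoff[OF S(2) c\<Psi> continuous_on_cutoff(3)]) (simp add: cutoff_simps)
  have cg: "continuous_on S (\<lambda>x. g x \<bullet> e)" for e
    by (intro continuous_intros cont(2))
  have cB: "continuous_on UNIV (B e)" if e: "e \<in> Basis" for e
    unfolding B_def[abs_def]
  proof (rule continuous_on_times_cutoff[OF S(2) _ continuous_on_cutoff(1)])
    show "continuous_on S (\<lambda>x. \<psi> (u x) * (H x e \<bullet> e) + \<psi>' (u x) * (g x \<bullet> e)\<^sup>2)"
      by (intro continuous_on_add continuous_on_mult continuous_on_power c\<psi> c\<psi>' cg cont(3)[OF e])
  qed (simp add: cutoff_simps)
  have out: "A e x = 0" "B e x = 0" if "x \<notin> ball 0 1" for e x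
    using that by (simp_all add: A_def B_def cutoff_simps)
  have intA: "integrable lborel (A e)" and intB: "integrable lborel (B e)" if e: "e \<in> Basis" for e
    using integral_lborel_eq_integral_cbox(1)[OF cA[of e]] integral_lborel_eq_integral_cbox(1)[OF cB[OF e]] out by auto
  have eq: "(\<integral>x. A e x \<partial>lborel) = (\<integral>x. B e x \<partial>lborel)" if e: "e \<in> Basis" for e
  proof -
    define G where "G x = cutoff_d l e x * \<Psi> (u x) - cutoff l x * (\<psi> (u x) * (g x \<bullet> e))" for x
    have "(\<integral>x. A e x - B e x \<partial>lborel) = 0"
    proof (rule integral_directional_derivative_zero(2))
      show "continuous_on UNIV (\<lambda>x. A e x - B e x)" by (intro continuous_on_diff cA cB e)
      show "continuous_on UNIV G"
        unfolding G_def
        by (intro continuous_on_diff continuous_on_times_cutoff[OF S(2)] continuous_on_mult c\<Psi> c\<psi> cg continuous_on_cutoff)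
          (simp_all add: cutoff_simps)
      show "compact (cball (0::'a) 1)" by simp
      show "G x = 0" "A e x - B e x = 0" if "x \<notin> cball 0 1" for x
        using that out[of x] by (auto simp: G_def cutoff_simps)
      show "((\<lambda>s. G (x + s *\<^sub>R e)) has_real_derivative A e x - B e x) (at 0)" for x
      proof (cases "x \<in> S")
        case True
        have L: "((\<lambda>s. x + s *\<^sub>R e) has_derivative (\<lambda>s. s *\<^sub>R e)) (at 0)"
          by (auto intro!: derivative_eq_intros)
        have "((\<lambda>s. u (x + s *\<^sub>R e)) has_derivative (\<lambda>s. g x \<bullet> (s *\<^sub>R e))) (at 0)"
          using has_derivative_compose[OF L, of u "\<lambda>h. g x \<bullet> h"] u(2)[OF True] by simp
        then have du: "((\<lambda>s. u (x + s *\<^sub>R e)) has_real_derivative g x \<bullet> e) (at 0)"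
          unfolding has_field_derivative_def by (rule has_derivative_eq_rhs) (simp add: fun_eq_iff)
        interpret H: bounded_linear "H x" using u(3)[OF True] by (rule has_derivative_bounded_linear)
        have "((\<lambda>s. g (x + s *\<^sub>R e)) has_derivative (\<lambda>s. H x (s *\<^sub>R e))) (at 0)"
          using has_derivative_compose[OF L, of g "H x"] u(3)[OF True] by simp
        then have "((\<lambda>s. g (x + s *\<^sub>R e) \<bullet> e) has_derivative (\<lambda>s. H x (s *\<^sub>R e) \<bullet> e)) (at 0)"
          by (rule has_derivative_inner_left)
        then have dg: "((\<lambda>s. g (x + s *\<^sub>R e) \<bullet> e) has_real_derivative H x e \<bullet> e) (at 0)"
          unfolding has_field_derivative_def by (rule has_derivative_eq_rhs) (simp add: fun_eq_iff H.scaleR)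
        have d\<Psi>: "((\<lambda>s. \<Psi> (u (x + s *\<^sub>R e))) has_real_derivative \<psi> (u x) * (g x \<bullet> e)) (at 0)"
          using DERIV_chain2[OF _ du, of \<Psi> "\<psi> (u x)"] \<Psi>[OF u(1)[OF True]] by simp
        have d\<psi>: "((\<lambda>s. \<psi> (u (x + s *\<^sub>R e))) has_real_derivative \<psi>' (u x) * (g x \<bullet> e)) (at 0)"
          using DERIV_chain2[OF _ du, of \<psi> "\<psi>' (u x)"] \<psi>(1)[OF u(1)[OF True]] by simp
        note 1 = DERIV_mult[OF cutoff_derivatives(2)[OF e, of l x] d\<Psi>]
        note 2 = DERIV_mult[OF cutoff_derivatives(1)[OF e, of l x] DERIV_mult[OF d\<psi> dg]]
        show ?thesis unfolding G_def
          by (rule DERIV_cong[OF DERIV_diff[OF 1 2]])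
            (simp add: A_def B_def algebra_simps power2_eq_square)
      next
        case False
        then have x: "x \<notin> cball 0 1" using S(2) by blast
        define r where "r = norm x - 1"
        have r: "r > 0" using x by (simp add: r_def)
        have "\<forall>\<^sub>F s in nhds 0. s \<in> {-r<..<r}" by (rule eventually_nhds_in_open) (use r in auto)
        then have "\<forall>\<^sub>F s in nhds 0. 0 = G (x + s *\<^sub>R e)"
        proof (rule eventually_mono)
          fix s assume s: "s \<in> {-r<..<r}"
          have "norm (x + s *\<^sub>R e) \<ge> norm x - \<bar>s\<bar>"
            using norm_triangle_ineq4[of "x + s *\<^sub>R e" "s *\<^sub>R e"] e by simp
          then have "x + s *\<^sub>R e \<notin> ball 0 1" using s by (auto simp: r_def)
          then show "0 = G (x + s *\<^sub>R e)" by (simp add: G_def cutoff_simps)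
        qed
        then have "((\<lambda>s. G (x + s *\<^sub>R e)) has_real_derivative 0) (at 0)"
          using DERIV_cong_ev[OF refl, of "\<lambda>s. 0" "\<lambda>s. G (x + s *\<^sub>R e)" 0 0 0] by simp
        moreover have "x \<notin> ball 0 1" using x by simp
        ultimately show ?thesis using out[of x] by simp
      qed
    qed
    then show ?thesis using intA[OF e] intB[OF e] by simp
  qed
  have sB: "(\<lambda>x. cutoff l x * (\<psi> (u x) * (\<Sum>e\<in>Basis. H x e \<bullet> e) + \<psi>' (u x) * (norm (g x))\<^sup>2)) = (\<lambda>x. \<Sum>e\<in>Basis. B e x)"
  proof
    fix x
    have "(norm (g x))\<^sup>2 = (\<Sum>e\<in>Basis. (g x \<bullet> e)\<^sup>2)"
      unfolding power2_norm_eq_inner by (subst euclidean_inner) (simp add: power2_eq_square)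
    then show "cutoff l x * (\<psi> (u x) * (\<Sum>e\<in>Basis. H x e \<bullet> e) + \<psi>' (u x) * (norm (g x))\<^sup>2) = (\<Sum>e\<in>Basis. B e x)"
      by (simp add: B_def sum.distrib sum_distrib_left distrib_left)
  qed
  have sA: "(\<lambda>x. (\<Sum>e\<in>Basis. cutoff_dd l e x) * \<Psi> (u x)) = (\<lambda>x. \<Sum>e\<in>Basis. A e x)"
    by (simp add: A_def sum_distrib_right fun_eq_iff)
  show "integrable lborel (\<lambda>x. cutoff l x * (\<psi> (u x) * (\<Sum>e\<in>Basis. H x e \<bullet> e) + \<psi>' (u x) * (norm (g x))\<^sup>2))"
    unfolding sB by (intro Bochner_Integration.integrable_sum intB)
  show "integrable lborel (\<lambda>x. (\<Sum>e\<in>Basis. cutoff_dd l e x) * \<Psi> (u x))"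
    unfolding sA by (intro Bochner_Integration.integrable_sum intA)
  show "(\<integral>x. cutoff l x * (\<psi> (u x) * (\<Sum>e\<in>Basis. H x e \<bullet> e) + \<psi>' (u x) * (norm (g x))\<^sup>2) \<partial>lborel)
       = (\<integral>x. (\<Sum>e\<in>Basis. cutoff_dd l e x) * \<Psi> (u x) \<partial>lborel)"
    unfolding sA sB using eq intA intB by (simp add: Bochner_Integration.integral_sum)
qed

section \<open>Local growth of the mass\<close>

lemma powr_le_one_plus:
  fixes x \<sigma> :: real
  assumes "x \<ge> 0" "0 \<le> \<sigma>" "\<sigma> \<le> 1"
  shows "x powr \<sigma> \<le> 1 + x"
proof (cases "x \<le> 1")
  case True
  then have "x powr \<sigma> \<le> 1 powr \<sigma>" using assms by (intro powr_mono2) auto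
  then show ?thesis using assms by simp
next
  case False
  then have "x powr \<sigma> \<le> x powr 1" using assms by (intro powr_mono) auto
  then show ?thesis using False by simp
qed

text \<open>
  Convexity of \<open>j\<close> gives \<open>\<partial>\<^sub>t j(u) \<le> \<Delta>(\<Psi>(u))\<close>. After integration by parts the right-hand side is bounded by the
  cutoff to the power \<open>\<sigma>\<close> times \<open>j\<^sup>\<sigma> + 1\<close>, and \<open>z\<^sup>\<sigma> \<le> 1 + z\<close> makes this linear in the weighted mass \<open>Y\<close>. Then
  \<open>Y + 2V\<close> times \<open>exp (- A t)\<close> is nonincreasing.
\<close>

lemma weighted_mass_growth:
  fixes u :: "real \<Rightarrow> 'a::euclidean_space \<Rightarrow> real" and j j1 j2 \<Psi> :: "real \<Rightarrow> real"
  assumes S: "open S" "cball 0 1 \<subseteq> S" and u: "classical_fde m {0<..1} S u ut g H"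
    and j: "\<And>r. r > 0 \<Longrightarrow> (j has_real_derivative j1 r) (at r)" "\<And>r. r > 0 \<Longrightarrow> 0 < j r"
    and j1: "\<And>r. r > 0 \<Longrightarrow> (j1 has_real_derivative j2 r) (at r)"
    and j2: "\<And>r. r > 0 \<Longrightarrow> 0 \<le> j2 r" "continuous_on {0<..} j2"
    and \<Psi>: "\<And>r. r > 0 \<Longrightarrow> (\<Psi> has_real_derivative j1 r * r powr (m - 1)) (at r)"
      "\<And>r. r > 0 \<Longrightarrow> \<bar>\<Psi> r\<bar> \<le> B * (j r powr \<sigma> + 1)"
    and B: "B \<ge> 0" and \<sigma>: "0 \<le> \<sigma>" "\<sigma> \<le> 1" and l: "real (l + 3) * \<sigma> \<le> real (l + 1)"
    and st: "0 < s" "s < t" "t \<le> 1"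
  defines "V \<equiv> measure lborel (ball (0::'a) 1)"
    and "A \<equiv> B * (2 * real (l + 3) * real DIM('a) + 4 * real (l + 3) * real (l + 2))"
  shows "(\<integral>x. cutoff l x * j (u t x) \<partial>lborel) \<le> exp A * ((\<integral>x. cutoff l x * j (u s x) \<partial>lborel) + 2 * V)"
proof -
  define F where "F \<tau> x = cutoff l x * j (u \<tau> x)" for \<tau> x
  define F' where "F' \<tau> x = cutoff l x * (j1 (u \<tau> x) * ut \<tau> x)" for \<tau> x
  define Y where "Y \<tau> = (\<integral>x. F \<tau> x \<partial>lborel)" for \<tau>
  have A0: "A \<ge> 0" using B by (simp add: A_def)
  have inI: "\<tau> \<in> {0<..1}" if "\<tau> \<in> {s..t}" for \<tau> using that st by auto
  have cj: "continuous_on {0<..} j" and cj1: "continuous_on {0<..} j1"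
    by (rule DERIV_continuous_on, rule has_field_derivative_at_within, rule j(1) j1, simp)+
  have pos: "u \<tau> x > 0" if "\<tau> \<in> {s..t}" "x \<in> S" for \<tau> x
    using classical_fdeD(1)[OF u inI[OF that(1)] that(2)] .
  have cu: "continuous_on S (u \<tau>)" "continuous_on S (ut \<tau>)" "continuous_on S (g \<tau>)"
    "\<And>e. e \<in> Basis \<Longrightarrow> continuous_on S (\<lambda>x. H \<tau> x e \<bullet> e)" if "\<tau> \<in> {s..t}" for \<tau>
    using continuous_on_slice[OF classical_fde_continuous(1)[OF u] inI[OF that]]
      continuous_on_slice[OF classical_fde_continuous(2)[OF u] inI[OF that]]
      continuous_on_slice[OF classical_fde_continuous(3)[OF u] inI[OF that]]
      continuous_on_slice[OF classical_fde_continuous(4)[OF u] inI[OF that]] by auto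
  have outF: "F \<tau> x = 0" "F' \<tau> x = 0" if "x \<notin> ball 0 1" for \<tau> x
    using that by (simp_all add: F_def F'_def cutoff_simps)
  have cF: "continuous_on UNIV (F \<tau>)" and cF': "continuous_on UNIV (F' \<tau>)" if \<tau>: "\<tau> \<in> {s..t}" for \<tau>
  proof -
    have "continuous_on S (\<lambda>x. j (u \<tau> x))"
      by (rule continuous_on_compose2[OF cj cu(1)[OF \<tau>]]) (use pos[OF \<tau>] in auto)
    then show "continuous_on UNIV (F \<tau>)" unfolding F_def[abs_def]
      by (rule continuous_on_times_cutoff[OF S(2) _ continuous_on_cutoff(1)]) (simp add: cutoff_simps)
    have "continuous_on S (\<lambda>x. j1 (u \<tau> x))"
      by (rule continuous_on_compose2[OF cj1 cu(1)[OF \<tau>]]) (use pos[OF \<tau>] in auto)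
    then have "continuous_on S (\<lambda>x. j1 (u \<tau> x) * ut \<tau> x)"
      by (intro continuous_on_mult cu(2)[OF \<tau>])
    then show "continuous_on UNIV (F' \<tau>)" unfolding F'_def[abs_def]
      by (rule continuous_on_times_cutoff[OF S(2) _ continuous_on_cutoff(1)]) (simp add: cutoff_simps)
  qed
  have IF: "integrable lborel (F \<tau>)" "integral (cbox (- One) One) (F \<tau>) = Y \<tau>"
    and IF': "integrable lborel (F' \<tau>)" "integral (cbox (- One) One) (F' \<tau>) = (\<integral>x. F' \<tau> x \<partial>lborel)"
    if \<tau>: "\<tau> \<in> {s..t}" for \<tau>
    using integral_lborel_eq_integral_cbox[OF cF[OF \<tau>]] integral_lborel_eq_integral_cbox[OF cF'[OF \<tau>]] outF
    by (auto simp: Y_def)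
  have dY: "(Y has_real_derivative (\<integral>x. F' \<tau> x \<partial>lborel)) (at \<tau> within {s..t})" if \<tau>: "\<tau> \<in> {s..t}" for \<tau>
  proof -
    have "((\<lambda>\<tau>. integral (cbox (- One) One) (F \<tau>)) has_real_derivative integral (cbox (- One) One) (F' \<tau>)) (at \<tau> within {s..t})"
    proof (rule leibniz_rule_field_derivative)
      show "((\<lambda>\<tau>. F \<tau> x) has_real_derivative F' \<tau> x) (at \<tau> within {s..t})" if \<tau>: "\<tau> \<in> {s..t}" for \<tau> x
      proof (cases "x \<in> S")
        case True
        have "((\<lambda>\<tau>. j (u \<tau> x)) has_real_derivative j1 (u \<tau> x) * ut \<tau> x) (at \<tau>)"
          by (rule DERIV_chain2[OF j(1)[OF pos[OF \<tau> True]] classical_fdeD(2)[OF u inI[OF \<tau>] True]])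
        from DERIV_cmult[OF this, of "cutoff l x"]
        show ?thesis unfolding F_def F'_def by (rule has_field_derivative_at_within)
      next
        case False
        then have "x \<notin> ball 0 1" using S(2) ball_subset_cball by blast
        then show ?thesis by (simp add: outF)
      qed
      show "F \<tau> integrable_on cbox (- One) One" if "\<tau> \<in> {s..t}" for \<tau>
        using cF[OF that] by (intro integrable_continuous) (auto elim: continuous_on_subset)
      have "continuous_on ({s..t} \<times> cball 0 1 \<union> {s..t} \<times> {x. norm x \<ge> 1}) (\<lambda>(\<tau>, x). F' \<tau> x)"
      proof (rule continuous_on_paste_zero)
        have cu2: "continuous_on ({s..t} \<times> cball 0 1) (\<lambda>(\<tau>, x). u \<tau> x)"
          by (rule continuous_on_subset[OF classical_fde_continuous(1)[OF u]]) (use S(2) inI in auto)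
        have cut2: "continuous_on ({s..t} \<times> cball 0 1) (\<lambda>(\<tau>, x). ut \<tau> x)"
          by (rule continuous_on_subset[OF classical_fde_continuous(2)[OF u]]) (use S(2) inI in auto)
        have 1: "continuous_on ({s..t} \<times> cball 0 1) (\<lambda>z. j1 (case z of (\<tau>, x) \<Rightarrow> u \<tau> x))"
          by (rule continuous_on_compose2[OF cj1 cu2]) (use pos S(2) in auto)
        have 2: "continuous_on ({s..t} \<times> cball 0 1) (\<lambda>z. cutoff l (snd z) :: real)"
          by (rule continuous_on_compose2[OF continuous_on_cutoff(1)[of UNIV]]) (auto intro!: continuous_intros)
        have "continuous_on ({s..t} \<times> cball 0 1)
            (\<lambda>z. cutoff l (snd z) * (j1 (case z of (\<tau>, x) \<Rightarrow> u \<tau> x) * (case z of (\<tau>, x) \<Rightarrow> ut \<tau> x)))"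
          by (intro continuous_on_mult 1 2 cut2)
        then show "continuous_on ({s..t} \<times> cball 0 1) (\<lambda>(\<tau>, x). F' \<tau> x)"
          by (simp add: F'_def case_prod_unfold)
        show "(case z of (\<tau>, x) \<Rightarrow> F' \<tau> x) = 0" if "z \<in> {s..t} \<times> {x. norm x \<ge> 1}" for z
          using that outF(2) by (cases z) simp
      qed (intro closed_Times closed_atLeastAtMost closed_cball closed_norm_ge_1)+
      then show "continuous_on ({s..t} \<times> cbox (- One) One) (\<lambda>(\<tau>, x). F' \<tau> x)"
        by (rule continuous_on_subset) auto
    qed (use \<tau> in auto)
    then have 1: "((\<lambda>\<tau>. integral (cbox (- One) One) (F \<tau>)) has_real_derivative (\<integral>x. F' \<tau> x \<partial>lborel)) (at \<tau> within {s..t})"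
      by (simp add: IF'(2)[OF \<tau>])
    show ?thesis
      by (rule has_field_derivative_transform_within[OF 1 zero_less_one \<tau>]) (use IF(2) in simp)
  qed
  have growth: "(\<integral>x. F' \<tau> x \<partial>lborel) \<le> A * (Y \<tau> + 2 * V)" if \<tau>: "\<tau> \<in> {s..t}" for \<tau>
  proof -
    \<comment> \<open>\<open>\<psi>\<close> is the derivative of \<open>\<Psi>\<close>; the term with \<open>j2\<close> in \<open>\<psi>'\<close> is the gain from convexity.\<close>
    define \<psi> where "\<psi> r = j1 r * r powr (m - 1)" for r
    define \<psi>' where "\<psi>' r = j2 r * r powr (m - 1) + (m - 1) * j1 r * r powr (m - 2)" for r
    have d\<psi>: "(\<psi> has_real_derivative \<psi>' r) (at r)" if "r > 0" for r
    proof -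
      have "((\<lambda>r. r powr (m - 1)) has_real_derivative (m - 1) * r powr (m - 1 - 1)) (at r)"
        by (rule has_real_derivative_powr[OF that])
      from DERIV_mult[OF j1[OF that] this] show ?thesis
        unfolding \<psi>_def[abs_def] \<psi>'_def by (rule DERIV_cong) (simp add: algebra_simps)
    qed
    have c\<psi>': "continuous_on {0<..} \<psi>'"
      unfolding \<psi>'_def[abs_def]
      by (intro continuous_on_add continuous_on_mult j2(2) cj1 continuous_on_const continuous_on_powr continuous_on_id) auto
    have \<Psi>': "(\<Psi> has_real_derivative \<psi> r) (at r)" if "r > 0" for r using \<Psi>(1)[OF that] by (simp add: \<psi>_def)
    define R where "R x = cutoff l x * (\<psi> (u \<tau> x) * (\<Sum>e\<in>Basis. H \<tau> x e \<bullet> e) + \<psi>' (u \<tau> x) * (norm (g \<tau> x))\<^sup>2)" for x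
    define Q where "Q x = (\<Sum>e\<in>Basis. cutoff_dd l e x) * \<Psi> (u \<tau> x)" for x
    have RQ: "integrable lborel R" "integrable lborel Q" "(\<integral>x. R x \<partial>lborel) = (\<integral>x. Q x \<partial>lborel)"
      unfolding R_def[abs_def] Q_def[abs_def]
      by (rule flux_integration_by_parts[OF S pos[OF \<tau>] classical_fdeD(3)[OF u inI[OF \<tau>]]
            classical_fdeD(4)[OF u inI[OF \<tau>]] cu(1)[OF \<tau>] cu(3)[OF \<tau>] cu(4)[OF \<tau>] \<Psi>' d\<psi> c\<psi>'];
          assumption)+
    have "(\<integral>x. F' \<tau> x \<partial>lborel) \<le> (\<integral>x. R x \<partial>lborel)"
    proof (rule integral_mono[OF IF'(1)[OF \<tau>] RQ(1)])
      fix x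
      show "F' \<tau> x \<le> R x"
      proof (cases "x \<in> S")
        case True
        have "R x - F' \<tau> x = cutoff l x * (j2 (u \<tau> x) * u \<tau> x powr (m - 1) * (norm (g \<tau> x))\<^sup>2)"
          unfolding R_def F'_def classical_fdeD(5)[OF u inI[OF \<tau>] True] \<psi>_def \<psi>'_def
          by (simp add: algebra_simps)
        also have "\<dots> \<ge> 0" using j2(1)[OF pos[OF \<tau> True]] by (simp add: cutoff_simps)
        finally show ?thesis by simp
      next
        case False
        then have "x \<notin> ball 0 1" using S(2) ball_subset_cball by blast
        then show ?thesis by (simp add: R_def F'_def cutoff_simps)
      qed
    qed
    also have "\<dots> = (\<integral>x. Q x \<partial>lborel)" by (rule RQ(3))
    also have "\<dots> \<le> (\<integral>x. A * (F \<tau> x + 2 * indicator (ball 0 1) x) \<partial>lborel)"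
    proof (rule integral_mono[OF RQ(2)])
      show "integrable lborel (\<lambda>x. A * (F \<tau> x + 2 * indicator (ball 0 1) x))"
        by (intro integrable_mult_right Bochner_Integration.integrable_add IF(1)[OF \<tau>] integrable_real_indicator)
          (simp_all add: emeasure_ball)
      fix x :: 'a
      show "Q x \<le> A * (F \<tau> x + 2 * indicator (ball 0 1) x)"
      proof (cases "x \<in> ball 0 1")
        case True
        then have xS: "x \<in> S" using S(2) ball_subset_cball by blast
        define J where "J = j (u \<tau> x)"
        have J: "J > 0" unfolding J_def by (rule j(2)[OF pos[OF \<tau> xS]])
        define c where "c = cutoff l x"
        have c: "0 \<le> c" "c \<le> 1" by (simp_all add: c_def cutoff_simps)
        have "Q x \<le> \<bar>\<Sum>e\<in>Basis. cutoff_dd l e x\<bar> * \<bar>\<Psi> (u \<tau> x)\<bar>"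
          unfolding Q_def by (metis abs_ge_self abs_mult)
        also have "\<dots> \<le> ((2 * real (l + 3) * real DIM('a) + 4 * real (l + 3) * real (l + 2)) * c powr \<sigma>) * (B * (J powr \<sigma> + 1))"
          using cutoff_laplacian_bound[OF l, of x] \<Psi>(2)[OF pos[OF \<tau> xS]]
          unfolding c_def J_def by (intro mult_mono) auto
        also have "\<dots> = A * ((c * J) powr \<sigma> + c powr \<sigma>)"
          using c J by (simp add: A_def powr_mult algebra_simps)
        also have "\<dots> \<le> A * ((1 + c * J) + 1)"
        proof (intro mult_left_mono add_mono A0)
          show "(c * J) powr \<sigma> \<le> 1 + c * J" using c J \<sigma> by (intro powr_le_one_plus) auto
          have "c powr \<sigma> \<le> 1 powr \<sigma>" using c \<sigma> by (intro powr_mono2) auto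
          then show "c powr \<sigma> \<le> 1" by simp
        qed
        also have "\<dots> = A * (F \<tau> x + 2 * indicator (ball 0 1) x)"
          using True by (simp add: F_def c_def J_def)
        finally show ?thesis .
      next
        case False
        then show ?thesis by (simp add: Q_def outF cutoff_simps)
      qed
    qed
    also have "\<dots> = A * (Y \<tau> + 2 * V)"
    proof -
      have "integrable lborel (\<lambda>x. indicator (ball (0::'a) 1) x :: real)"
        by (rule integrable_real_indicator) (simp_all add: emeasure_ball)
      then show ?thesis using IF(1)[OF \<tau>] by (simp add: Y_def V_def)
    qed
    finally show ?thesis .
  qed
  define Z where "Z \<tau> = (Y \<tau> + 2 * V) * exp (- A * \<tau>)" for \<tau>
  have dZ: "(Z has_real_derivative ((\<integral>x. F' \<tau> x \<partial>lborel) - A * (Y \<tau> + 2 * V)) * exp (- A * \<tau>)) (at \<tau> within {s..t})"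
    if "\<tau> \<in> {s..t}" for \<tau>
    unfolding Z_def[abs_def]
    by (rule derivative_eq_intros dY[OF that] refl)+ (simp add: algebra_simps)
  have "Z t \<le> Z s"
  proof (rule DERIV_nonpos_imp_decreasing_open[of s t Z])
    show "continuous_on {s..t} Z" using dZ by (rule DERIV_continuous_on)
    fix \<tau> assume "s < \<tau>" "\<tau> < t"
    then have \<tau>: "\<tau> \<in> {s..t}" and "at \<tau> within {s..t} = at \<tau>" by (auto simp: at_within_Icc_at)
    then have "(Z has_real_derivative ((\<integral>x. F' \<tau> x \<partial>lborel) - A * (Y \<tau> + 2 * V)) * exp (- A * \<tau>)) (at \<tau>)"
      using dZ[OF \<tau>] by simp
    moreover have "((\<integral>x. F' \<tau> x \<partial>lborel) - A * (Y \<tau> + 2 * V)) * exp (- A * \<tau>) \<le> 0"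
      using growth[OF \<tau>] by (intro mult_nonpos_nonneg) auto
    ultimately show "\<exists>y. (Z has_real_derivative y) (at \<tau>) \<and> y \<le> 0" by blast
  qed (use st in simp)
  have V0: "V \<ge> 0" by (simp add: V_def)
  have Ys: "Y s \<ge> 0" unfolding Y_def
  proof (rule integral_nonneg_AE, rule AE_I2)
    fix x
    show "0 \<le> F s x"
    proof (cases "x \<in> S")
      case True
      then have "j (u s x) > 0" using st by (intro j(2) pos) auto
      then show ?thesis by (simp add: F_def cutoff_simps)
    next
      case False
      then have "x \<notin> ball 0 1" using S(2) ball_subset_cball by blast
      then show ?thesis by (simp add: outF)
    qed
  qed
  have "(Y t + 2 * V) = Z t * exp (A * t)" by (simp add: Z_def exp_minus)
  also have "\<dots> \<le> Z s * exp (A * t)" using \<open>Z t \<le> Z s\<close> by (intro mult_right_mono) auto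
  also have "\<dots> = (Y s + 2 * V) * exp (A * (t - s))"
    by (simp add: Z_def mult.assoc exp_add[symmetric] algebra_simps)
  also have "\<dots> \<le> (Y s + 2 * V) * exp A"
  proof (intro mult_left_mono)
    have "A * (t - s) \<le> A * 1" using A0 st by (intro mult_left_mono) auto
    then show "exp (A * (t - s)) \<le> exp A" by simp
  qed (use Ys V0 in simp)
  finally have "Y t \<le> exp A * (Y s + 2 * V)" using V0 by (simp add: mult.commute)
  then show ?thesis by (simp add: Y_def F_def)
qed

section \<open>The estimate at unit scale\<close>

lemma integrable_lebesgue_of_lborel:
  fixes f :: "'a::euclidean_space \<Rightarrow> real"
  assumes "integrable lborel f"
  shows "integrable lebesgue f"
  using assms integrable_completion[OF borel_measurable_integrable[OF assms]] by simp

text \<open>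
  A solution at unit scale with initial mass at most \<open>1\<close>. The integrability of \<open>u0\<close> is listed separately because the integral in the limit
  is \<open>0\<close> by default for a function that is not integrable.
\<close>

definition unit_data :: "real \<Rightarrow> real \<Rightarrow> (real \<Rightarrow> 'a::euclidean_space \<Rightarrow> real) \<Rightarrow> ('a \<Rightarrow> real) \<Rightarrow> bool" where
  "unit_data m p u u0 \<longleftrightarrow> classical_near m {0<..1} (cball 0 1) u \<and>
     set_integrable lebesgue (cball 0 1) u0 \<and>
     ((\<lambda>s. LINT x:cball 0 1|lebesgue. \<bar>u s x - u0 x\<bar>) \<longlongrightarrow> 0) (at_right 0) \<and>
     (\<integral>\<^sup>+x\<in>ball 0 1. ennreal (\<bar>u0 x\<bar> powr p) \<partial>lebesgue) \<le> 1"

text \<open>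
  The growth estimate holds from time \<open>s\<close> on with constants that depend neither on \<open>s\<close> nor on \<open>\<epsilon>\<close>. Let \<open>s\<close> tend to \<open>0\<close>, apply
  Chebyshev's inequality, and let \<open>\<epsilon>\<close> tend to \<open>0\<close>.
\<close>

lemma superlevel_mass_bound:
  fixes m p :: real
  assumes m: "m < 1" and p: "p \<ge> 1" "p + m - 1 > 0"
  shows "\<exists>C>0. \<forall>(u :: real \<Rightarrow> 'a::euclidean_space \<Rightarrow> real) u0. unit_data m p u u0 \<longrightarrow>
     (\<forall>t\<in>{0<..1}. \<forall>\<mu>>0. emeasure lborel {x \<in> ball 0 (1/2). u t x > \<mu>} \<le> ennreal (C * \<mu> powr (- p)))"
proof -
  define \<sigma> where "\<sigma> = (p + m - 1) / p"
  have \<sigma>: "0 < \<sigma>" "\<sigma> < 1" using p m by (auto simp: \<sigma>_def field_simps)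
  \<comment> \<open>The power of the cutoff is chosen large enough for its Laplacian to be absorbed.\<close>
  define l where "l = nat \<lceil>3 / (1 - \<sigma>)\<rceil>"
  have l: "real (l + 3) * \<sigma> \<le> real (l + 1)"
  proof -
    have "3 / (1 - \<sigma>) \<le> real l" unfolding l_def by linarith
    then have "3 \<le> real l * (1 - \<sigma>)" using \<sigma> by (simp add: field_simps)
    then have "3 * \<sigma> + real l * \<sigma> \<le> real l" using \<sigma> by (simp add: right_diff_distrib)
    then show ?thesis by (simp add: distrib_right)
  qed
  define V where "V = measure lborel (ball (0::'a) 1)"
  define A where "A = (1 / \<sigma>) * (2 * real (l + 3) * real DIM('a) + 4 * real (l + 3) * real (l + 2))"
  define D where "D = exp A * (1 + 2 * V)"
  have V0: "V \<ge> 0" by (simp add: V_def)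
  have D0: "D > 0" using V0 by (simp add: D_def add_pos_nonneg)
  define C where "C = D * (4/3) ^ (l + 3)"
  have main: "emeasure lborel {x \<in> ball 0 (1/2). u t x > \<mu>} \<le> ennreal (C * \<mu> powr (- p))"
    if S: "open S" "cball 0 1 \<subseteq> S" and u: "classical_fde m {0<..1} S u ut g H"
      and u0: "set_integrable lebesgue (cball 0 1) u0"
      and lim: "((\<lambda>s. LINT x:cball 0 1|lebesgue. \<bar>u s x - u0 x\<bar>) \<longlongrightarrow> 0) (at_right 0)"
      and mass: "(\<integral>\<^sup>+x\<in>ball 0 1. ennreal (\<bar>u0 x\<bar> powr p) \<partial>lebesgue) \<le> 1"
      and t: "t \<in> {0<..1}" and \<mu>: "\<mu> > 0"
    for u :: "real \<Rightarrow> 'a \<Rightarrow> real" and ut g H S u0 t \<mu>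
  proof -
    have pos: "u s x > 0" if "s \<in> {0<..1}" "x \<in> S" for s x using classical_fdeD(1)[OF u that] .
    have cu: "continuous_on S (u s)" if "s \<in> {0<..1}" for s
      by (rule continuous_on_slice[OF classical_fde_continuous(1)[OF u] that])
    have bS: "x \<in> S" if "x \<in> ball 0 1" for x using that S(2) ball_subset_cball by blast
    define f0 where "f0 x = indicator (ball 0 1) x * \<bar>u0 x\<bar> powr p" for x
    have f0: "integrable lebesgue f0" "(\<integral>x. f0 x \<partial>lebesgue) \<le> 1"
    proof -
      have "(\<lambda>x. indicator (cball 0 1) x *\<^sub>R u0 x) \<in> borel_measurable lebesgue"
        using u0 unfolding set_integrable_def by (rule borel_measurable_integrable)
      then have "(\<lambda>x. indicator (ball 0 1) x * \<bar>indicator (cball 0 1) x *\<^sub>R u0 x\<bar> powr p) \<in> borel_measurable lebesgue"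
        by (intro borel_measurable_times borel_measurable_indicator powr_real_measurable borel_measurable_abs
            borel_measurable_const) auto
      also have "(\<lambda>x. indicator (ball 0 1) x * \<bar>indicator (cball 0 1) x *\<^sub>R u0 x\<bar> powr p) = f0"
      proof
        fix x
        show "indicator (ball 0 1) x * \<bar>indicator (cball 0 1) x *\<^sub>R u0 x\<bar> powr p = f0 x"
        proof (cases "x \<in> ball 0 1")
          case True
          moreover from True have "x \<in> cball 0 1" using ball_subset_cball by blast
          ultimately show ?thesis by (simp only: f0_def indicator_simps scaleR_one)
        qed (simp add: f0_def)
      qed
      finally have meas: "f0 \<in> borel_measurable lebesgue" .
      have nn: "(\<integral>\<^sup>+x. ennreal (f0 x) \<partial>lebesgue) \<le> 1"
      proof -
        have "(\<integral>\<^sup>+x. ennreal (f0 x) \<partial>lebesgue) = (\<integral>\<^sup>+x\<in>ball 0 1. ennreal (\<bar>u0 x\<bar> powr p) \<partial>lebesgue)"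
          by (rule nn_integral_cong) (simp add: f0_def indicator_def)
        then show ?thesis using mass by simp
      qed
      have nonneg: "f0 x \<ge> 0" for x by (simp add: f0_def)
      show int: "integrable lebesgue f0"
      proof (rule integrableI_nonneg[OF meas])
        show "(\<integral>\<^sup>+x. ennreal (f0 x) \<partial>lebesgue) < \<infinity>"
          using le_less_trans[OF nn ennreal_one_less_top] by simp
      qed (simp add: nonneg)
      have "ennreal (\<integral>x. f0 x \<partial>lebesgue) = (\<integral>\<^sup>+x. ennreal (f0 x) \<partial>lebesgue)"
        by (rule nn_integral_eq_integral[symmetric, OF int]) (use nonneg in auto)
      then have "ennreal (\<integral>x. f0 x \<partial>lebesgue) \<le> ennreal 1" using nn by simp
      then show "(\<integral>x. f0 x \<partial>lebesgue) \<le> 1" by (subst (asm) ennreal_le_iff) auto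
    qed
    define dist1 where "dist1 s = (LINT x:cball 0 1|lebesgue. \<bar>u s x - u0 x\<bar>)" for s
    have int_dist: "integrable lebesgue (\<lambda>x. indicator (cball 0 1) x *\<^sub>R \<bar>u s x - u0 x\<bar>)" if s: "s \<in> {0<..1}" for s
    proof -
      have "integrable lborel (\<lambda>x. indicator (cball 0 1) x *\<^sub>R u s x)"
        by (rule borel_integrable_compact[OF compact_cball continuous_on_subset[OF cu[OF s] S(2)]])
      then have "integrable lebesgue (\<lambda>x. indicator (cball 0 1) x *\<^sub>R u s x)"
        by (rule integrable_lebesgue_of_lborel)
      from Bochner_Integration.integrable_diff[OF this u0[unfolded set_integrable_def]]
      have "integrable lebesgue (\<lambda>x. \<bar>indicator (cball 0 1) x *\<^sub>R u s x - indicator (cball 0 1) x *\<^sub>R u0 x\<bar>)"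
        by (rule integrable_abs)
      also have "(\<lambda>x. \<bar>indicator (cball 0 1) x *\<^sub>R u s x - indicator (cball 0 1) x *\<^sub>R u0 x\<bar>) =
          (\<lambda>x. indicator (cball 0 1) x *\<^sub>R \<bar>u s x - u0 x\<bar>)"
        by (rule ext) (simp add: indicator_def)
      finally show ?thesis .
    qed
    define Y where "Y \<epsilon> s = (\<integral>x. cutoff l x * tpow p \<epsilon> (u s x) \<partial>lborel)" for \<epsilon> s
    have Yint: "integrable lborel (\<lambda>x. cutoff l x * tpow p \<epsilon> (u s x))" if \<epsilon>: "\<epsilon> > 0" and s: "s \<in> {0<..1}" for \<epsilon> s
    proof (rule integral_lborel_eq_integral_cbox(1))
      have "continuous_on S (\<lambda>x. tpow p \<epsilon> (u s x))"
        by (rule continuous_on_compose2[OF continuous_on_tpow[OF \<epsilon> p(1)] cu[OF s]]) (use pos[OF s] in \<open>auto intro: less_imp_le\<close>)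
      then show "continuous_on UNIV (\<lambda>x. cutoff l x * tpow p \<epsilon> (u s x))"
        by (rule continuous_on_times_cutoff[OF S(2) _ continuous_on_cutoff(1)]) (simp add: cutoff_simps)
      show "cutoff l x * tpow p \<epsilon> (u s x) = 0" if "x \<notin> cball 0 1" for x
        using that by (simp add: cutoff_simps)
    qed
    have Y0: "Y \<epsilon> s \<le> 1 + p * \<epsilon> powr (1 - p) * dist1 s" if \<epsilon>: "\<epsilon> > 0" and s: "s \<in> {0<..1}" for \<epsilon> s
    proof -
      define L where "L = p * \<epsilon> powr (1 - p)"
      have L: "L \<ge> 0" using p by (simp add: L_def)
      have "Y \<epsilon> s = (\<integral>x. cutoff l x * tpow p \<epsilon> (u s x) \<partial>lebesgue)"
        unfolding Y_def by (rule integral_completion[symmetric]) (rule borel_measurable_integrable[OF Yint[OF \<epsilon> s]])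
      also have "\<dots> \<le> (\<integral>x. f0 x + L * (indicator (cball 0 1) x *\<^sub>R \<bar>u s x - u0 x\<bar>) \<partial>lebesgue)"
      proof (rule integral_mono)
        show "integrable lebesgue (\<lambda>x. cutoff l x * tpow p \<epsilon> (u s x))"
          by (rule integrable_lebesgue_of_lborel[OF Yint[OF \<epsilon> s]])
        show "integrable lebesgue (\<lambda>x. f0 x + L * (indicator (cball 0 1) x *\<^sub>R \<bar>u s x - u0 x\<bar>))"
          by (intro Bochner_Integration.integrable_add f0(1) integrable_mult_right int_dist[OF s])
        fix x :: 'a
        show "cutoff l x * tpow p \<epsilon> (u s x) \<le> f0 x + L * (indicator (cball 0 1) x *\<^sub>R \<bar>u s x - u0 x\<bar>)"
        proof (cases "x \<in> ball 0 1")
          case True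
          have ux: "u s x > 0" by (rule pos[OF s bS[OF True]])
          have "tpow p \<epsilon> (u s x) \<le> tpow p \<epsilon> \<bar>u0 x\<bar> + L * \<bar>u s x - \<bar>u0 x\<bar>\<bar>"
            unfolding L_def by (rule tpow_lipschitz[OF _ _ \<epsilon> p(1)]) (use ux in auto)
          moreover have "\<bar>u s x - \<bar>u0 x\<bar>\<bar> \<le> \<bar>u s x - u0 x\<bar>" using ux by linarith
          then have "L * \<bar>u s x - \<bar>u0 x\<bar>\<bar> \<le> L * \<bar>u s x - u0 x\<bar>" using L by (intro mult_left_mono)
          moreover have "tpow p \<epsilon> \<bar>u0 x\<bar> \<le> \<bar>u0 x\<bar> powr p"
            using tpow_bounds(2)[of "\<bar>u0 x\<bar>", OF _ \<epsilon> p(1)] tpow_0 by (cases "u0 x = 0") auto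
          ultimately have le: "tpow p \<epsilon> (u s x) \<le> \<bar>u0 x\<bar> powr p + L * \<bar>u s x - u0 x\<bar>" by linarith
          have "tpow p \<epsilon> (u s x) \<ge> 0" using tpow_bounds(1)[OF ux \<epsilon> p(1)] by simp
          then have "cutoff l x * tpow p \<epsilon> (u s x) \<le> 1 * tpow p \<epsilon> (u s x)"
            by (intro mult_right_mono) (auto simp: cutoff_simps)
          then show ?thesis using le True by (simp add: f0_def)
        next
          case False
          then show ?thesis using L by (simp add: cutoff_simps f0_def)
        qed
      qed
      also have "\<dots> = (\<integral>x. f0 x \<partial>lebesgue) + L * dist1 s"
        using f0(1) int_dist[OF s] by (simp add: dist1_def set_lebesgue_integral_def)
      finally show ?thesis using f0(2) by (simp add: L_def)
    qed
    have Yt: "Y \<epsilon> t \<le> D" if \<epsilon>: "\<epsilon> > 0" for \<epsilon>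
    proof -
      have c1: "continuous_on {0<..} (tpow_d p \<epsilon>)"
        by (rule DERIV_continuous_on, rule has_field_derivative_at_within, rule tpow_d_derivative[OF _ \<epsilon>], simp)
      have c2: "continuous_on {0<..} (tpow_dd p \<epsilon>)"
        unfolding tpow_dd_def[abs_def] using \<epsilon>
        by (intro continuous_on_mult continuous_on_powr continuous_on_add continuous_on_const continuous_on_id)
          (auto simp: add_pos_pos less_imp_neq[THEN not_sym])
      obtain \<Psi> where \<Psi>: "\<forall>r>0. (\<Psi> has_real_derivative tpow_d p \<epsilon> r * r powr (m - 1)) (at r) \<and>
          \<bar>\<Psi> r\<bar> \<le> (tpow p \<epsilon> r powr \<sigma> + 1) / \<sigma>"
        using flux_potential[OF m _ p(2) tpow_derivative[OF _ \<epsilon>] tpow_bounds(3)[OF _ \<epsilon> p(1)] c1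
            tpow_bounds(1)[OF _ \<epsilon> p(1)] tpow_bounds(2)[OF _ \<epsilon> p(1)]] p unfolding \<sigma>_def by auto
      have step: "Y \<epsilon> t \<le> exp A * (Y \<epsilon> s + 2 * V)" if s: "0 < s" "s < t" for s
        unfolding Y_def A_def V_def
      proof (rule weighted_mass_growth[OF S u tpow_derivative[OF _ \<epsilon>] tpow_bounds(1)[OF _ \<epsilon> p(1)]
            tpow_d_derivative[OF _ \<epsilon>] tpow_bounds(5)[OF _ \<epsilon> p(1)] c2])
        show "(\<Psi> has_real_derivative tpow_d p \<epsilon> r * r powr (m - 1)) (at r)" if "r > 0" for r
          using \<Psi> that by blast
        show "\<bar>\<Psi> r\<bar> \<le> 1 / \<sigma> * (tpow p \<epsilon> r powr \<sigma> + 1)" if "r > 0" for r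
          using \<Psi> that by simp
      qed (use \<sigma> l s t in auto)
      have "((\<lambda>s. exp A * ((1 + p * \<epsilon> powr (1 - p) * dist1 s) + 2 * V)) \<longlongrightarrow> exp A * ((1 + p * \<epsilon> powr (1 - p) * 0) + 2 * V)) (at_right 0)"
        using lim unfolding dist1_def[symmetric] by (intro tendsto_intros)
      moreover have "\<forall>\<^sub>F s in at_right 0. Y \<epsilon> t \<le> exp A * ((1 + p * \<epsilon> powr (1 - p) * dist1 s) + 2 * V)"
      proof -
        have "\<forall>\<^sub>F s in at_right 0. 0 < s \<and> s < t"
          using t by (auto simp: eventually_at_right_field intro!: exI[of _ t])
        then show ?thesis
        proof (rule eventually_mono)
          fix s assume s: "0 < s \<and> s < t"
          then have "exp A * (Y \<epsilon> s + 2 * V) \<le> exp A * ((1 + p * \<epsilon> powr (1 - p) * dist1 s) + 2 * V)"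
            using Y0[OF \<epsilon>, of s] t by (intro mult_left_mono add_right_mono) auto
          then show "Y \<epsilon> t \<le> exp A * ((1 + p * \<epsilon> powr (1 - p) * dist1 s) + 2 * V)"
            using step[of s] s by linarith
        qed
      qed
      ultimately have "Y \<epsilon> t \<le> exp A * ((1 + p * \<epsilon> powr (1 - p) * 0) + 2 * V)"
        by (intro tendsto_lowerbound[of _ _ "at_right 0"]) auto
      then show ?thesis by (simp add: D_def)
    qed
    define E where "E = {x \<in> ball 0 (1/2). u t x > \<mu>}"
    have bhS: "ball 0 (1/2) \<subseteq> S"
    proof
      fix x :: 'a assume "x \<in> ball 0 (1/2)"
      then show "x \<in> S" by (intro bS) simp
    qed
    have "open (ball 0 (1/2) \<inter> u t -` {\<mu><..})"
      by (rule continuous_open_preimage[OF continuous_on_subset[OF cu[OF t] bhS]]) auto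
    moreover have "E = ball 0 (1/2) \<inter> u t -` {\<mu><..}" by (auto simp: E_def)
    ultimately have Em: "E \<in> sets lborel" by simp
    have "emeasure lborel E \<le> emeasure lborel (ball (0::'a) (1/2))"
      by (intro emeasure_mono) (auto simp: E_def)
    also have "\<dots> < \<infinity>" by (simp add: emeasure_ball)
    finally have Efin: "emeasure lborel E < \<infinity>" .
    define k where "k = (3/4::real) ^ (l + 3)"
    have k: "k > 0" by (simp add: k_def)
    have cheb: "k * tpow p \<epsilon> \<mu> * measure lborel E \<le> D" if \<epsilon>: "\<epsilon> > 0" for \<epsilon>
    proof -
      have "k * tpow p \<epsilon> \<mu> * measure lborel E = (\<integral>x. k * tpow p \<epsilon> \<mu> * indicator E x \<partial>lborel)"
        using Em Efin by simp
      also have "\<dots> \<le> Y \<epsilon> t" unfolding Y_def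
      proof (rule integral_mono[OF _ Yint[OF \<epsilon> t]])
        show "integrable lborel (\<lambda>x. k * tpow p \<epsilon> \<mu> * indicator E x)"
          using Em Efin by (intro integrable_mult_right integrable_real_indicator) auto
        fix x :: 'a
        have T0: "tpow p \<epsilon> \<mu> > 0" by (rule tpow_bounds(1)[OF \<mu> \<epsilon> p(1)])
        show "k * tpow p \<epsilon> \<mu> * indicator E x \<le> cutoff l x * tpow p \<epsilon> (u t x)"
        proof (cases "x \<in> ball 0 1")
          case False
          then have "x \<notin> E" by (auto simp: E_def)
          then show ?thesis using False by (simp add: cutoff_simps)
        next
          case True
          have ux: "u t x > 0" by (rule pos[OF t bS[OF True]])
          show ?thesis
          proof (cases "x \<in> E")
            case True
            then have x: "norm x < 1/2" "u t x > \<mu>" by (auto simp: E_def)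
            have "(norm x)\<^sup>2 \<le> (1/2)\<^sup>2" using x by (intro power_mono) auto
            then have "x \<bullet> x \<le> 1/4" unfolding power2_norm_eq_inner by (simp add: power2_eq_square)
            then have "bump_base x \<ge> 3/4" unfolding bump_base_def by linarith
            then have kc: "k \<le> cutoff l x" unfolding k_def cutoff_def by (intro power_mono) auto
            have T: "tpow p \<epsilon> \<mu> \<le> tpow p \<epsilon> (u t x)" by (rule tpow_mono[OF \<mu> _ \<epsilon> p(1)]) (use x in simp)
            have "k * tpow p \<epsilon> \<mu> \<le> cutoff l x * tpow p \<epsilon> (u t x)"
              by (rule mult_mono[OF kc T]) (use T0 in \<open>simp_all add: cutoff_simps\<close>)
            then show ?thesis using True by simp
          next
            case False
            then show ?thesis using tpow_bounds(1)[OF ux \<epsilon> p(1)] by (simp add: cutoff_simps)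
          qed
        qed
      qed
      also have "\<dots> \<le> D" by (rule Yt[OF \<epsilon>])
      finally show ?thesis .
    qed
    have "((\<lambda>\<epsilon>. \<mu> powr p * (1 + \<epsilon> * \<mu>) powr (1 - p)) \<longlongrightarrow> \<mu> powr p * (1 + 0 * \<mu>) powr (1 - p)) (at_right 0)"
      by (intro tendsto_intros) auto
    then have "((\<lambda>\<epsilon>. tpow p \<epsilon> \<mu>) \<longlongrightarrow> \<mu> powr p) (at_right 0)"
      by (simp add: tpow_def)
    then have "((\<lambda>\<epsilon>. k * tpow p \<epsilon> \<mu> * measure lborel E) \<longlongrightarrow> k * \<mu> powr p * measure lborel E) (at_right 0)"
      by (intro tendsto_intros)
    moreover have "\<forall>\<^sub>F \<epsilon> in at_right 0. k * tpow p \<epsilon> \<mu> * measure lborel E \<le> D"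
      using cheb by (auto simp: eventually_at_right_field intro!: exI[of _ 1])
    ultimately have "k * \<mu> powr p * measure lborel E \<le> D"
      by (intro tendsto_upperbound[of _ _ "at_right 0"]) auto
    then have "measure lborel E \<le> D / (k * \<mu> powr p)" using k \<mu> by (simp add: field_simps)
    also have "D / (k * \<mu> powr p) = C * \<mu> powr (- p)"
    proof -
      have "(4/3::real) ^ (l + 3) = 1 / k" unfolding k_def by (simp add: power_divide)
      then show ?thesis unfolding C_def by (simp add: powr_minus_divide)
    qed
    finally have "ennreal (measure lborel E) \<le> ennreal (C * \<mu> powr (- p))" by (rule ennreal_leI)
    then show ?thesis using Efin unfolding E_def[symmetric] by (simp add: emeasure_eq_ennreal_measure)
  qed
  show ?thesis
  proof (intro exI[of _ C] conjI allI impI ballI)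
    show "C > 0" using D0 by (simp add: C_def)
    fix u :: "real \<Rightarrow> 'a \<Rightarrow> real" and u0 and t \<mu> :: real
    assume u: "unit_data m p u u0" and t: "t \<in> {0<..1}" and \<mu>: "\<mu> > 0"
    then obtain S ut g H where "open S" "cball 0 1 \<subseteq> S" "classical_fde m {0<..1} S u ut g H"
      unfolding unit_data_def classical_near_def by blast
    then show "emeasure lborel {x \<in> ball 0 (1/2). u t x > \<mu>} \<le> ennreal (C * \<mu> powr (- p))"
      by (rule main[where ?u0.0 = u0, OF _ _ _ _ _ _ t \<mu>]) (use u in \<open>simp_all only: unit_data_def\<close>)
  qed
qed

lemma smoothing_unit_scale:
  fixes m p :: real
  assumes m: "m < 1" and p: "p \<ge> 1" "p + m - 1 > 0" "2 * p > real DIM('a) * (1 - m)"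
  shows "\<exists>C>0. \<forall>(u :: real \<Rightarrow> 'a::euclidean_space \<Rightarrow> real) u0. unit_data m p u u0 \<longrightarrow> u 1 0 \<le> C"
proof -
  obtain K1 where K1: "K1 > 0" and mass: "\<forall>(u :: real \<Rightarrow> 'a \<Rightarrow> real) u0. unit_data m p u u0 \<longrightarrow>
     (\<forall>t\<in>{0<..1}. \<forall>\<mu>>0. emeasure lborel {x \<in> ball 0 (1/2). u t x > \<mu>} \<le> ennreal (K1 * \<mu> powr (- p)))"
    using superlevel_mass_bound[OF m p(1,2), where 'a='a] by (elim exE conjE) (rule that)
  obtain C where C: "C > 0" and sm: "\<forall>u :: real \<Rightarrow> 'a \<Rightarrow> real. classical_near m {1/2..1} (cball 0 (1/2)) u \<and>
     (\<forall>t\<in>{1/2..1}. \<forall>\<mu>>0. emeasure lborel {x \<in> ball 0 (1/2). u t x > \<mu>} \<le> ennreal (K1 * \<mu> powr (- p)))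
     \<longrightarrow> u 1 0 \<le> C"
    using bounded_of_weak_Lp_bound[OF m p(3) K1] by (elim exE conjE) (rule that)
  show ?thesis
  proof (intro exI[of _ C] conjI allI impI C)
    fix u :: "real \<Rightarrow> 'a \<Rightarrow> real" and u0
    assume u: "unit_data m p u u0"
    have "classical_near m {0<..1} (cball 0 1) u" using u by (simp only: unit_data_def)
    then have near: "classical_near m {1/2..1} (cball 0 (1/2)) u"
    proof (rule classical_near_mono)
      show "{1/2..1::real} \<subseteq> {0<..1}" by auto
      show "cball (0::'a) (1/2) \<subseteq> cball 0 1" by (rule subset_cball) simp
    qed
    have "\<forall>t\<in>{1/2..1}. \<forall>\<mu>>0. emeasure lborel {x \<in> ball 0 (1/2). u t x > \<mu>} \<le> ennreal (K1 * \<mu> powr (- p))"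
    proof (intro ballI allI impI)
      fix t \<mu> :: real assume "t \<in> {1/2..1}" "\<mu> > 0"
      then show "emeasure lborel {x \<in> ball 0 (1/2). u t x > \<mu>} \<le> ennreal (K1 * \<mu> powr (- p))"
        by (intro mass[rule_format, OF u]) simp_all
    qed
    then show "u 1 0 \<le> C" by (intro sm[THEN spec, THEN mp] conjI near)
  qed
qed

section \<open>Smooth test functions\<close>

lemma partial_eq:
  assumes "(f has_derivative f') (at z)"
  shows "partial v f z = f' v"
  unfolding partial_def using frechet_derivative_at[OF assms] by simp

lemma has_derivative_partial:
  assumes "f differentiable (at z)"
  shows "(f has_derivative (\<lambda>v. partial v f z)) (at z)"
  using assms unfolding partial_def by (simp add: frechet_derivative_works)

lemma partial_direction:
  assumes "f differentiable (at z)"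
  shows "((\<lambda>s. f (z + s *\<^sub>R e)) has_real_derivative partial e f z) (at 0)"
proof -
  have 1: "((\<lambda>s. z + s *\<^sub>R e) has_derivative (\<lambda>s. s *\<^sub>R e)) (at 0)"
    by (auto intro!: derivative_eq_intros)
  have 2: "(f has_derivative (\<lambda>v. partial v f z)) (at (z + 0 *\<^sub>R e))"
    using has_derivative_partial[OF assms] by simp
  interpret D: bounded_linear "\<lambda>v. partial v f z"
    using has_derivative_partial[OF assms] by (rule has_derivative_bounded_linear)
  have "((\<lambda>s. f (z + s *\<^sub>R e)) has_derivative (\<lambda>s. partial (s *\<^sub>R e) f z)) (at 0)"
    by (rule has_derivative_compose[OF 1 2])
  then show ?thesis
    unfolding has_field_derivative_def by (rule has_derivative_eq_rhs) (simp add: fun_eq_iff D.scaleR)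
qed

lemma Ck_on_Suc_imp: "Ck_on (Suc k) S f \<Longrightarrow> Ck_on k S f"
proof (induction k arbitrary: f)
  case 0
  then have "\<forall>z\<in>S. f differentiable (at z)" by simp
  then show ?case by (auto intro!: continuous_at_imp_continuous_on differentiable_imp_continuous_within)
next
  case (Suc k)
  then show ?case by auto
qed

lemma Ck_on_const: "Ck_on k UNIV (\<lambda>_. c)"
proof (induction k arbitrary: c)
  case (Suc k)
  have "partial v (\<lambda>_. c) = (\<lambda>_. 0)" for v :: 'a by (rule ext) (rule partial_eq, rule has_derivative_const)
  then show ?case using Suc by simp
qed simp

lemma Ck_on_add: "Ck_on k UNIV f \<Longrightarrow> Ck_on k UNIV g \<Longrightarrow> Ck_on k UNIV (\<lambda>z. f z + g z)"
proof (induction k arbitrary: f g)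
  case 0
  then show ?case by (auto intro: continuous_on_add)
next
  case (Suc k)
  have d: "f differentiable (at z)" "g differentiable (at z)" for z using Suc.prems by auto
  have "partial v (\<lambda>z. f z + g z) = (\<lambda>z. partial v f z + partial v g z)" for v
    by (rule ext) (rule partial_eq, intro has_derivative_add has_derivative_partial d)
  then show ?case using Suc d by (auto intro: differentiable_add)
qed

lemma Ck_on_mult: "Ck_on k UNIV f \<Longrightarrow> Ck_on k UNIV g \<Longrightarrow> Ck_on k UNIV (\<lambda>z. f z * g z)"
proof (induction k arbitrary: f g)
  case 0
  then show ?case by (auto intro: continuous_on_mult)
next
  case (Suc k)
  have d: "f differentiable (at z)" "g differentiable (at z)" for z using Suc.prems by auto
  have p: "partial v (\<lambda>z. f z * g z) = (\<lambda>z. f z * partial v g z + partial v f z * g z)" for v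
    by (rule ext) (rule partial_eq, intro has_derivative_mult has_derivative_partial d)
  have "Ck_on k UNIV f" "Ck_on k UNIV g" using Suc.prems Ck_on_Suc_imp by blast+
  moreover have "Ck_on k UNIV (partial v f)" "Ck_on k UNIV (partial v g)" for v using Suc.prems by auto
  ultimately have "Ck_on k UNIV (partial v (\<lambda>z. f z * g z))" for v
    unfolding p by (intro Ck_on_add Suc.IH)
  then show ?case using d by (auto intro: differentiable_mult)
qed

text \<open>
  The functions \<open>s\<^bsup>-k\<^esup> exp(-1/s)\<close>, extended by zero: a family that contains the standard flat function
  and in which every derivative is a linear combination of two members.
\<close>

definition flat_exp :: "nat \<Rightarrow> real \<Rightarrow> real" where
  "flat_exp k s = (if s > 0 then inverse s ^ k * exp (- inverse s) else 0)"

lemma flat_exp_derivative: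
  "(flat_exp k has_real_derivative (flat_exp (k + 2) s - real k * flat_exp (k + 1) s)) (at s)"
proof -
  consider "s > 0" | "s < 0" | "s = 0" by linarith
  then show ?thesis
  proof cases
    case 1
    have "((\<lambda>s. inverse s ^ k * exp (- inverse s)) has_real_derivative
        (flat_exp (k + 2) s - real k * flat_exp (k + 1) s)) (at s)"
    proof -
      have d1: "(inverse has_real_derivative - (inverse s ^ 2)) (at s)"
        using DERIV_inverse[of s UNIV] 1 by (simp add: numeral_2_eq_2)
      have d2: "((\<lambda>s. inverse s ^ k) has_real_derivative real k * (- (inverse s ^ 2) * inverse s ^ (k - 1))) (at s)"
        using DERIV_power[OF d1, of k] by simp
      have d3: "((\<lambda>s. exp (- inverse s)) has_real_derivative exp (- inverse s) * - (- (inverse s ^ 2))) (at s)"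
        by (rule DERIV_chain2[OF DERIV_exp DERIV_minus[OF d1]])
      have k: "real k * (inverse s ^ 2 * inverse s ^ (k - 1)) = real k * inverse s ^ (k + 1)"
        by (cases k) (simp_all add: power2_eq_square)
      have "real k * (- (inverse s ^ 2) * inverse s ^ (k - 1)) = - (real k * inverse s ^ (k + 1))"
        using k by simp
      moreover have "inverse s ^ (k + 2) = inverse s ^ k * inverse s ^ 2" by (rule power_add)
      moreover have "flat_exp (k + 2) s = inverse s ^ (k + 2) * exp (- inverse s)"
        "flat_exp (k + 1) s = inverse s ^ (k + 1) * exp (- inverse s)" using 1 by (simp_all only: flat_exp_def if_True)
      moreover have gen: "- (c * X) * E + E * - (- I) * J = J * I * E - c * (X * E)" for c X E I J :: real
        by (simp add: algebra_simps)
      ultimately have "real k * (- (inverse s ^ 2) * inverse s ^ (k - 1)) * exp (- inverse s) +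
          exp (- inverse s) * - (- (inverse s ^ 2)) * inverse s ^ k = flat_exp (k + 2) s - real k * flat_exp (k + 1) s"
        by (simp only: gen)
      then show ?thesis by (rule DERIV_cong[OF DERIV_mult[OF d2 d3]])
    qed
    moreover have "\<forall>\<^sub>F x in nhds s. inverse x ^ k * exp (- inverse x) = flat_exp k x"
      using eventually_nhds_in_open[of "{0<..}" s] 1 by (auto elim!: eventually_mono simp: flat_exp_def)
    ultimately show ?thesis using DERIV_cong_ev[OF refl _ refl] by fastforce
  next
    case 2
    have "((\<lambda>s. 0) has_real_derivative 0) (at s)" by simp
    moreover have "\<forall>\<^sub>F x in nhds s. 0 = flat_exp k x"
      using eventually_nhds_in_open[of "{..<0}" s] 2 by (auto elim!: eventually_mono simp: flat_exp_def)
    ultimately have "(flat_exp k has_real_derivative 0) (at s)"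
      using DERIV_cong_ev[OF refl _ refl] by fastforce
    then show ?thesis using 2 by (simp add: flat_exp_def)
  next
    case 3
    have "((\<lambda>x. x ^ (k + 1) / exp x) \<longlongrightarrow> 0) (at_top :: real filter)"
      by (rule tendsto_power_div_exp_0)
    then have "((\<lambda>h. inverse h ^ (k + 1) / exp (inverse h)) \<longlongrightarrow> 0) (at_right (0::real))"
      by (rule filterlim_compose[OF _ filterlim_inverse_at_top_right])
    moreover have "\<forall>\<^sub>F h in at_right (0::real). inverse h ^ (k + 1) / exp (inverse h) = (flat_exp k (0 + h) - flat_exp k 0) / h"
      by (auto simp: eventually_at_right_field flat_exp_def exp_minus divide_inverse intro!: exI[of _ 1])
    ultimately have r: "((\<lambda>h. (flat_exp k (0 + h) - flat_exp k 0) / h) \<longlongrightarrow> 0) (at_right 0)"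
      by (rule Lim_transform_eventually)
    have "\<forall>\<^sub>F h in at_left (0::real). 0 = (flat_exp k (0 + h) - flat_exp k 0) / h"
      by (auto simp: eventually_at_left_field flat_exp_def intro!: exI[of _ "-1"])
    then have "((\<lambda>h. (flat_exp k (0 + h) - flat_exp k 0) / h) \<longlongrightarrow> 0) (at_left 0)"
      by (rule Lim_transform_eventually[OF tendsto_const])
    with r have "((\<lambda>h. (flat_exp k (0 + h) - flat_exp k 0) / h) \<longlongrightarrow> 0) (at 0)"
      by (simp add: filterlim_split_at)
    then show ?thesis unfolding DERIV_def 3 by (simp add: flat_exp_def)
  qed
qed

definition quad_bump :: "nat \<Rightarrow> real \<Rightarrow> 'a::euclidean_space \<Rightarrow> 'a \<Rightarrow> real" where
  "quad_bump j r c z = flat_exp j (r\<^sup>2 - (z - c) \<bullet> (z - c))"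

text \<open>
  The derivative of \<open>flat_exp j\<close> is a combination of two functions of the same family, so an induction over all \<open>j\<close> at once
  closes.
\<close>

lemma Ck_on_quad_bump: "Ck_on k UNIV (quad_bump j r c)"
proof (induction k arbitrary: j)
  case 0
  have "continuous_on UNIV (flat_exp j)"
    by (rule DERIV_continuous_on, rule has_field_derivative_at_within, rule flat_exp_derivative)
  then show ?case unfolding quad_bump_def[abs_def] Ck_on.simps
    by (rule continuous_on_compose2) (auto intro!: continuous_intros)
next
  case (Suc k)
  have D: "(quad_bump j r c has_derivative (\<lambda>v. (quad_bump (j + 2) r c z + (- real j) * quad_bump (j + 1) r c z) * (- 2 * ((z - c) \<bullet> v)))) (at z)" for z
  proof -
    have 1: "((\<lambda>z. r\<^sup>2 - (z - c) \<bullet> (z - c)) has_derivative (\<lambda>v. - 2 * ((z - c) \<bullet> v))) (at z)"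
      by (rule derivative_eq_intros refl)+ (simp add: inner_commute)
    from has_derivative_compose[OF 1 flat_exp_derivative[unfolded has_field_derivative_def]]
    show ?thesis unfolding quad_bump_def[abs_def] by simp
  qed
  have p: "partial v (quad_bump j r c) = (\<lambda>z. (quad_bump (j + 2) r c z + (- real j) * quad_bump (j + 1) r c z) * (- 2 * ((z - c) \<bullet> v)))" for v
    by (rule ext) (rule partial_eq[OF D])
  have lin: "Ck_on k UNIV (\<lambda>z. - 2 * ((z - c) \<bullet> v))" for v
  proof (cases k)
    case 0
    then show ?thesis by (auto intro!: continuous_intros)
  next
    case (Suc k')
    have D2: "((\<lambda>z. - 2 * ((z - c) \<bullet> v)) has_derivative (\<lambda>w. - 2 * (w \<bullet> v))) (at z)" for z
      by (rule derivative_eq_intros refl)+ simp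
    have "partial w (\<lambda>z. - 2 * ((z - c) \<bullet> v)) = (\<lambda>_. - 2 * (w \<bullet> v))" for w
      by (rule ext) (rule partial_eq[OF D2])
    then show ?thesis using D2 Ck_on_const unfolding Suc by (auto simp: differentiable_def)
  qed
  have "Ck_on k UNIV (partial v (quad_bump j r c))" for v
    unfolding p by (intro Ck_on_mult Ck_on_add Ck_on_const Suc.IH lin)
  then show ?case using D by (auto simp: differentiable_def)
qed

lemma exists_test_function:
  fixes c :: "'a::euclidean_space"
  assumes "r > 0" "cball c r \<subseteq> S"
  shows "\<exists>\<phi>. test_function S \<phi> \<and> (\<forall>z. 0 \<le> \<phi> z) \<and> 0 < \<phi> c \<and> (\<forall>z. z \<notin> cball c r \<longrightarrow> \<phi> z = 0)"
proof (intro exI[of _ "quad_bump 0 r c"] conjI allI impI)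
  show out: "quad_bump 0 r c z = 0" if "z \<notin> cball c r" for z
  proof -
    have "r < norm (z - c)" using that by (simp add: dist_norm norm_minus_commute)
    then have "r\<^sup>2 < (norm (z - c))\<^sup>2" using assms(1) by (intro power_strict_mono) auto
    then show ?thesis by (simp add: quad_bump_def flat_exp_def power2_norm_eq_inner)
  qed
  show "test_function S (quad_bump 0 r c)"
    unfolding test_function_def smooth_on_def
    by (intro conjI allI impI Ck_on_quad_bump exI[of _ "cball c r"] compact_cball assms(2) out)
  show "0 \<le> quad_bump 0 r c z" for z by (simp add: quad_bump_def flat_exp_def)
  show "0 < quad_bump 0 r c c" using assms(1) by (simp add: quad_bump_def flat_exp_def)
qed

text \<open>
  The function \<open>h\<close> is arbitrary off \<open>P\<close>; its product with \<open>\<phi>\<close> vanishes there near every point.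
\<close>

lemma integration_by_parts_compact_support:
  fixes h \<phi> :: "'a::euclidean_space \<Rightarrow> real"
  assumes P: "open P" and K: "compact K" "K \<subseteq> P"
    and h: "\<And>z. z \<in> P \<Longrightarrow> ((\<lambda>s. h (z + s *\<^sub>R e)) has_real_derivative h' z) (at 0)"
      "continuous_on P h" "continuous_on P h'"
    and \<phi>: "\<And>z. ((\<lambda>s. \<phi> (z + s *\<^sub>R e)) has_real_derivative \<phi>' z) (at 0)"
      "continuous_on UNIV \<phi>" "continuous_on UNIV \<phi>'"
    and out: "\<And>z. z \<notin> K \<Longrightarrow> \<phi> z = 0" "\<And>z. z \<notin> K \<Longrightarrow> \<phi>' z = 0"
  shows "integrable lborel (\<lambda>z. h z * \<phi>' z)" "integrable lborel (\<lambda>z. h' z * \<phi> z)"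
    "(\<integral>z. h z * \<phi>' z \<partial>lborel) = - (\<integral>z. h' z * \<phi> z \<partial>lborel)"
proof -
  have Kc: "open (- K)" using K(1) compact_imp_closed by blast
  have cont: "continuous_on UNIV (\<lambda>z. f z * k z)"
    if "continuous_on P f" "continuous_on UNIV k" "\<And>z. z \<notin> K \<Longrightarrow> k z = 0" for f k :: "'a \<Rightarrow> real"
  proof -
    have "continuous_on (P \<union> - K) (\<lambda>z. f z * k z)"
    proof (rule continuous_on_open_Un[OF P Kc])
      show "continuous_on P (\<lambda>z. f z * k z)"
        by (intro continuous_on_mult that(1) continuous_on_subset[OF that(2) subset_UNIV])
      show "continuous_on (- K) (\<lambda>z. f z * k z)"
        using continuous_on_const[of "- K" "0::real"] by (rule continuous_on_eq) (simp add: that(3))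
    qed
    moreover have "P \<union> - K = UNIV" using K(2) by blast
    ultimately show ?thesis by simp
  qed
  have int: "integrable lborel f" if "continuous_on UNIV f" "\<And>z. z \<notin> K \<Longrightarrow> f z = 0" for f :: "'a \<Rightarrow> real"
  proof -
    have "integrable lborel (\<lambda>z. indicator K z *\<^sub>R f z)"
      by (rule borel_integrable_compact[OF K(1) continuous_on_subset[OF that(1) subset_UNIV]])
    also have "(\<lambda>z. indicator K z *\<^sub>R f z) = f"
    proof
      fix z show "indicator K z *\<^sub>R f z = f z" by (cases "z \<in> K") (simp_all add: that(2))
    qed
    finally show ?thesis .
  qed
  have c1: "continuous_on UNIV (\<lambda>z. h z * \<phi>' z)" by (rule cont[OF h(2) \<phi>(3)]) (rule out(2))
  have c2: "continuous_on UNIV (\<lambda>z. h' z * \<phi> z)" by (rule cont[OF h(3) \<phi>(2)]) (rule out(1))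
  have c3: "continuous_on UNIV (\<lambda>z. h z * \<phi> z)" by (rule cont[OF h(2) \<phi>(2)]) (rule out(1))
  show i1: "integrable lborel (\<lambda>z. h z * \<phi>' z)" by (rule int[OF c1]) (simp add: out)
  show i2: "integrable lborel (\<lambda>z. h' z * \<phi> z)" by (rule int[OF c2]) (simp add: out)
  have "(\<integral>z. h z * \<phi>' z + h' z * \<phi> z \<partial>lborel) = 0"
  proof (rule integral_directional_derivative_zero(2)[OF _ _ K(1) _ _ c3])
    show "continuous_on UNIV (\<lambda>z. h z * \<phi>' z + h' z * \<phi> z)" by (intro continuous_on_add c1 c2)
    show "((\<lambda>s. h (z + s *\<^sub>R e) * \<phi> (z + s *\<^sub>R e)) has_real_derivative h z * \<phi>' z + h' z * \<phi> z) (at 0)" for z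
    proof (cases "z \<in> P")
      case True
      show ?thesis by (rule DERIV_cong[OF DERIV_mult[OF h(1)[OF True] \<phi>(1)]]) (simp add: mult.commute)
    next
      case False
      then have zK: "z \<in> - K" using K(2) by blast
      have "open ((\<lambda>s. z + s *\<^sub>R e) -` (- K))" by (rule open_vimage[OF Kc]) (intro continuous_intros)
      then have "\<forall>\<^sub>F s in nhds 0. s \<in> (\<lambda>s. z + s *\<^sub>R e) -` (- K)" by (rule eventually_nhds_in_open) (use zK in simp)
      then have "\<forall>\<^sub>F s in nhds 0. 0 = h (z + s *\<^sub>R e) * \<phi> (z + s *\<^sub>R e)"
        by (rule eventually_mono) (simp add: out)
      then have "((\<lambda>s. h (z + s *\<^sub>R e) * \<phi> (z + s *\<^sub>R e)) has_real_derivative 0) (at 0)"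
        using DERIV_cong_ev[OF refl, of "\<lambda>s. 0" "\<lambda>s. h (z + s *\<^sub>R e) * \<phi> (z + s *\<^sub>R e)" 0 0 0] by simp
      then show ?thesis using zK by (simp add: out)
    qed
  qed (simp_all add: out)
  then show "(\<integral>z. h z * \<phi>' z \<partial>lborel) = - (\<integral>z. h' z * \<phi> z \<partial>lborel)"
    unfolding Bochner_Integration.integral_add[OF i1 i2] by linarith
qed

section \<open>Weak solutions are classical before extinction\<close>

lemma partial_zero_on_open:
  assumes "open W" "z \<in> W" "\<And>w. w \<in> W \<Longrightarrow> f w = 0"
  shows "partial v f z = 0"
proof -
  have "((\<lambda>_. 0) has_derivative (\<lambda>_. 0)) (at z)" by (rule has_derivative_const)
  then have "(f has_derivative (\<lambda>_. 0)) (at z)"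
    by (rule has_derivative_transform_within_open[OF _ assms(1,2)]) (simp add: assms(3))
  then show ?thesis by (rule partial_eq)
qed

lemma fde_Phi_derivative:
  assumes "r > 0"
  shows "(fde_Phi m has_real_derivative r powr (m - 1)) (at r)"
proof (cases "m = 0")
  case True
  then have "fde_Phi m = ln" by (simp add: fde_Phi_def fun_eq_iff)
  moreover have "r powr (m - 1) = 1 / r" using True assms by (simp add: powr_minus_divide)
  ultimately show ?thesis using DERIV_ln_divide[OF assms] by simp
next
  case False
  then have "fde_Phi m = (\<lambda>r. r powr m / m)" by (simp add: fde_Phi_def fun_eq_iff)
  then show ?thesis using DERIV_cdivide[OF has_real_derivative_powr[OF assms, of m], of m] False by simp
qed

lemma smooth_onD:
  assumes "smooth_on S f"
  shows "z \<in> S \<Longrightarrow> f differentiable (at z)" "continuous_on S f" "continuous_on S (partial v f)"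
    "z \<in> S \<Longrightarrow> partial v f differentiable (at z)" "continuous_on S (partial w (partial v f))"
proof -
  have 0: "Ck_on 0 S f" and 1: "Ck_on (Suc 0) S f" and 2: "Ck_on (Suc (Suc 0)) S f"
    using assms unfolding smooth_on_def by blast+
  show "z \<in> S \<Longrightarrow> f differentiable (at z)" using 1 by simp
  show "continuous_on S f" using 0 by simp
  show "continuous_on S (partial v f)" using 1 by simp
  show "z \<in> S \<Longrightarrow> partial v f differentiable (at z)" using 2 by simp
  show "continuous_on S (partial w (partial v f))" using 2 by simp
qed

lemma open_cylinder:
  assumes "open \<Omega>"
  shows "open (cylinder T \<Omega>)"
proof -
  have "cylinder T \<Omega> = ({0<..} \<inter> ereal -` {..<T}) \<times> \<Omega>" by (auto simp: cylinder_def)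
  moreover have "open (ereal -` {..<T})" by (rule open_vimage) (auto intro!: continuous_intros)
  ultimately show ?thesis using assms by (auto intro!: open_Times)
qed

text \<open>
  Differentiability at a point of the positivity set refers to a full neighbourhood of that point in space-time, so
  positivity propagates to a neighbourhood.
\<close>

lemma open_positivity_set:
  assumes "open \<Omega>" and smooth: "smooth_on {(t, x) \<in> cylinder T \<Omega>. u t x > 0} (\<lambda>(t, x). u t x)"
  shows "open {(t, x) \<in> cylinder T \<Omega>. u t x > 0}"
proof (subst open_subopen, rule ballI)
  fix z assume z: "z \<in> {(t, x) \<in> cylinder T \<Omega>. u t x > 0}"
  have "isCont (\<lambda>(t, x). u t x) z"
    using smooth_onD(1)[OF smooth z] by (rule differentiable_imp_continuous_within)
  then have "((\<lambda>(t, x). u t x) \<longlongrightarrow> (case z of (t, x) \<Rightarrow> u t x)) (nhds z)"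
    by (simp add: continuous_at tendsto_at_iff_tendsto_nhds)
  moreover have "(case z of (t, x) \<Rightarrow> u t x) > 0" using z by auto
  ultimately have "\<forall>\<^sub>F w in nhds z. (case w of (t, x) \<Rightarrow> u t x) > 0"
    by (rule order_tendstoD(1))
  moreover have "\<forall>\<^sub>F w in nhds z. w \<in> cylinder T \<Omega>"
    by (rule eventually_nhds_in_open[OF open_cylinder[OF assms(1)]]) (use z in auto)
  ultimately have "\<forall>\<^sub>F w in nhds z. w \<in> {(t, x) \<in> cylinder T \<Omega>. u t x > 0}"
    by eventually_elim auto
  then show "\<exists>W. open W \<and> z \<in> W \<and> W \<subseteq> {(t, x) \<in> cylinder T \<Omega>. u t x > 0}"
    unfolding eventually_nhds by blast
qed

text \<open>
  If the defect \<open>E\<close> of the equation were nonzero at \<open>z0\<close>, it would have a sign on a ball around \<open>z0\<close>. Moving all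
  derivatives off a nonnegative test function supported in that ball shows that the integral of \<open>E\<close> against it vanishes.
\<close>

lemma weak_equation_pointwise:
  fixes u :: "real \<Rightarrow> real^'n::finite \<Rightarrow> real"
  assumes \<Omega>: "open \<Omega>" and weak: "fde_weak_equation m T \<Omega> u"
    and smooth: "smooth_on {(t, x) \<in> cylinder T \<Omega>. u t x > 0} (\<lambda>(t, x). u t x)"
  defines "P \<equiv> {(t, x) \<in> cylinder T \<Omega>. u t x > 0}"
    and "f \<equiv> \<lambda>(t, x). u t x"
    and "ax \<equiv> \<lambda>i. (0 :: real, axis i (1::real))"
  assumes z0: "z0 \<in> P"
  shows "partial (1, 0) f z0 = f z0 powr (m - 1) * (\<Sum>i\<in>UNIV. partial (ax i) (partial (ax i) f) z0) +
      (m - 1) * f z0 powr (m - 2) * (\<Sum>i\<in>UNIV. (partial (ax i) f z0)\<^sup>2)"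
proof -
  have sm: "smooth_on P f" unfolding P_def f_def by (rule smooth)
  note D = smooth_onD[OF sm]
  have Po: "open P" unfolding P_def by (rule open_positivity_set[OF \<Omega> smooth])
  have fpos: "f z > 0" if "z \<in> P" for z using that by (auto simp: P_def f_def)
  define N where "N i z = f z powr (m - 1) * partial (ax i) (partial (ax i) f) z +
      (m - 1) * f z powr (m - 2) * (partial (ax i) f z)\<^sup>2" for i z
  define E where "E z = partial (1, 0) f z - (\<Sum>i\<in>UNIV. N i z)" for z
  have cpow: "continuous_on P (\<lambda>z. f z powr a)" for a
    by (intro continuous_on_powr D(2) continuous_on_const ballI) (use fpos in force)
  have cN: "continuous_on P (N i)" for i
    unfolding N_def[abs_def]
    by (intro continuous_on_add continuous_on_mult continuous_on_power continuous_on_const cpow D(3) D(5))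
  have cE: "continuous_on P E"
    unfolding E_def[abs_def] by (intro continuous_on_diff continuous_on_sum cN D(3))
  have "E z0 = 0"
  proof (rule ccontr)
    assume E0: "E z0 \<noteq> 0"
    define sg where "sg = sgn (E z0)"
    have sgE: "sg * E z0 = \<bar>E z0\<bar>" by (simp add: sg_def abs_sgn mult.commute)
    define W where "W = P \<inter> (\<lambda>z. sg * E z) -` {\<bar>E z0\<bar> / 2<..}"
    have "open W" unfolding W_def
      by (rule continuous_open_preimage[OF _ Po]) (auto intro!: continuous_on_mult cE)
    moreover have "z0 \<in> W" using z0 E0 sgE by (simp add: W_def)
    ultimately obtain r where r: "r > 0" "cball z0 r \<subseteq> W" using open_contains_cball by blast
    define K where "K = cball z0 r"
    have K: "compact K" "K \<subseteq> P" using r by (auto simp: K_def W_def)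
    obtain \<phi> where \<phi>: "test_function P \<phi>" "\<And>z. 0 \<le> \<phi> z" "0 < \<phi> z0" "\<And>z. z \<notin> K \<Longrightarrow> \<phi> z = 0"
      using exists_test_function[OF r(1), of z0 P] K(2) unfolding K_def by blast
    have s\<phi>: "smooth_on UNIV \<phi>" using \<phi>(1) by (simp add: test_function_def)
    note D\<phi> = smooth_onD[OF s\<phi>]
    have Kc: "open (- K)" by (simp add: K_def open_Compl)
    have out1: "partial v \<phi> z = 0" if "z \<notin> K" for v z
      by (rule partial_zero_on_open[OF Kc]) (use that \<phi>(4) in auto)
    have out2: "partial w (partial v \<phi>) z = 0" if "z \<notin> K" for v w z
      by (rule partial_zero_on_open[OF Kc]) (use that out1 in auto)
    have dir: "((\<lambda>s. f (z + s *\<^sub>R e)) has_real_derivative partial e f z) (at 0)" if "z \<in> P" for z e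
      by (rule partial_direction[OF D(1)[OF that]])
    have dir\<phi>: "((\<lambda>s. \<phi> (z + s *\<^sub>R e)) has_real_derivative partial e \<phi> z) (at 0)" for z e
      by (rule partial_direction[OF D\<phi>(1)]) simp
    have dir\<phi>2: "((\<lambda>s. partial v \<phi> (z + s *\<^sub>R e)) has_real_derivative partial e (partial v \<phi>) z) (at 0)" for z e v
      by (rule partial_direction[OF D\<phi>(4)]) simp
    note time = integration_by_parts_compact_support[OF Po K dir[where e = "(1, 0)"] D(2) D(3)[where v = "(1, 0)"]
        dir\<phi>[where e = "(1, 0)"] D\<phi>(2) D\<phi>(3)[where v = "(1, 0)"] \<phi>(4) out1[where v = "(1, 0)"]]
    have dPhi: "((\<lambda>s. fde_Phi m (f (z + s *\<^sub>R e))) has_real_derivative f z powr (m - 1) * partial e f z) (at 0)"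
      if "z \<in> P" for z e
      using DERIV_chain2[OF _ dir[OF that], of "fde_Phi m" "f z powr (m - 1)"] fde_Phi_derivative[OF fpos[OF that]] by simp
    have cPhi: "continuous_on P (\<lambda>z. fde_Phi m (f z))"
    proof (rule continuous_on_compose2[OF _ D(2)])
      show "continuous_on {0<..} (fde_Phi m)"
        by (rule DERIV_continuous_on, rule has_field_derivative_at_within, rule fde_Phi_derivative) simp
    qed (use fpos in auto)
    have cflux: "continuous_on P (\<lambda>z. f z powr (m - 1) * partial e f z)" for e
      by (intro continuous_on_mult cpow D(3))
    have dflux: "((\<lambda>s. f (z + s *\<^sub>R ax i) powr (m - 1) * partial (ax i) f (z + s *\<^sub>R ax i)) has_real_derivative N i z) (at 0)"
      if "z \<in> P" for z i
    proof -
      have 1: "((\<lambda>s. f (z + s *\<^sub>R ax i) powr (m - 1)) has_real_derivative (m - 1) * f z powr (m - 1 - 1) * partial (ax i) f z) (at 0)"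
        using DERIV_chain2[OF _ dir[OF that], of "\<lambda>r. r powr (m - 1)" "(m - 1) * f z powr (m - 1 - 1)"]
          has_real_derivative_powr[OF fpos[OF that], of "m - 1"] by simp
      have 2: "((\<lambda>s. partial (ax i) f (z + s *\<^sub>R ax i)) has_real_derivative partial (ax i) (partial (ax i) f) z) (at 0)"
        by (rule partial_direction[OF D(4)[OF that]])
      show ?thesis
        by (rule DERIV_cong[OF DERIV_mult[OF 1 2]]) (simp add: N_def power2_eq_square algebra_simps)
    qed
    have space: "integrable lborel (\<lambda>z. fde_Phi m (f z) * partial (ax i) (partial (ax i) \<phi>) z)"
      "integrable lborel (\<lambda>z. N i z * \<phi> z)"
      "(\<integral>z. fde_Phi m (f z) * partial (ax i) (partial (ax i) \<phi>) z \<partial>lborel) = (\<integral>z. N i z * \<phi> z \<partial>lborel)" for i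
    proof -
      note A = integration_by_parts_compact_support[OF Po K dPhi[where e = "ax i"] cPhi cflux[where e = "ax i"]
          dir\<phi>2[where e = "ax i" and v = "ax i"] D\<phi>(3)[where v = "ax i"] D\<phi>(5)[where v = "ax i" and w = "ax i"]
          out1[where v = "ax i"] out2[where v = "ax i" and w = "ax i"]]
      note B = integration_by_parts_compact_support[OF Po K dflux[where i = i] cflux[where e = "ax i"] cN[where i = i]
          dir\<phi>[where e = "ax i"] D\<phi>(2) D\<phi>(3)[where v = "ax i"] \<phi>(4) out1[where v = "ax i"]]
      show "integrable lborel (\<lambda>z. fde_Phi m (f z) * partial (ax i) (partial (ax i) \<phi>) z)" by (rule A(1))
      show "integrable lborel (\<lambda>z. N i z * \<phi> z)" by (rule B(2))
      show "(\<integral>z. fde_Phi m (f z) * partial (ax i) (partial (ax i) \<phi>) z \<partial>lborel) = (\<integral>z. N i z * \<phi> z \<partial>lborel)"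
        using A(3) B(3) by simp
    qed
    have "P \<subseteq> fde_region m T \<Omega> u" by (auto simp: P_def fde_region_def)
    then have "test_function (fde_region m T \<Omega> u) \<phi>" using \<phi>(1) unfolding test_function_def by (meson order_trans)
    then have w: "(LINT z|lebesgue. (case z of (t, x) \<Rightarrow> u t x * dt \<phi> (t, x) + fde_Phi m (u t x) * laplace_x \<phi> (t, x))) = 0"
      using weak unfolding fde_weak_equation_def by blast
    have eq: "(\<lambda>z. (case z of (t, x) \<Rightarrow> u t x * dt \<phi> (t, x) + fde_Phi m (u t x) * laplace_x \<phi> (t, x))) =
        (\<lambda>z. f z * partial (1, 0) \<phi> z + (\<Sum>i\<in>UNIV. fde_Phi m (f z) * partial (ax i) (partial (ax i) \<phi>) z))"
      by (rule ext) (simp add: f_def dt_def laplace_x_def ax_def sum_distrib_left split: prod.split)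
    have int: "integrable lborel (\<lambda>z. f z * partial (1, 0) \<phi> z + (\<Sum>i\<in>UNIV. fde_Phi m (f z) * partial (ax i) (partial (ax i) \<phi>) z))"
      by (intro Bochner_Integration.integrable_add Bochner_Integration.integrable_sum space(1) time(1))
    have "0 = (\<integral>z. f z * partial (1, 0) \<phi> z + (\<Sum>i\<in>UNIV. fde_Phi m (f z) * partial (ax i) (partial (ax i) \<phi>) z) \<partial>lborel)"
      using w unfolding eq integral_completion[OF borel_measurable_integrable[OF int]] by simp
    also have "\<dots> = (\<integral>z. f z * partial (1, 0) \<phi> z \<partial>lborel) + (\<Sum>i\<in>UNIV. \<integral>z. fde_Phi m (f z) * partial (ax i) (partial (ax i) \<phi>) z \<partial>lborel)"
      by (subst Bochner_Integration.integral_add[OF time(1)])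
        (simp_all add: Bochner_Integration.integral_sum space(1))
    also have "\<dots> = - (\<integral>z. partial (1, 0) f z * \<phi> z \<partial>lborel) + (\<Sum>i\<in>UNIV. \<integral>z. N i z * \<phi> z \<partial>lborel)"
      using time(3) by (simp add: space(3))
    also have "\<dots> = - (\<integral>z. E z * \<phi> z \<partial>lborel)"
      using time(2) space(2) by (simp add: E_def left_diff_distrib sum_distrib_right)
    finally have zero: "(\<integral>z. E z * \<phi> z \<partial>lborel) = 0" by simp
    have intE: "integrable lborel (\<lambda>z. E z * \<phi> z)"
      using time(2) space(2) by (simp add: E_def left_diff_distrib sum_distrib_right)
    have "continuous_on UNIV \<phi>" by (rule D\<phi>(2))
    from continuous_open_preimage[OF this open_UNIV open_greaterThan, of "\<phi> z0 / 2"]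
    have "open (\<phi> -` {\<phi> z0 / 2<..})" by simp
    moreover have "z0 \<in> \<phi> -` {\<phi> z0 / 2<..}" using \<phi>(3) by simp
    ultimately obtain r2 where r2: "r2 > 0" "ball z0 r2 \<subseteq> \<phi> -` {\<phi> z0 / 2<..}" using open_contains_ball by blast
    define \<rho> where "\<rho> = min r r2"
    have \<rho>: "\<rho> > 0" using r r2 by (simp add: \<rho>_def)
    define c where "c = \<bar>E z0\<bar> / 2 * (\<phi> z0 / 2)"
    have c: "c > 0" using E0 \<phi>(3) by (simp add: c_def)
    have "c * measure lborel (ball z0 \<rho>) = (\<integral>z. c * indicator (ball z0 \<rho>) z \<partial>lborel)"
      by simp
    also have "\<dots> \<le> (\<integral>z. sg * (E z * \<phi> z) \<partial>lborel)"
    proof (rule integral_mono)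
      show "integrable lborel (\<lambda>z. c * indicator (ball z0 \<rho>) z)"
        by (intro integrable_mult_right integrable_real_indicator) (simp_all add: emeasure_ball less_imp_le[OF \<rho>])
      show "integrable lborel (\<lambda>z. sg * (E z * \<phi> z))" by (intro integrable_mult_right intE)
      fix z
      have big: "sg * E z > \<bar>E z0\<bar> / 2" if "z \<in> K" using that r(2) by (auto simp: K_def W_def)
      show "c * indicator (ball z0 \<rho>) z \<le> sg * (E z * \<phi> z)"
      proof (cases "z \<in> ball z0 \<rho>")
        case True
        then have "z \<in> K" "\<phi> z > \<phi> z0 / 2" using r2 by (auto simp: K_def \<rho>_def)
        then have "\<bar>E z0\<bar> / 2 * (\<phi> z0 / 2) \<le> (sg * E z) * \<phi> z"
          using big \<phi>(3) by (intro mult_mono) auto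
        then show ?thesis using True by (simp add: c_def mult.assoc)
      next
        case False
        have "0 \<le> (sg * E z) * \<phi> z"
        proof (cases "z \<in> K")
          case True
          then have "0 \<le> sg * E z" using big by (meson abs_ge_zero divide_nonneg_pos le_less_trans less_imp_le zero_less_numeral)
          then show ?thesis using \<phi>(2)[of z] by (rule mult_nonneg_nonneg)
        qed (simp add: \<phi>(4))
        then show ?thesis using False by (simp add: mult.assoc)
      qed
    qed
    also have "\<dots> = 0" using zero by simp
    finally have "c * measure lborel (ball z0 \<rho>) \<le> 0" .
    moreover have "measure lborel (ball z0 \<rho>) > 0" using \<rho> by (simp add: content_ball)
    ultimately show False using c by (simp add: mult_le_0_iff)
  qed
  then show ?thesis
    by (simp add: E_def N_def sum.distrib sum_distrib_left)
qed

lemma sum_Basis_axis: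
  fixes F :: "real^'n::finite \<Rightarrow> 'b::comm_monoid_add"
  shows "(\<Sum>e\<in>Basis. F e) = (\<Sum>i\<in>UNIV. F (axis i 1))"
proof -
  have B: "Basis = (\<lambda>i. axis i (1::real)) ` (UNIV :: 'n set)" by (auto simp: Basis_vec_def)
  have inj: "inj_on (\<lambda>i. axis i (1::real)) (UNIV :: 'n set)" by (auto simp: inj_on_def axis_eq_axis)
  show ?thesis unfolding B sum.reindex[OF inj] by (simp only: o_def)
qed

text \<open>
  A solution that is positive at time \<open>t\<close> was not extinct earlier, so it is smooth and positive on all of
  \<open>(0, t] \<times> \<Omega>\<close>. Its derivatives at time \<open>t\<close> itself are two-sided, because the positivity set is open.
\<close>

lemma classical_solution_until:
  fixes u :: "real \<Rightarrow> real^'n::finite \<Rightarrow> real"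
  assumes \<Omega>: "open \<Omega>" and sol: "local_weak_solution m T \<Omega> u0 u"
    and x0: "x0 \<in> \<Omega>" and t: "0 < t" "ereal t < T" and ut: "u t x0 > 0"
  shows "\<exists>ut g H. classical_fde m {0<..t} \<Omega> u ut g H"
proof -
  define P where "P = {(t, x) \<in> cylinder T \<Omega>. u t x > 0}"
  define f where "f = (\<lambda>(t, x). u t x)"
  have weak: "fde_weak_equation m T \<Omega> u" and pse: "positive_smooth_until_extinction T \<Omega> u"
    using sol by (auto simp: local_weak_solution_def)
  have sm: "smooth_on P f"
    using pse unfolding positive_smooth_until_extinction_def P_def f_def by blast
  note D = smooth_onD[OF sm]
  have sub: "(s, x) \<in> P" if s: "s \<in> {0<..t}" and x: "x \<in> \<Omega>" for s x
  proof -
    have sT: "ereal s < T" using s t(2) by (meson ereal_less_eq(3) greaterThanAtMost_iff le_less_trans)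
    have "(\<forall>x\<in>\<Omega>. u s x > 0) \<or> (\<forall>r. s \<le> r \<and> ereal r < T \<longrightarrow> (\<forall>x\<in>\<Omega>. u r x = 0))"
      using pse s sT unfolding positive_smooth_until_extinction_def by auto
    then have "u s x > 0"
    proof
      assume "\<forall>r. s \<le> r \<and> ereal r < T \<longrightarrow> (\<forall>x\<in>\<Omega>. u r x = 0)"
      then have "u t x0 = 0" using s t x0 by auto
      then show ?thesis using ut by simp
    qed (use x in blast)
    then show ?thesis using s x sT by (auto simp: P_def cylinder_def)
  qed
  define e0 where "e0 e = (0 :: real, e :: real^'n)" for e
  define vt where "vt s x = partial (1, 0) f (s, x)" for s x
  define g where "g s x = (\<Sum>e\<in>Basis. partial (e0 e) f (s, x) *\<^sub>R e)" for s x
  define H where "H s x h = (\<Sum>e\<in>Basis. partial (e0 h) (partial (e0 e) f) (s, x) *\<^sub>R e)" for s x h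
  have gi: "g s x \<bullet> e = partial (e0 e) f (s, x)" if "e \<in> Basis" for s x e
    unfolding g_def using that by (simp add: inner_sum_left inner_Basis if_distrib sum.delta cong: if_cong)
  have Hi: "H s x h \<bullet> e = partial (e0 h) (partial (e0 e) f) (s, x)" if "e \<in> Basis" for s x e h
    unfolding H_def using that by (simp add: inner_sum_left inner_Basis if_distrib sum.delta cong: if_cong)
  have slice: "((\<lambda>x. k (s, x)) has_derivative (\<lambda>h. partial (e0 h) k (s, x))) (at x)"
    if "k differentiable (at (s, x))" for k :: "real \<times> (real^'n) \<Rightarrow> real" and s x
  proof -
    have 1: "((\<lambda>x. (s, x)) has_derivative (\<lambda>h. (0, h))) (at x)"
      by (auto intro!: derivative_eq_intros)
    show ?thesis unfolding e0_def
      by (rule has_derivative_compose[OF 1 has_derivative_partial[OF that]])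
  qed
  have pt: "0 < u s x \<and> ((\<lambda>s. u s x) has_real_derivative vt s x) (at s) \<and>
      (u s has_derivative (\<lambda>h. g s x \<bullet> h)) (at x) \<and> (g s has_derivative H s x) (at x) \<and>
      vt s x = u s x powr (m - 1) * (\<Sum>e\<in>Basis. H s x e \<bullet> e) + (m - 1) * u s x powr (m - 2) * (norm (g s x))\<^sup>2"
    if s: "s \<in> {0<..t}" and x: "x \<in> \<Omega>" for s x
  proof (intro conjI)
    have sP: "(s, x) \<in> P" by (rule sub[OF s x])
    show "0 < u s x" using sP by (simp add: P_def)
    have "((\<lambda>r. f ((s, x) + r *\<^sub>R (1, 0))) has_real_derivative vt s x) (at (s - s))"
      using partial_direction[OF D(1)[OF sP], of "(1, 0)"] by (simp add: vt_def)
    moreover have "((\<lambda>r. r - s) has_real_derivative 1) (at s)" by (auto intro!: derivative_eq_intros)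
    ultimately have "((\<lambda>r. f ((s, x) + (r - s) *\<^sub>R (1, 0))) has_real_derivative vt s x * 1) (at s)"
      by (rule DERIV_chain2)
    then show "((\<lambda>s. u s x) has_real_derivative vt s x) (at s)" by (simp add: f_def)
    have du: "((\<lambda>x. f (s, x)) has_derivative (\<lambda>h. partial (e0 h) f (s, x))) (at x)"
      by (rule slice[OF D(1)[OF sP]])
    interpret L: bounded_linear "\<lambda>h. partial (e0 h) f (s, x)" using du by (rule has_derivative_bounded_linear)
    have "partial (e0 h) f (s, x) = g s x \<bullet> h" for h
    proof -
      have "partial (e0 h) f (s, x) = partial (e0 (\<Sum>e\<in>Basis. (h \<bullet> e) *\<^sub>R e)) f (s, x)"
        by (simp add: euclidean_representation)
      also have "\<dots> = (\<Sum>e\<in>Basis. (h \<bullet> e) * partial (e0 e) f (s, x))"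
        by (simp add: L.sum L.scaleR)
      also have "\<dots> = g s x \<bullet> h"
        by (simp add: g_def inner_sum_left inner_commute[of h] mult.commute)
      finally show ?thesis .
    qed
    then show "(u s has_derivative (\<lambda>h. g s x \<bullet> h)) (at x)" using du by (simp add: f_def)
    have "((\<lambda>x. \<Sum>e\<in>Basis. partial (e0 e) f (s, x) *\<^sub>R e) has_derivative
        (\<lambda>h. \<Sum>e\<in>Basis. partial (e0 h) (partial (e0 e) f) (s, x) *\<^sub>R e)) (at x)"
      by (intro has_derivative_sum has_derivative_scaleR_left slice D(4)[OF sP])
    then show "(g s has_derivative H s x) (at x)"
      by (simp add: g_def[abs_def] H_def[abs_def])
    have "(norm (g s x))\<^sup>2 = (\<Sum>e\<in>Basis. (g s x \<bullet> e)\<^sup>2)"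
      unfolding power2_norm_eq_inner by (subst euclidean_inner) (simp add: power2_eq_square)
    also have "\<dots> = (\<Sum>e\<in>Basis. (partial (e0 e) f (s, x))\<^sup>2)" by (simp add: gi)
    also have "\<dots> = (\<Sum>i\<in>UNIV. (partial (0, axis i 1) f (s, x))\<^sup>2)" by (simp add: sum_Basis_axis e0_def)
    finally have ng: "(norm (g s x))\<^sup>2 = (\<Sum>i\<in>UNIV. (partial (0, axis i 1) f (s, x))\<^sup>2)" .
    have tr: "(\<Sum>e\<in>Basis. H s x e \<bullet> e) = (\<Sum>i\<in>UNIV. partial (0, axis i 1) (partial (0, axis i 1) f) (s, x))"
      by (simp add: Hi sum_Basis_axis e0_def)
    have "partial (1, 0) f (s, x) = f (s, x) powr (m - 1) * (\<Sum>i\<in>UNIV. partial (0, axis i 1) (partial (0, axis i 1) f) (s, x)) +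
      (m - 1) * f (s, x) powr (m - 2) * (\<Sum>i\<in>UNIV. (partial (0, axis i 1) f (s, x))\<^sup>2)"
      unfolding f_def
      by (rule weak_equation_pointwise[OF \<Omega> weak sm[unfolded P_def f_def] sP[unfolded P_def]])
    then show "vt s x = u s x powr (m - 1) * (\<Sum>e\<in>Basis. H s x e \<bullet> e) + (m - 1) * u s x powr (m - 2) * (norm (g s x))\<^sup>2"
      by (simp add: vt_def tr ng f_def)
  qed
  have PS: "{0<..t} \<times> \<Omega> \<subseteq> P" using sub by auto
  have c1: "continuous_on ({0<..t} \<times> \<Omega>) (\<lambda>(s, x). k (s, x))" if "continuous_on P k" for k :: "real \<times> (real^'n) \<Rightarrow> real"
    using continuous_on_subset[OF that PS] by simp
  have "continuous_on ({0<..t} \<times> \<Omega>) (\<lambda>(s, x). u s x)" using c1[OF D(2)] by (simp add: f_def)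
  moreover have "continuous_on ({0<..t} \<times> \<Omega>) (\<lambda>(s, x). vt s x)" using c1[OF D(3)] by (simp add: vt_def)
  moreover have "continuous_on ({0<..t} \<times> \<Omega>) (\<lambda>(s, x). g s x)"
  proof -
    have "continuous_on ({0<..t} \<times> \<Omega>) (\<lambda>z. \<Sum>e\<in>Basis. partial (e0 e) f z *\<^sub>R e)"
      by (intro continuous_on_sum continuous_on_scaleR continuous_on_subset[OF D(3) PS] continuous_on_const)
    then show ?thesis by (simp add: g_def case_prod_unfold)
  qed
  moreover have "continuous_on ({0<..t} \<times> \<Omega>) (\<lambda>(s, x). H s x e \<bullet> e)" if "e \<in> Basis" for e
    unfolding Hi[OF that] by (rule c1[OF D(5)])
  ultimately have "classical_fde m {0<..t} \<Omega> u vt g H" unfolding classical_fde_def using pt by blast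
  then show ?thesis by blast
qed

section \<open>Dilations and the local smoothing estimate\<close>

lemma lebesgue_dilation:
  fixes c :: "'a::euclidean_space"
  assumes l: "l > 0"
  shows "lebesgue = density (distr lebesgue lebesgue (\<lambda>x. c + l *\<^sub>R x)) (\<lambda>_. ennreal (l ^ DIM('a)))"
    and "(\<lambda>x. c + l *\<^sub>R x) \<in> lebesgue \<rightarrow>\<^sub>M lebesgue"
proof -
  have eq: "(\<lambda>x. c + (\<Sum>j\<in>Basis. (l * (x \<bullet> j)) *\<^sub>R j)) = (\<lambda>x. c + l *\<^sub>R x)"
    by (rule ext) (simp only: scaleR_scaleR[symmetric] scaleR_sum_right[symmetric] euclidean_representation)
  have pr: "(\<Prod>j\<in>(Basis::'a set). \<bar>l\<bar>) = l ^ DIM('a)" using l by simp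
  show "lebesgue = density (distr lebesgue lebesgue (\<lambda>x. c + l *\<^sub>R x)) (\<lambda>_. ennreal (l ^ DIM('a)))"
    using lebesgue_affine_euclidean[of "\<lambda>_. l" c] l unfolding eq pr by simp
  show "(\<lambda>x. c + l *\<^sub>R x) \<in> lebesgue \<rightarrow>\<^sub>M lebesgue"
    using lebesgue_affine_measurable[of "\<lambda>_. l" c] l unfolding eq by simp
qed

lemma nn_integral_dilation:
  fixes f :: "'a::euclidean_space \<Rightarrow> ennreal"
  assumes l: "l > 0" and f: "f \<in> borel_measurable lebesgue"
  shows "(\<integral>\<^sup>+x. f x \<partial>lebesgue) = ennreal (l ^ DIM('a)) * (\<integral>\<^sup>+x. f (c + l *\<^sub>R x) \<partial>lebesgue)"
proof -
  let ?D = "distr lebesgue lebesgue (\<lambda>x. c + l *\<^sub>R x)"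
  have f': "f \<in> borel_measurable ?D" using f by simp
  have "(\<integral>\<^sup>+x. f x \<partial>lebesgue) = (\<integral>\<^sup>+x. f x \<partial>density ?D (\<lambda>_. ennreal (l ^ DIM('a))))"
    using lebesgue_dilation(1)[OF l, of c] by simp
  also have "\<dots> = (\<integral>\<^sup>+x. ennreal (l ^ DIM('a)) * f x \<partial>?D)"
    by (subst nn_integral_density) (use f' in auto)
  also have "\<dots> = ennreal (l ^ DIM('a)) * (\<integral>\<^sup>+x. f x \<partial>?D)"
    by (rule nn_integral_cmult[OF f'])
  also have "(\<integral>\<^sup>+x. f x \<partial>?D) = (\<integral>\<^sup>+x. f (c + l *\<^sub>R x) \<partial>lebesgue)"
    by (rule nn_integral_distr[OF lebesgue_dilation(2)[OF l] f'])
  finally show ?thesis .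
qed

lemma integral_dilation:
  fixes f :: "'a::euclidean_space \<Rightarrow> real"
  assumes l: "l > 0" and f: "f \<in> borel_measurable lebesgue"
  shows "integrable lebesgue f \<longleftrightarrow> integrable lebesgue (\<lambda>x. f (c + l *\<^sub>R x))"
    and "(\<integral>x. f x \<partial>lebesgue) = l ^ DIM('a) * (\<integral>x. f (c + l *\<^sub>R x) \<partial>lebesgue)"
proof -
  let ?D = "distr lebesgue lebesgue (\<lambda>x. c + l *\<^sub>R x)"
  have f': "f \<in> borel_measurable ?D" using f by simp
  have "integrable lebesgue f \<longleftrightarrow> integrable (density ?D (\<lambda>_. ennreal (l ^ DIM('a)))) f"
    using lebesgue_dilation(1)[OF l, of c] by simp
  also have "\<dots> \<longleftrightarrow> integrable ?D (\<lambda>x. l ^ DIM('a) *\<^sub>R f x)"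
    by (rule integrable_density[OF f']) (use l in auto)
  also have "\<dots> \<longleftrightarrow> integrable ?D f" using l by simp
  also have "\<dots> \<longleftrightarrow> integrable lebesgue (\<lambda>x. f (c + l *\<^sub>R x))"
    by (rule integrable_distr_eq[OF lebesgue_dilation(2)[OF l] f])
  finally show "integrable lebesgue f \<longleftrightarrow> integrable lebesgue (\<lambda>x. f (c + l *\<^sub>R x))" .
  have "(\<integral>x. f x \<partial>lebesgue) = (\<integral>x. f x \<partial>density ?D (\<lambda>_. ennreal (l ^ DIM('a))))"
    using lebesgue_dilation(1)[OF l, of c] by simp
  also have "\<dots> = (\<integral>x. l ^ DIM('a) *\<^sub>R f x \<partial>?D)"
    by (rule integral_density[OF f']) (use l in auto)
  also have "\<dots> = l ^ DIM('a) * (\<integral>x. f x \<partial>?D)" by simp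
  also have "(\<integral>x. f x \<partial>?D) = (\<integral>x. f (c + l *\<^sub>R x) \<partial>lebesgue)"
    by (rule integral_distr[OF lebesgue_dilation(2)[OF l] f])
  finally show "(\<integral>x. f x \<partial>lebesgue) = l ^ DIM('a) * (\<integral>x. f (c + l *\<^sub>R x) \<partial>lebesgue)" .
qed

lemma indicator_cball_dilation:
  fixes c x :: "'a::real_normed_vector"
  assumes "l > 0"
  shows "indicator (cball c l) (c + l *\<^sub>R x) = indicator (cball 0 1) x"
    and "indicator (ball c l) (c + l *\<^sub>R x) = indicator (ball 0 1) x"
proof -
  have "dist c (c + l *\<^sub>R x) = l * dist 0 x" using assms unfolding dist_norm by simp
  then show "indicator (cball c l) (c + l *\<^sub>R x) = indicator (cball 0 1) x"
    and "indicator (ball c l) (c + l *\<^sub>R x) = indicator (ball 0 1) x"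
    using assms by (simp_all add: indicator_def mult_le_cancel_left1 mult_less_cancel_left1)
qed

text \<open>
  The reduction to unit scale with \<open>A = (R\<^sup>2/t)\<^bsup>1/(1-m)\<^esup>\<close>, the amplitude for which time \<open>t\<close> and radius \<open>R\<close> both become \<open>1\<close>.
  The last hypothesis says that the rescaled mass is at most \<open>1\<close>.
\<close>

lemma bound_at_radius:
  fixes u :: "real \<Rightarrow> real^'n::finite \<Rightarrow> real"
  assumes m: "m < 1"
    and \<Omega>: "open \<Omega>" and sol: "local_weak_solution m T \<Omega> u0 u"
    and x0: "x0 \<in> \<Omega>" and t: "0 < t" "ereal t < T" and ut: "u t x0 > 0"
    and R: "R > 0" "cball x0 R \<subseteq> \<Omega>"
    and C: "\<forall>(u :: real \<Rightarrow> real^'n \<Rightarrow> real) u0. unit_data m p u u0 \<longrightarrow> u 1 0 \<le> C"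
    and mass: "(\<integral>\<^sup>+x\<in>ball x0 R. ennreal (\<bar>u0 x\<bar> powr p) \<partial>lebesgue) \<le> ennreal M" "M \<ge> 0"
      "(R\<^sup>2 / t) powr (p / (1 - m)) * M \<le> R ^ CARD('n)"
  shows "u t x0 \<le> C * (t / R\<^sup>2) powr (1 / (1 - m))"
proof -
  define A where "A = (R\<^sup>2 / t) powr (1 / (1 - m))"
  have A: "A > 0" using R t by (simp add: A_def)
  have D: "DIM(real^'n) = CARD('n)" by simp
  obtain vt g H where cl: "classical_fde m {0<..t} \<Omega> u vt g H"
    using classical_solution_until[OF \<Omega> sol x0 t ut] by blast
  have scale: "A * t = A powr m * R\<^sup>2"
  proof -
    have "A powr (1 - m) = R\<^sup>2 / t" using m R t by (simp add: A_def powr_powr)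
    then have "A powr (1 - m) * A powr m * t = R\<^sup>2 / t * A powr m * t" by simp
    then show ?thesis using A t by (simp add: powr_add[symmetric] mult.commute)
  qed
  define S where "S = (\<lambda>x. x0 + R *\<^sub>R x) -` \<Omega>"
  have So: "open S" unfolding S_def by (rule open_vimage[OF \<Omega>]) (intro continuous_intros)
  have Sc: "cball 0 1 \<subseteq> S"
  proof
    fix x :: "real^'n" assume "x \<in> cball 0 1"
    then have "norm (R *\<^sub>R x) \<le> R * 1" using R by (simp add: mult_left_le)
    then have "x0 + R *\<^sub>R x \<in> cball x0 R" by (simp add: dist_norm)
    then show "x \<in> S" using R by (auto simp: S_def)
  qed
  define U where "U s x = A * u (0 + t * s) (x0 + R *\<^sub>R x)" for s x
  define U0 where "U0 x = A * u0 (x0 + R *\<^sub>R x)" for x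
  have clU: "classical_fde m {0<..1} S U (\<lambda>s x. A * t * vt (0 + t * s) (x0 + R *\<^sub>R x))
     (\<lambda>s x. (A * R) *\<^sub>R g (0 + t * s) (x0 + R *\<^sub>R x))
     (\<lambda>s x h. (A * R\<^sup>2) *\<^sub>R H (0 + t * s) (x0 + R *\<^sub>R x) h)"
    unfolding U_def[abs_def]
    by (rule classical_fde_rescale[OF cl A R(1) scale]) (use t in \<open>auto simp: S_def mult_left_le\<close>)
  let ?K = "cball x0 R"
  have K: "compact ?K" by simp
  have Kmeas: "(\<lambda>x. indicator ?K x *\<^sub>R v x) \<in> borel_measurable lebesgue"
    and Kint: "integrable lebesgue (\<lambda>x. indicator ?K x *\<^sub>R \<bar>v x\<bar>)" if "Lp_loc 1 \<Omega> v" for v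
  proof -
    have "set_borel_measurable lebesgue ?K v" "set_integrable lebesgue ?K (\<lambda>x. \<bar>v x\<bar> powr 1)"
      using that K R(2) unfolding Lp_loc_def by blast+
    then show "(\<lambda>x. indicator ?K x *\<^sub>R v x) \<in> borel_measurable lebesgue"
      "integrable lebesgue (\<lambda>x. indicator ?K x *\<^sub>R \<bar>v x\<bar>)"
      unfolding set_borel_measurable_def set_integrable_def by simp_all
  qed
  have u0L: "Lp_loc 1 \<Omega> u0" and uL: "\<And>s. 0 < s \<Longrightarrow> ereal s < T \<Longrightarrow> Lp_loc 1 \<Omega> (u s)"
    and lim: "tendsto_L1_loc \<Omega> u u0 (at_right 0)"
    using sol unfolding local_weak_solution_def by blast+
  have u0int: "integrable lebesgue (\<lambda>x. indicator ?K x *\<^sub>R u0 x)"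
  proof (rule Bochner_Integration.integrable_bound[OF Kint[OF u0L] Kmeas[OF u0L]])
    show "AE x in lebesgue. norm (indicator ?K x *\<^sub>R u0 x) \<le> norm (indicator ?K x *\<^sub>R \<bar>u0 x\<bar>)"
      by (rule AE_I2) (simp add: indicator_def)
  qed
  have U0int: "set_integrable lebesgue (cball 0 1) U0"
  proof -
    have "integrable lebesgue (\<lambda>x. indicator ?K (x0 + R *\<^sub>R x) *\<^sub>R u0 (x0 + R *\<^sub>R x))"
      using integral_dilation(1)[OF R(1) Kmeas[OF u0L], of x0] u0int by blast
    then have "integrable lebesgue (\<lambda>x. A * (indicator (cball 0 1) x *\<^sub>R u0 (x0 + R *\<^sub>R x)))"
      unfolding indicator_cball_dilation[OF R(1)] by (rule integrable_mult_right)
    then show ?thesis unfolding set_integrable_def U0_def by (simp add: mult.left_commute)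
  qed
  have Ulim: "((\<lambda>s. LINT x:cball 0 1|lebesgue. \<bar>U s x - U0 x\<bar>) \<longlongrightarrow> 0) (at_right 0)"
  proof -
    define I where "I s = (LINT x:?K|lebesgue. \<bar>u s x - u0 x\<bar>)" for s
    have "(I \<longlongrightarrow> 0) (at_right 0)"
      using lim K R(2) unfolding tendsto_L1_loc_def I_def[abs_def] by blast
    moreover have "filterlim (\<lambda>s. t * s) (at_right 0) (at_right 0)"
      unfolding filterlim_at
    proof
      show "\<forall>\<^sub>F s in at_right 0. t * s \<in> {0<..} \<and> t * s \<noteq> 0"
        using t by (auto simp: eventually_at_right_field intro!: exI[of _ 1])
      have "((\<lambda>s. t * s) \<longlongrightarrow> t * 0) (at_right 0)" by (intro tendsto_intros)
      then show "((\<lambda>s. t * s) \<longlongrightarrow> 0) (at_right 0)" by simp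
    qed
    ultimately have "((\<lambda>s. I (t * s)) \<longlongrightarrow> 0) (at_right 0)" by (rule filterlim_compose)
    then have "((\<lambda>s. A / R ^ CARD('n) * I (t * s)) \<longlongrightarrow> A / R ^ CARD('n) * 0) (at_right 0)"
      by (intro tendsto_intros)
    then have lim0: "((\<lambda>s. A / R ^ CARD('n) * I (t * s)) \<longlongrightarrow> 0) (at_right 0)" by simp
    have "\<forall>\<^sub>F s in at_right 0. 0 < s \<and> s < (1::real)"
      by (auto simp: eventually_at_right_field intro!: exI[of _ 1])
    then have "\<forall>\<^sub>F s in at_right 0. A / R ^ CARD('n) * I (t * s) = (LINT x:cball 0 1|lebesgue. \<bar>U s x - U0 x\<bar>)"
    proof (rule eventually_mono)
      fix s :: real assume s: "0 < s \<and> s < 1"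
      have ts: "0 < t * s" "t * s < t" using s t by auto
      then have "ereal (t * s) < T" using t(2) by (meson ereal_less(2) less_ereal.simps(1) less_trans)
      then have L: "Lp_loc 1 \<Omega> (u (t * s))" using uL ts by blast
      have "(\<lambda>x. \<bar>indicator ?K x *\<^sub>R u (t * s) x - indicator ?K x *\<^sub>R u0 x\<bar>) \<in> borel_measurable lebesgue"
        using Kmeas[OF L] Kmeas[OF u0L] by (intro borel_measurable_abs borel_measurable_diff)
      also have "(\<lambda>x. \<bar>indicator ?K x *\<^sub>R u (t * s) x - indicator ?K x *\<^sub>R u0 x\<bar>) = (\<lambda>x. indicator ?K x *\<^sub>R \<bar>u (t * s) x - u0 x\<bar>)"
        by (rule ext) (simp add: indicator_def)
      finally have meas: "(\<lambda>x. indicator ?K x *\<^sub>R \<bar>u (t * s) x - u0 x\<bar>) \<in> borel_measurable lebesgue" .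
      have "I (t * s) = R ^ CARD('n) * (\<integral>x. indicator (cball 0 1) x *\<^sub>R \<bar>u (t * s) (x0 + R *\<^sub>R x) - u0 (x0 + R *\<^sub>R x)\<bar> \<partial>lebesgue)"
        unfolding I_def set_lebesgue_integral_def integral_dilation(2)[OF R(1) meas, of x0] indicator_cball_dilation[OF R(1)] D ..
      then have "A / R ^ CARD('n) * I (t * s) = A * (\<integral>x. indicator (cball 0 1) x *\<^sub>R \<bar>u (t * s) (x0 + R *\<^sub>R x) - u0 (x0 + R *\<^sub>R x)\<bar> \<partial>lebesgue)"
        using R(1) by simp
      also have "\<dots> = (\<integral>x. A * (indicator (cball 0 1) x *\<^sub>R \<bar>u (t * s) (x0 + R *\<^sub>R x) - u0 (x0 + R *\<^sub>R x)\<bar>) \<partial>lebesgue)"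
        by simp
      also have "\<dots> = (LINT x:cball 0 1|lebesgue. \<bar>U s x - U0 x\<bar>)"
        unfolding set_lebesgue_integral_def U_def U0_def
        using A by (intro Bochner_Integration.integral_cong) (simp_all add: right_diff_distrib[symmetric] abs_mult)
      finally show "A / R ^ CARD('n) * I (t * s) = (LINT x:cball 0 1|lebesgue. \<bar>U s x - U0 x\<bar>)" .
    qed
    with lim0 show ?thesis by (rule Lim_transform_eventually)
  qed
  have Umass: "(\<integral>\<^sup>+x\<in>ball 0 1. ennreal (\<bar>U0 x\<bar> powr p) \<partial>lebesgue) \<le> 1"
  proof -
    define F where "F x = ennreal (\<bar>u0 x\<bar> powr p) * indicator (ball x0 R) x" for x
    have "(\<lambda>x. ennreal (\<bar>indicator ?K x *\<^sub>R u0 x\<bar> powr p) * indicator (ball x0 R) x) \<in> borel_measurable lebesgue"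
      using Kmeas[OF u0L] by (intro borel_measurable_times_ennreal measurable_compose[OF _ measurable_ennreal]
          measurable_abs_powr borel_measurable_indicator) auto
    also have "(\<lambda>x. ennreal (\<bar>indicator ?K x *\<^sub>R u0 x\<bar> powr p) * indicator (ball x0 R) x) = F"
    proof
      fix x
      show "ennreal (\<bar>indicator ?K x *\<^sub>R u0 x\<bar> powr p) * indicator (ball x0 R) x = F x"
      proof (cases "x \<in> ball x0 R")
        case True
        then have "x \<in> ?K" using ball_subset_cball by blast
        then show ?thesis by (simp only: F_def indicator_simps scaleR_one)
      qed (simp add: F_def)
    qed
    finally have F: "F \<in> borel_measurable lebesgue" .
    have cg: "ennreal (\<bar>U0 x\<bar> powr p) * indicator (ball 0 1) x = ennreal (A powr p) * F (x0 + R *\<^sub>R x)" for x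
      unfolding F_def U0_def indicator_cball_dilation[OF R(1)]
      using A by (simp add: abs_mult powr_mult ennreal_mult mult.assoc)
    have FT: "(\<lambda>x. F (x0 + R *\<^sub>R x)) \<in> borel_measurable lebesgue"
      by (rule measurable_compose[OF lebesgue_dilation(2)[OF R(1)] F])
    define J where "J = (\<integral>\<^sup>+x. F (x0 + R *\<^sub>R x) \<partial>lebesgue)"
    have UJ: "(\<integral>\<^sup>+x\<in>ball 0 1. ennreal (\<bar>U0 x\<bar> powr p) \<partial>lebesgue) = ennreal (A powr p) * J"
      unfolding cg J_def by (rule nn_integral_cmult[OF FT])
    have RJ: "ennreal (R ^ CARD('n)) * J \<le> ennreal M"
      using nn_integral_dilation[OF R(1) F, of x0] mass(1) unfolding J_def F_def by simp
    have "ennreal (R ^ CARD('n)) * (ennreal (A powr p) * J) = ennreal (A powr p) * (ennreal (R ^ CARD('n)) * J)"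
      by (simp add: mult_ac)
    also have "\<dots> \<le> ennreal (A powr p) * ennreal M" using RJ by (rule mult_left_mono) simp
    also have "\<dots> = ennreal (A powr p * M)" using mass(2) by (simp add: ennreal_mult)
    also have "\<dots> \<le> ennreal (R ^ CARD('n))"
    proof (rule ennreal_leI)
      have "A powr p = (R\<^sup>2 / t) powr (p / (1 - m))" using R t by (simp add: A_def powr_powr)
      then show "A powr p * M \<le> R ^ CARD('n)" using mass(3) by simp
    qed
    finally have "ennreal (R ^ CARD('n)) * (ennreal (A powr p) * J) \<le> ennreal (R ^ CARD('n)) * 1" by simp
    then have "ennreal (A powr p) * J \<le> 1"
      using R(1) by (subst (asm) ennreal_mult_le_mult_iff) auto
    then show ?thesis by (simp only: UJ)
  qed
  have "unit_data m p U U0"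
    unfolding unit_data_def by (intro conjI classical_nearI[OF So Sc clU] U0int Ulim Umass)
  then have "U 1 0 \<le> C" by (rule C[rule_format])
  then have "A * u t x0 \<le> C" by (simp add: U_def)
  then have "u t x0 \<le> C * (1 / A)" using A by (simp add: field_simps)
  also have "1 / A = (t / R\<^sup>2) powr (1 / (1 - m))"
    using R t by (simp add: A_def powr_divide)
  finally show ?thesis .
qed

lemma ball_subset_of_frontier_distance:
  fixes \<Omega> :: "'a::euclidean_space set"
  assumes "x0 \<in> \<Omega>" "R > 0" "\<forall>y\<in>frontier \<Omega>. R \<le> dist x0 y"
  shows "ball x0 R \<subseteq> \<Omega>"
proof (rule ccontr)
  assume "\<not> ball x0 R \<subseteq> \<Omega>"
  then have "ball x0 R - \<Omega> \<noteq> {}" by blast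
  moreover have "ball x0 R \<inter> \<Omega> \<noteq> {}" using assms(1,2) centre_in_ball by blast
  ultimately have "ball x0 R \<inter> frontier \<Omega> \<noteq> {}" using connected_Int_frontier connected_ball by blast
  then show False using assms(3) by fastforce
qed

theorem theorem2p1:
  fixes m p :: real
  assumes "CARD('n::finite) \<ge> 3"
    and "m < 1"
    and "(m > m_crit CARD('n) \<and> p \<ge> 1) \<or> (m \<le> m_crit CARD('n) \<and> p > p_crit CARD('n) m)"
  shows "\<exists>C1 C2. 0 < C1 \<and> 0 < C2 \<and>
    (\<forall>(\<Omega> :: (real^'n) set) (T :: ereal) (u0 :: real^'n \<Rightarrow> real) (u :: real \<Rightarrow> real^'n \<Rightarrow> real).
       open \<Omega> \<and> connected \<Omega> \<and> 0 < T \<and> Lp_loc p \<Omega> u0 \<and> local_weak_solution m T \<Omega> u0 u \<longrightarrow>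
       (\<forall>x0\<in>\<Omega>. \<forall>R0 t.
          0 < R0 \<and> (\<forall>y\<in>frontier \<Omega>. R0 \<le> dist x0 y) \<and> 0 < t \<and> ereal t < T \<longrightarrow>
          ennreal (u t x0) \<le>
            ennreal (C1 / t powr (real CARD('n) * theta CARD('n) m p)) *
              ennreal_powr (\<integral>\<^sup>+x\<in>ball x0 R0. ennreal (\<bar>u0 x\<bar> powr p) \<partial>lebesgue)
                (2 * theta CARD('n) m p)
            + ennreal (C2 * (t / R0\<^sup>2) powr (1 / (1 - m)))))"
proof -
  define n where "n = real CARD('n)"
  have n: "n \<ge> 3" using assms(1) by (simp add: n_def)
  have m: "m < 1" by fact
  \<comment> \<open>For \<open>m\<close> above the critical value, \<open>n(1-m) < 2\<close>; otherwise \<open>n(1-m)/2 \<ge> 1\<close>. So both cases of the hypothesis give the same two inequalities.\<close>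
  have p: "p \<ge> 1 \<and> 2 * p > n * (1 - m)"
  proof (cases "m > m_crit CARD('n)")
    case True
    then have "n * m > n - 2" using n by (simp add: m_crit_def n_def[symmetric] field_simps)
    moreover have "p \<ge> 1" using True assms(3) by auto
    ultimately show ?thesis by (simp add: right_diff_distrib)
  next
    case False
    then have "n * m \<le> n - 2" using n by (simp add: m_crit_def n_def[symmetric] field_simps)
    moreover have "p > n * (1 - m) / 2" using False assms(3) by (auto simp: p_crit_def n_def)
    ultimately show ?thesis by (simp add: right_diff_distrib)
  qed
  have p2: "p + m - 1 > 0"
  proof -
    have "3 * (1 - m) \<le> n * (1 - m)" using n m by (intro mult_right_mono) auto
    then have "2 * p > 3 * (1 - m)" using p by linarith
    then show ?thesis using m by simp
  qed
  define q where "q = 2 * p - n * (1 - m)"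
  have q: "q > 0" using p by (simp add: q_def)
  have th: "theta CARD('n) m p = 1 / q" by (simp add: theta_def q_def n_def)
  have p3: "2 * p > real DIM(real^'n) * (1 - m)" using p by (simp add: n_def)
  obtain C where C0: "C > 0" and C: "\<forall>(u :: real \<Rightarrow> real^'n \<Rightarrow> real) u0. unit_data m p u u0 \<longrightarrow> u 1 0 \<le> C"
    using smoothing_unit_scale[OF m conjunct1[OF p] p2 p3] by (elim exE conjE) (rule that)
  define C2 where "C2 = C * 4 powr (1 / (1 - m))"
  have C2: "C2 > 0" using C0 by (simp add: C2_def)
  have main: "ennreal (u t x0) \<le>
            ennreal (C / t powr (n * (1 / q))) *
              ennreal_powr (\<integral>\<^sup>+x\<in>ball x0 R0. ennreal (\<bar>u0 x\<bar> powr p) \<partial>lebesgue) (2 * (1 / q))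
            + ennreal (C2 * (t / R0\<^sup>2) powr (1 / (1 - m)))"
    if \<Omega>: "open \<Omega>" and sol: "local_weak_solution m T \<Omega> u0 u" and x0: "x0 \<in> \<Omega>"
      and R0: "0 < R0" "\<forall>y\<in>frontier \<Omega>. R0 \<le> dist x0 y" and t: "0 < t" "ereal t < T"
    for \<Omega> :: "(real^'n) set" and T u0 u x0 R0 t
  proof -
    define M where "M = (\<integral>\<^sup>+x\<in>ball x0 R0. ennreal (\<bar>u0 x\<bar> powr p) \<partial>lebesgue)"
    define K where "K = enn2real M"
    consider "u t x0 \<le> 0" | "M = \<infinity>" | "u t x0 > 0" "M \<noteq> \<infinity>" by fastforce
    then show ?thesis
    proof cases
      case 1
      then show ?thesis by (simp add: ennreal_neg)
    next
      case 2
      have "0 < C / t powr (n * (1 / q))" using C0 t by simp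
      then have "ennreal (C / t powr (n * (1 / q))) \<noteq> 0" unfolding ennreal_eq_0_iff by linarith
      then show ?thesis using 2 unfolding M_def[symmetric] by (simp add: ennreal_powr_def ennreal_mult_top)
    next
      case 3
      have MK: "M = ennreal K" using 3 by (simp add: K_def less_top)
      have K0: "K \<ge> 0" by (simp add: K_def)
      have bnd: "u t x0 \<le> C * (t / R\<^sup>2) powr (1 / (1 - m))"
        if R: "R > 0" "R \<le> R0 / 2" and small: "(R\<^sup>2 / t) powr (p / (1 - m)) * K \<le> R powr n" for R
      proof (rule bound_at_radius[OF m \<Omega> sol x0 t 3(1) R(1) _ C _ K0])
        have "cball x0 R \<subseteq> ball x0 R0" using R R0 by (auto simp: subset_iff)
        then show "cball x0 R \<subseteq> \<Omega>" using ball_subset_of_frontier_distance[OF x0 R0] by blast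
        have "ball x0 R \<subseteq> ball x0 R0" using R R0 by (intro subset_ball) simp
        then have "(\<integral>\<^sup>+x\<in>ball x0 R. ennreal (\<bar>u0 x\<bar> powr p) \<partial>lebesgue) \<le> M"
          unfolding M_def by (intro nn_integral_mono mult_left_mono) (auto simp: indicator_def)
        then show "(\<integral>\<^sup>+x\<in>ball x0 R. ennreal (\<bar>u0 x\<bar> powr p) \<partial>lebesgue) \<le> ennreal K" by (simp add: MK)
        show "(R\<^sup>2 / t) powr (p / (1 - m)) * K \<le> R ^ CARD('n)"
          using small R(1) by (simp add: n_def powr_realpow)
      qed
      define b where "b = 1 / (1 - m)"
      have b: "b > 0" using m by (simp add: b_def)
      have b1: "p / (1 - m) = p * b" by (simp add: b_def)
      have bq: "2 * (p * b) - n = q * b"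
      proof -
        have "(1 - m) * b = 1" using m by (simp add: b_def)
        then have "n = n * (1 - m) * b" by (simp add: mult.assoc)
        then show ?thesis by (simp add: q_def left_diff_distrib)
      qed
      have norm_mass: "(R\<^sup>2 / t) powr (p * b) * K \<le> R powr n \<longleftrightarrow> R powr (q * b) * K \<le> t powr (p * b)"
        if R: "R > 0" for R
      proof -
        have "(R\<^sup>2 / t) powr (p * b) = R powr (2 * (p * b)) / t powr (p * b)"
          using R t by (simp add: powr_divide powr_powr flip: powr_numeral)
        also have "R powr (2 * (p * b)) = R powr (q * b) * R powr n"
          unfolding powr_add[symmetric] bq[symmetric] by simp
        finally have e: "(R\<^sup>2 / t) powr (p * b) = R powr (q * b) * R powr n / t powr (p * b)" .
        have "x * c / d * K \<le> c \<longleftrightarrow> x * K \<le> d" if "c > 0" "d > 0" for x c d :: real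
        proof -
          have "x * c / d * K \<le> c \<longleftrightarrow> c * (x * K) \<le> c * d" using that by (simp add: field_simps)
          then show ?thesis using that by simp
        qed
        from this[of "R powr n" "t powr (p * b)" "R powr (q * b)"] show ?thesis unfolding e using R t by simp
      qed
      have "u t x0 \<le> C / t powr (n * (1 / q)) * K powr (2 * (1 / q)) + C2 * (t / R0\<^sup>2) powr b"
      proof (cases "(R0 / 2) powr (q * b) * K \<le> t powr (p * b)")
        case True
        have "u t x0 \<le> C * (t / (R0 / 2)\<^sup>2) powr (1 / (1 - m))"
        proof (rule bnd)
          have "0 < R0 / 2" using R0 by simp
          from norm_mass[OF this] True
          show "((R0 / 2)\<^sup>2 / t) powr (p / (1 - m)) * K \<le> (R0 / 2) powr n" unfolding b1 by blast
        qed (use R0 in auto)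
        also have "t / (R0 / 2)\<^sup>2 = 4 * (t / R0\<^sup>2)" by (simp add: power_divide)
        also have "C * (4 * (t / R0\<^sup>2)) powr (1 / (1 - m)) = C2 * (t / R0\<^sup>2) powr b"
          using t R0 unfolding C2_def b_def by (subst powr_mult) auto
        finally have "u t x0 \<le> C2 * (t / R0\<^sup>2) powr b" .
        moreover have "0 \<le> C / t powr (n * (1 / q)) * K powr (2 * (1 / q))" using C0 by simp
        ultimately show ?thesis by linarith
      next
        case False
        have Kpos: "K > 0"
        proof (rule ccontr)
          assume "\<not> K > 0"
          then show False using K0 False t by simp
        qed
        \<comment> \<open>The radius at which the rescaled mass equals \<open>1\<close>.\<close>
        define R where "R = (t powr (p * b) / K) powr (1 / (q * b))"
        have R: "R > 0" using t Kpos by (simp add: R_def)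
        have Rq: "R powr (q * b) = t powr (p * b) / K" using t Kpos q b by (simp add: R_def powr_powr)
        have "R powr (q * b) < (R0 / 2) powr (q * b)" unfolding Rq using False Kpos by (simp add: field_simps)
        then have "R < R0 / 2" using powr_less_cancel2[of "q * b" R "R0 / 2"] q b R R0 by simp
        then have "u t x0 \<le> C * (t / R\<^sup>2) powr (1 / (1 - m))"
        proof (intro bnd R)
          have "R powr (q * b) * K \<le> t powr (p * b)" unfolding Rq using Kpos by simp
          then show "(R\<^sup>2 / t) powr (p / (1 - m)) * K \<le> R powr n" unfolding b1 norm_mass[OF R] .
        qed simp
        also have "(t / R\<^sup>2) powr (1 / (1 - m)) = K powr (2 * (1 / q)) / t powr (n * (1 / q))"
        proof -
          have "(t / R\<^sup>2) powr b = t powr b / R powr (2 * b)"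
            using R t by (simp add: powr_divide powr_powr flip: powr_numeral)
          also have "R powr (2 * b) = (t powr (p * b) / K) powr (2 / q)"
            using q b t Kpos by (simp add: R_def powr_powr)
          also have "\<dots> = t powr (p * b * (2 / q)) / K powr (2 / q)"
            using t Kpos by (simp add: powr_divide powr_powr)
          also have "t powr (p * b * (2 / q)) = t powr b * t powr (n / q)"
          proof -
            have "p * b * (2 / q) = (q * b + n) / q" unfolding bq[symmetric] by simp
            also have "\<dots> = b + n / q" using q by (simp add: add_divide_distrib)
            finally show ?thesis by (simp add: powr_add)
          qed
          finally show ?thesis using t Kpos by (simp add: b_def)
        qed
        also have "C * (K powr (2 * (1 / q)) / t powr (n * (1 / q))) = C / t powr (n * (1 / q)) * K powr (2 * (1 / q))" by simp
        finally have "u t x0 \<le> C / t powr (n * (1 / q)) * K powr (2 * (1 / q))" .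
        moreover have "0 \<le> C2 * (t / R0\<^sup>2) powr b" using C2 by simp
        ultimately show ?thesis by linarith
      qed
      then have "ennreal (u t x0) \<le> ennreal (C / t powr (n * (1 / q)) * K powr (2 * (1 / q)) + C2 * (t / R0\<^sup>2) powr b)"
        by (rule ennreal_leI)
      also have "\<dots> = ennreal (C / t powr (n * (1 / q))) * ennreal (K powr (2 * (1 / q))) + ennreal (C2 * (t / R0\<^sup>2) powr b)"
      proof -
        have split: "ennreal (a * k + s) = ennreal a * ennreal k + ennreal s" if "a \<ge> 0" "k \<ge> 0" "s \<ge> 0" for a k s
          using that by (simp add: ennreal_mult)
        show ?thesis by (rule split) (use C0 C2 in simp_all)
      qed
      also have "ennreal (K powr (2 * (1 / q))) = ennreal_powr M (2 * (1 / q))"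
        using 3(2) by (simp add: ennreal_powr_def K_def)
      finally show ?thesis unfolding M_def b_def .
    qed
  qed
  show ?thesis
    unfolding th n_def[symmetric]
  proof (rule exI[of _ C], rule exI[of _ C2], intro conjI allI impI ballI C0 C2)
    fix \<Omega> :: "(real^'n) set" and T u0 u x0 R0 t
    assume "open \<Omega> \<and> connected \<Omega> \<and> 0 < T \<and> Lp_loc p \<Omega> u0 \<and> local_weak_solution m T \<Omega> u0 u"
      and "x0 \<in> \<Omega>" and "0 < R0 \<and> (\<forall>y\<in>frontier \<Omega>. R0 \<le> dist x0 y) \<and> 0 < t \<and> ereal t < T"
    then show "ennreal (u t x0) \<le>
            ennreal (C / t powr (n * (1 / q))) *
              ennreal_powr (\<integral>\<^sup>+x\<in>ball x0 R0. ennreal (\<bar>u0 x\<bar> powr p) \<partial>lebesgue) (2 * (1 / q))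
            + ennreal (C2 * (t / R0\<^sup>2) powr (1 / (1 - m)))"
      by (elim conjE) (rule main)
  qed
qed

end
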